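(* Let $\mathcal{F}$ be a real closed field and let $C_1, C_2$ be Dedekind cuts in $\mathcal{F}$ induced by the indiscernible sequences $\bar{\mathbf a} = \langle a_t : t \in I\rangle$ and $\bar{\mathbf b} = \langle b_s : s \in J\rangle$ of elements of $\mathcal{F}$, respectively. Then $C_2$ is positively equivalent to $C_1$ if and only if $\bar{\mathbf a}, \bar{\mathbf b}$ are not $\mathcal{F}$-perpendicular.
   Context: We work in the theory of real closed fields in the language $\langle +,\cdot,0,1,<\rangle$. Indiscernibility is with respect to this language. A cut in $\mathcal{F}$ is a pair $C=(C^-,C^+)$ with $C^-$ an initial segment of $\mathcal{F}$, $C^+$ an end segment, $C^-\cup C^+=\mathcal{F}$, $C^-\cap C^+=\emptyset$; it is Dedekind if $C^-$ has no maximum and $C^+$ has no minimum. If $\bar{\mathbf a}=\langle a_t:t\in I\rangle$ is a strictly increasing indiscernible sequence, the cut induced by $\bar{\mathbf a}$ in $\mathcal{F}$ is $(C^-,C^+)$ where $C^-$ is the downward closure of $\{a_t : t\in I\}$ in $\mathcal{F}$. An interval around a cut $C$ is an interval $(d,e)$ of $\mathcal{F}$ with $d\in C^-$, $e\in C^+$. Dedekind cuts $C_1,C_2$ are positively equivalent if there is a function $f$, definable in $\mathcal{F}$ with parameters from $\mathcal{F}$, which is strictly increasing from some interval $I_1$ around $C_1$ onto some interval $I_2$ around $C_2$ and respects the cuts, i.e. $f(I_1\cap C_1^-)=I_2\cap C_2^-$. For a formula $\varphi$, $\varphi^1=\varphi$ and $\varphi^0=\neg\varphi$. "For every large enough $t\in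 I$, $P(t)$" means: there is $t_0\in I$ with $P(t)$ for all $t\ge t_0$. Two indiscernible sequences $\langle a_t:t\in I\rangle$, $\langle b_s:s\in J\rangle$ with all entries in $\mathcal{F}$ are $\mathcal{F}$-perpendicular if for every formula $\varphi(x,y,\bar z)$ and every tuple $\bar d$ from $\mathcal{F}$ there is a truth value $\mathbf t\in\{0,1\}$ such that: for every large enough $t\in I$, for every large enough $s\in J$, $\models\varphi[a_t,b_s,\bar d]^{\mathbf t}$; and for every large enough $s\in J$, for every large enough $t\in I$, $\models\varphi[a_t,b_s,\bar d]^{\mathbf t}$.
   Formalization: Both sides of a Dedekind cut are required to be nonempty; with an empty side allowed the claim fails, e.g. for two equal indiscernible sequences cofinal in the field, since no interval lies around the cut. *)

theory Defs
  imports Complex_Main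
begin

class real_closed_field = linordered_field +
  assumes nonneg_is_square: "0 \<le> x \<Longrightarrow> \<exists>y. x = y * y"
    and odd_degree_has_root: "odd n \<Longrightarrow> c n \<noteq> 0 \<Longrightarrow> \<exists>x. (\<Sum>i\<le>n. c i * x ^ i) = 0"

text \<open>First-order logic with equality in the language of ordered rings; variables are
  natural numbers. The remaining connectives and the universal quantifier are definable.\<close>

datatype rcf_term = Var nat | Zero | One | Add rcf_term rcf_term | Mult rcf_term rcf_term

datatype rcf_formula =
    Equal rcf_term rcf_term
  | Less rcf_term rcf_term
  | Neg rcf_formula
  | Conj rcf_formula rcf_formula
  | Exists nat rcf_formula

primrec term_vars :: "rcf_term \<Rightarrow> nat set" where
  "term_vars (Var n) = {n}"
| "term_vars Zero = {}"
| "term_vars One = {}"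
| "term_vars (Add s t) = term_vars s \<union> term_vars t"
| "term_vars (Mult s t) = term_vars s \<union> term_vars t"

primrec free_vars :: "rcf_formula \<Rightarrow> nat set" where
  "free_vars (Equal s t) = term_vars s \<union> term_vars t"
| "free_vars (Less s t) = term_vars s \<union> term_vars t"
| "free_vars (Neg \<phi>) = free_vars \<phi>"
| "free_vars (Conj \<phi> \<psi>) = free_vars \<phi> \<union> free_vars \<psi>"
| "free_vars (Exists n \<phi>) = free_vars \<phi> - {n}"

primrec term_val :: "rcf_term \<Rightarrow> (nat \<Rightarrow> 'f::linordered_field) \<Rightarrow> 'f" where
  "term_val (Var n) e = e n"
| "term_val Zero e = 0"
| "term_val One e = 1"
| "term_val (Add s t) e = term_val s e + term_val t e"
| "term_val (Mult s t) e = term_val s e * term_val t e"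

primrec sat :: "rcf_formula \<Rightarrow> (nat \<Rightarrow> 'f::linordered_field) \<Rightarrow> bool" where
  "sat (Equal s t) e \<longleftrightarrow> term_val s e = term_val t e"
| "sat (Less s t) e \<longleftrightarrow> term_val s e < term_val t e"
| "sat (Neg \<phi>) e \<longleftrightarrow> \<not> sat \<phi> e"
| "sat (Conj \<phi> \<psi>) e \<longleftrightarrow> sat \<phi> e \<and> sat \<psi> e"
| "sat (Exists n \<phi>) e \<longleftrightarrow> (\<exists>x. sat \<phi> (e(n := x)))"

text \<open>\<^term>\<open>models \<phi> xs\<close> evaluates \<^term>\<open>\<phi>\<close> at the tuple \<^term>\<open>xs\<close>, the variable
  with index \<^term>\<open>i\<close> taking the value \<^term>\<open>xs ! i\<close>. It is only used when every free
  variable of \<^term>\<open>\<phi>\<close> is smaller than \<^term>\<open>length xs\<close>, so that the default value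
  \<^term>\<open>0\<close> is irrelevant.\<close>

definition models :: "rcf_formula \<Rightarrow> 'f::linordered_field list \<Rightarrow> bool" where
  "models \<phi> xs \<longleftrightarrow> sat \<phi> (\<lambda>i. if i < length xs then xs ! i else 0)"

definition indiscernible :: "('i::linorder \<Rightarrow> 'f::linordered_field) \<Rightarrow> bool" where
  "indiscernible a \<longleftrightarrow>
     (\<forall>\<phi> ts ss. sorted_wrt (<) ts \<and> sorted_wrt (<) ss \<and> length ts = length ss \<and>
        free_vars \<phi> \<subseteq> {..<length ts} \<longrightarrow>
        (models \<phi> (map a ts) \<longleftrightarrow> models \<phi> (map a ss)))"

type_synonym 'f cut = "'f set \<times> 'f set"

definition is_cut :: "'f::linordered_field cut \<Rightarrow> bool" where
  "is_cut C \<longleftrightarrow>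
     (\<forall>x y. x \<in> fst C \<and> y \<le> x \<longrightarrow> y \<in> fst C) \<and>
     (\<forall>x y. x \<in> snd C \<and> x \<le> y \<longrightarrow> y \<in> snd C) \<and>
     fst C \<union> snd C = UNIV \<and> fst C \<inter> snd C = {}"

text \<open>Both sides of a Dedekind cut are nonempty, as usual. Otherwise there would be no interval
  around the cut, and the cut would not even be positively equivalent to itself.\<close>

definition dedekind_cut :: "'f::linordered_field cut \<Rightarrow> bool" where
  "dedekind_cut C \<longleftrightarrow> is_cut C \<and> fst C \<noteq> {} \<and> snd C \<noteq> {} \<and>
     \<not> (\<exists>m\<in>fst C. \<forall>x\<in>fst C. x \<le> m) \<and>
     \<not> (\<exists>m\<in>snd C. \<forall>x\<in>snd C. m \<le> x)"

definition induced_cut :: "('i::linorder \<Rightarrow> 'f::linordered_field) \<Rightarrow> 'f cut" where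
  "induced_cut a = ({x. \<exists>t. x \<le> a t}, - {x. \<exists>t. x \<le> a t})"

definition interval_around :: "'f::linordered_field cut \<Rightarrow> 'f set \<Rightarrow> bool" where
  "interval_around C S \<longleftrightarrow> (\<exists>d\<in>fst C. \<exists>e\<in>snd C. S = {d<..<e})"

text \<open>The graph of the restriction of \<^term>\<open>f\<close> to \<^term>\<open>S\<close> is definable with parameters;
  the values of \<^term>\<open>f\<close> outside \<^term>\<open>S\<close> do not matter.\<close>

definition definable_on :: "'f::linordered_field set \<Rightarrow> ('f \<Rightarrow> 'f) \<Rightarrow> bool" where
  "definable_on S f \<longleftrightarrow>
     (\<exists>\<phi> ds. free_vars \<phi> \<subseteq> {..<2 + length ds} \<and>
        (\<forall>x y. models \<phi> (x # y # ds) \<longleftrightarrow> x \<in> S \<and> y = f x))"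

definition positively_equivalent ::
  "'f::linordered_field cut \<Rightarrow> 'f cut \<Rightarrow> bool" where
  "positively_equivalent C D \<longleftrightarrow>
     (\<exists>f S T. interval_around C S \<and> interval_around D T \<and> definable_on S f \<and>
        strict_mono_on S f \<and> f ` S = T \<and> f ` (S \<inter> fst C) = T \<inter> fst D)"

definition perpendicular ::
  "('i::linorder \<Rightarrow> 'f::linordered_field) \<Rightarrow> ('j::linorder \<Rightarrow> 'f) \<Rightarrow> bool" where
  "perpendicular a b \<longleftrightarrow>
     (\<forall>\<phi> ds. free_vars \<phi> \<subseteq> {..<2 + length ds} \<longrightarrow>
        (\<exists>tv. (\<forall>\<^sub>F t in at_top. \<forall>\<^sub>F s in at_top. models \<phi> (a t # b s # ds) = tv) \<and>
              (\<forall>\<^sub>F s in at_top. \<forall>\<^sub>F t in at_top. models \<phi> (a t # b s # ds) = tv)))"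

end

theory Submission
  imports Defs "HOL-Algebra.Algebraic_Closure_Type"
begin

hide_const (open) UnivPoly.coeff UnivPoly.monom Module.smult Polynomials.degree

text \<open>Non-perpendicularity means that some formula changes its truth value between the two iterated
  limits at the corner \<open>(C\<^sub>1, C\<^sub>2)\<close> approached from the lower left. By quantifier elimination the
  truth value there is determined by the signs of finitely many polynomials \<open>P(x, y)\<close>, so it suffices
  that every \<open>P\<close> has constant sign on a box \<open>(x\<^sub>0, C\<^sub>1) \<times> (y\<^sub>0, C\<^sub>2)\<close> unless the cuts are positively
  equivalent. By induction on the degree both partial derivatives of \<open>P\<close> have constant sign on
  such a box. If the signs agree, \<open>P\<close> is monotone towards the corner and the claim is clear. If
  they are opposite and the sign of \<open>P\<close> is not constant, then the zero set of \<open>P\<close> is the graph of an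
  increasing function of \<open>y\<close>, cofinal in \<open>C\<^sub>1\<close>. Being defined, increasing and onto is a first-order
  property of the endpoint of the interval, so by o-minimality it persists slightly beyond the Dedekind
  cut \<open>C\<^sub>2\<close>, which gives a positive equivalence.

  Quantifier elimination is obtained semantically, following Cohen and Hoermander: if two finite lists
  of univariate polynomials, closed under derivatives and remainders, have the same leading signs, then an
  order automorphism of the field carries the signs of one list to those of the other. This rests on
  the intermediate value theorem for polynomials, which follows from Laplace's proof that adjoining a square
  root of \<open>-1\<close> makes the field algebraically closed.\<close>

section \<open>Polynomials over the base field of an algebraic closure\<close>

text \<open>The axioms of \<open>real_closed_field\<close> only give square roots and roots in odd
  degree, so Laplace's argument has to descend from the algebraic closure to the field. In place of
  symmetric functions it uses products over the roots of \<open>p\<close>, which lie in the field,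
  then interpolation through infinitely many points and a polynomial square root. Quantifier
  elimination never produces a formula: a quantifier is passed because an order automorphism that
  matches signs carries witnesses to witnesses, in both directions as it is onto. The last obstacle
  is that nothing is known about \<open>P\<close> on the far side of the cuts, while a positive
  equivalence must be defined on both sides. The branch is therefore described without reference to
  a cut, as the first zero of \<open>P\<close> to the right of a fixed point, starting from a fixed
  left end; only the right end varies. What holds for all right ends below the cut then holds for
  one above it.\<close>

abbreviation ac_poly :: "'a::field poly \<Rightarrow> 'a alg_closure poly" where
  "ac_poly \<equiv> map_poly to_ac"

lemma ac_poly_add: "ac_poly (p + q) = ac_poly p + ac_poly q"
  by (rule poly_eqI) (simp add: coeff_map_poly)

lemma ac_poly_mult: "ac_poly (p * q) = ac_poly p * ac_poly q"
  by (rule poly_eqI) (simp add: coeff_map_poly coeff_mult to_ac_sum)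

lemma poly_ac_poly: "poly (ac_poly p) (to_ac x) = to_ac (poly p x)"
  by (induction p) (simp_all add: map_poly_pCons)

lemma degree_ac_poly [simp]: "degree (ac_poly p) = degree p"
  by (rule degree_map_poly) simp

lemma monic_splits_ac:
  fixes p :: "'a::field poly"
  assumes "lead_coeff p = 1"
  obtains z where "ac_poly p = (\<Prod>i<degree p. [:- z i, 1:])"
proof -
  have "ac_poly p \<noteq> 0"
    using assms by (metis degree_ac_poly coeff_map_poly coeff_0 to_ac_0 to_ac_1 zero_neq_one)
  then obtain A where A: "size A = degree p"
      "ac_poly p = smult (lead_coeff (ac_poly p)) (\<Prod>x\<in>#A. [:-x, 1:])"
    using alg_closed_imp_factorization[of "ac_poly p"] by auto
  obtain xs where xs: "A = mset xs" by (metis ex_mset)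
  have "(\<Prod>x\<in>#A. [:-x, 1:]) = prod_list (map (\<lambda>x. [:-x, 1:]) xs)"
    unfolding xs by (simp flip: prod_mset_prod_list)
  also have "\<dots> = (\<Prod>i<length xs. [:- (xs ! i), 1:])"
    by (simp add: prod.list_conv_set_nth atLeast0LessThan)
  finally show thesis
    using A assms xs by (intro that[of "\<lambda>i. xs ! i"]) (simp add: coeff_map_poly)
qed

lemma range_to_ac_prod: "(\<And>i. i \<in> I \<Longrightarrow> f i \<in> range to_ac) \<Longrightarrow> prod f I \<in> range to_ac"
proof (induction I rule: infinite_finite_induct)
  case (insert x F)
  then obtain a b where "f x = to_ac a" "prod f F = to_ac b" by (metis image_iff insertCI)
  with insert show ?case by (simp flip: to_ac_mult)
qed (auto intro: range_eqI[of _ _ 1])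

lemma range_to_ac_arith:
  assumes "x \<in> range to_ac" "y \<in> range to_ac"
  shows "x + y \<in> range to_ac" "x - y \<in> range to_ac" "x * y \<in> range to_ac" "x / y \<in> range to_ac"
  using assms by (auto simp flip: to_ac_add to_ac_diff to_ac_mult to_ac_divide)

lemma range_to_ac_sum: "(\<And>i. i \<in> I \<Longrightarrow> f i \<in> range to_ac) \<Longrightarrow> sum f I \<in> range to_ac"
  by (induction I rule: infinite_finite_induct)
    (auto intro: range_eqI[of _ _ 0] range_to_ac_arith)

text \<open>Up to sign and a power of the leading coefficient of \<open>q\<close>, the product is the resultant of
  \<open>p\<close> and \<open>q\<close>, so the Euclidean algorithm computes it inside the base field.\<close>

lemma prod_poly_roots_in_base:
  fixes p q :: "'a::field poly" and n :: nat
  assumes "ac_poly p = (\<Prod>i<n. [:- z i, 1:])"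
  shows "(\<Prod>i<n. poly (ac_poly q) (z i)) \<in> range to_ac"
  using assms
proof (induction "degree q" arbitrary: p q n z rule: less_induct)
  case less
  show ?case
  proof (cases "degree q = 0")
    case True
    then obtain c where "q = [:c:]" by (metis degree_eq_zeroE)
    then show ?thesis by (intro range_to_ac_prod) (simp add: map_poly_pCons)
  next
    case False
    define c where "c = lead_coeff q"
    define r where "r = smult (inverse c) q"
    define m where "m = degree r"
    have c: "c \<noteq> 0" using False by (auto simp: c_def)
    have "lead_coeff r = 1" using c by (simp add: r_def c_def)
    then obtain y where y: "ac_poly r = (\<Prod>i<m. [:- y i, 1:])"
      using monic_splits_ac[of r] m_def by blast
    have q: "q = smult c r" using c by (simp add: r_def)
    have "degree r = degree q" using c by (simp add: r_def)
    then have r0: "r \<noteq> 0" "degree r > 0" using False by auto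
    have root: "poly (ac_poly r) (y j) = 0" if "j < m" for j
      using that unfolding y by (auto simp: poly_prod)
    have "poly (ac_poly p) (y j) = poly (ac_poly (p mod r)) (y j)" if "j < m" for j
    proof -
      have "ac_poly p = ac_poly (p div r) * ac_poly r + ac_poly (p mod r)"
        by (simp flip: ac_poly_mult ac_poly_add)
      then show ?thesis using root[OF that] by simp
    qed
    then have mod: "(\<Prod>j<m. poly (ac_poly p) (y j)) = (\<Prod>j<m. poly (ac_poly (p mod r)) (y j))"
      by (intro prod.cong) auto
    have "degree (p mod r) < degree q"
      using degree_mod_less'[of r p] r0 \<open>degree r = degree q\<close>
      by (cases "p mod r = 0") auto
    then have IH: "(\<Prod>j<m. poly (ac_poly (p mod r)) (y j)) \<in> range to_ac"
      using less.hyps y by blast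
    have "poly (ac_poly q) (z i) = to_ac c * (\<Prod>j<m. z i - y j)" for i
      unfolding q by (simp add: map_poly_smult y poly_prod)
    then have "(\<Prod>i<n. poly (ac_poly q) (z i)) = (\<Prod>i<n. to_ac c) * (\<Prod>i<n. \<Prod>j<m. z i - y j)"
      by (simp add: prod.distrib)
    also have "(\<Prod>i<n. \<Prod>j<m. z i - y j) = (\<Prod>j<m. \<Prod>i<n. to_ac (-1) * (y j - z i))"
      by (subst prod.swap) simp
    also have "\<dots> = (\<Prod>j<m. \<Prod>i<n. to_ac (-1)) * (\<Prod>j<m. poly (ac_poly p) (y j))"
      unfolding less.prems by (simp add: prod.distrib poly_prod del: to_ac_minus)
    finally have "(\<Prod>i<n. poly (ac_poly q) (z i)) = (\<Prod>i<n. to_ac c) *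
        ((\<Prod>j<m. \<Prod>i<n. to_ac (-1)) * (\<Prod>j<m. poly (ac_poly (p mod r)) (y j)))"
      unfolding mod .
    also have "\<dots> \<in> range to_ac"
      by (rule range_to_ac_arith(3)[OF range_to_ac_prod range_to_ac_arith(3)[OF range_to_ac_prod IH]];
          (rule range_to_ac_prod)?; rule rangeI)
    finally show ?thesis .
  qed
qed

text \<open>Newton's divided differences: after subtracting the value at one point \<open>t\<close>
  of \<open>T\<close> and dividing by the factor with root \<open>t\<close>, the quotient takes base
  values at the other points of \<open>T\<close> and has smaller degree.\<close>

lemma poly_in_base_if_values_in_base:
  fixes P :: "'a::field alg_closure poly"
  assumes "infinite T" "\<And>t. t \<in> T \<Longrightarrow> poly P (to_ac t) \<in> range to_ac"
  shows "\<exists>p. P = ac_poly p"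
  using assms
proof (induction "degree P" arbitrary: P T rule: less_induct)
  case less
  obtain t where t: "t \<in> T" using less.prems(1) by fastforce
  obtain r where r: "poly P (to_ac t) = to_ac r" using less.prems(2)[OF t] by auto
  show ?case
  proof (cases "degree P = 0")
    case True
    then obtain c where "P = [:c:]" by (metis degree_eq_zeroE)
    with r have "P = ac_poly [:r:]" by (simp add: map_poly_pCons)
    then show ?thesis by blast
  next
    case False
    have "poly (P - [:to_ac r:]) (to_ac t) = 0" using r by simp
    then obtain Q where Q: "P - [:to_ac r:] = [:- to_ac t, 1:] * Q"
      by (metis poly_eq_0_iff_dvd dvdE)
    have P: "P = ac_poly [:- t, 1:] * Q + ac_poly [:r:]"
      using Q by (simp add: map_poly_pCons algebra_simps)
    have "Q \<noteq> 0" using P False by (auto simp: map_poly_pCons)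
    have "degree P = degree (P - [:to_ac r:])" using False
      by (metis degree_add_eq_left degree_pCons_0 gr0I diff_conv_add_uminus degree_minus)
    also have "\<dots> = 1 + degree Q"
      unfolding Q using \<open>Q \<noteq> 0\<close> by (subst Polynomial.degree_mult_eq) auto
    finally have deg: "degree Q < degree P" by simp
    have "poly Q (to_ac u) \<in> range to_ac" if u: "u \<in> T - {t}" for u
    proof -
      have "poly P (to_ac u) = to_ac (u - t) * poly Q (to_ac u) + to_ac r"
        by (subst P) (simp add: map_poly_pCons algebra_simps)
      then have "poly Q (to_ac u) = (poly P (to_ac u) - to_ac r) / to_ac (u - t)"
        using u by (simp del: to_ac_diff)
      then show ?thesis
        using less.prems(2)[of u] u by (auto intro!: range_to_ac_arith simp del: to_ac_diff)
    qed
    then obtain q where "Q = ac_poly q"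
      using less.hyps[OF deg, of "T - {t}"] less.prems(1) by auto
    then have "P = ac_poly ([:- t, 1:] * q + [:r:])"
      using P by (simp only: ac_poly_add ac_poly_mult)
    then show ?thesis by blast
  qed
qed

text \<open>Comparing coefficients of \<open>S * S\<close> downwards from the top determines those
  of \<open>S\<close> one at a time: the new one enters linearly with factor 2, which is invertible
  in characteristic 0.\<close>

lemma monic_sqrt_in_base:
  fixes S :: "'a::field_char_0 alg_closure poly"
  assumes monic: "lead_coeff S = 1" and sq: "S * S = ac_poly q"
  shows "\<exists>s. S = ac_poly s"
proof -
  let ?m = "degree S" and ?s = "coeff S"
  have top: "?s (?m - k) \<in> range to_ac" if "k \<le> ?m" for k
    using that
  proof (induction k rule: less_induct)
    case (less k)
    show ?case
    proof (cases "k = 0")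
      case True
      then show ?thesis using monic by (simp add: range_eqI[of _ _ 1])
    next
      case False
      \<comment> \<open>In this coefficient of \<open>S * S\<close> the unknown
        \<open>?s (?m - k)\<close> occurs twice, each time multiplied by the leading 1; the other
        products involve only coefficients of larger index, known by induction.\<close>
      let ?N = "?m + (?m - k)"
      let ?g = "\<lambda>i. ?s i * ?s (?N - i)"
      have "to_ac (coeff q ?N) = coeff (S * S) ?N"
        unfolding sq by (simp add: coeff_map_poly)
      also have "\<dots> = (\<Sum>i\<le>?N. ?g i)" by (simp add: coeff_mult)
      also have "\<dots> = (\<Sum>i\<in>{?m-k..?m}. ?g i)"
        by (rule sum.mono_neutral_right) (auto simp: not_le intro!: coeff_eq_0)
      also have "{?m-k..?m} = insert (?m-k) (insert ?m {?m-k<..<?m})"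
        using less.prems False by auto
      also have "(\<Sum>i\<in>insert (?m-k) (insert ?m {?m-k<..<?m}). ?g i) =
          2 * ?s (?m-k) + (\<Sum>i\<in>{?m-k<..<?m}. ?g i)"
        using less.prems False monic by (subst sum.insert; simp)+
      finally have "?s (?m-k) = (to_ac (coeff q ?N) - (\<Sum>i\<in>{?m-k<..<?m}. ?g i)) / to_ac 2"
        by simp
      moreover have "?g i \<in> range to_ac" if "i \<in> {?m-k<..<?m}" for i
      proof -
        have "?s (?m - (?m - i)) \<in> range to_ac" "?s (?m - (?m - (?N - i))) \<in> range to_ac"
          using that less.prems by (intro less.IH; force)+
        moreover have "?m - (?m - i) = i" "?m - (?m - (?N - i)) = ?N - i" using that by auto
        ultimately show ?thesis by (simp add: range_to_ac_arith)
      qed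
      then have "(\<Sum>i\<in>{?m-k<..<?m}. ?g i) \<in> range to_ac"
        by (rule range_to_ac_sum)
      ultimately show ?thesis
        by (simp only: range_to_ac_arith(4)[OF range_to_ac_arith(2)[OF rangeI] rangeI])
    qed
  qed
  have "?s i \<in> range to_ac" for i
  proof (cases "i \<le> ?m")
    case True
    then show ?thesis using top[of "?m - i"] by simp
  next
    case False
    then show ?thesis by (simp add: coeff_eq_0 range_eqI[of _ _ 0])
  qed
  then have "S = ac_poly (map_poly of_ac S)"
    by (intro poly_eqI) (simp add: coeff_map_poly to_ac_of_ac)
  then show ?thesis by blast
qed

section \<open>The intermediate value theorem\<close>

lemma ac_poly_diff: "ac_poly (p - q) = ac_poly p - ac_poly q"
  by (rule poly_eqI) (simp add: coeff_map_poly)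

lemma neg_if_pos_mult_neg: "c * d < 0 \<Longrightarrow> 0 < c \<Longrightarrow> d < 0" for c d :: "'a::linordered_idom"
  by (simp add: mult_less_0_iff)

text \<open>The homogenization of the monic polynomial with roots \<open>z i\<close>. For fixed
  \<open>u\<close> it exhibits the product as a polynomial in \<open>v\<close> whose coefficients
  are those of \<open>P\<close> times powers of \<open>u\<close>.\<close>

lemma prod_homogenize:
  fixes z :: "nat \<Rightarrow> 'a::field" and n :: nat
  defines "P \<equiv> \<Prod>i<n. [:- z i, 1:]"
  shows "(\<Prod>i<n. u - z i * v) = (\<Sum>k\<le>n. coeff P k * u ^ k * v ^ (n - k))"
proof -
  have deg: "degree P = n"
    unfolding P_def by (subst degree_prod_eq_sum_degree) auto
  have lead: "coeff P n = 1"
    using lead_coeff_prod[of "\<lambda>i. [:- z i, 1:]" "{..<n}"] by (simp flip: P_def add: deg)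
  show ?thesis
  proof (cases "v = 0")
    case True
    have "(\<Sum>k\<le>n. coeff P k * u ^ k * v ^ (n - k)) = (\<Sum>k\<in>{n}. coeff P k * u ^ k * v ^ (n - k))"
      by (rule sum.mono_neutral_right) (use True in auto)
    then show ?thesis using True lead by simp
  next
    case False
    have "(\<Prod>i<n. u - z i * v) = (\<Prod>i<n. v * (u / v - z i))"
      using False by (intro prod.cong) (auto simp: field_simps)
    also have "\<dots> = v ^ n * poly P (u / v)"
      by (simp add: prod.distrib P_def poly_prod)
    also have "\<dots> = (\<Sum>k\<le>n. coeff P k * u ^ k * v ^ (n - k))"
      unfolding poly_altdef deg sum_distrib_left
      using False by (intro sum.cong) (auto simp: power_divide power_diff field_simps)
    finally show ?thesis .
  qed
qed

text \<open>Ordered pairs lie below, above or on the diagonal. Products over ordered pairs therefore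
  give access only to the square of the product over unordered pairs.\<close>

lemma prod_square_symmetric:
  fixes g :: "nat \<Rightarrow> nat \<Rightarrow> 'a::comm_monoid_mult"
  assumes "\<And>i j. g i j = g j i"
  shows "(\<Prod>i<n. \<Prod>j<n. g i j) = (\<Prod>j<n. \<Prod>i<j. g i j) * (\<Prod>j<n. \<Prod>i<j. g i j) * (\<Prod>i<n. g i i)"
proof (induction n)
  case (Suc n)
  have "(\<Prod>j<n. g n j) = (\<Prod>i<n. g i n)" using assms by simp
  with Suc show ?case by (simp add: prod.distrib mult_ac)
qed simp

text \<open>Replaces the theorem on symmetric polynomials. At a base point \<open>t\<close>, the
  products of \<open>t - z i * z j\<close> over all ordered pairs and over the diagonal are both
  products of values of a base polynomial at the roots of \<open>p\<close>. Their quotient, defined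
  away from the finitely many zeros of \<open>D\<close>, gives base values of \<open>S * S\<close>;
  interpolation and the monic square root do the rest.\<close>

lemma pair_products_in_base:
  fixes p :: "'a::field_char_0 poly" and n :: nat
  assumes p: "ac_poly p = (\<Prod>i<n. [:- z i, 1:])"
  shows "\<exists>s. ac_poly s = (\<Prod>j<n. \<Prod>i<j. [:- (z i * z j), 1:])"
proof -
  define S where "S = (\<Prod>j<n. \<Prod>i<j. [:- (z i * z j), 1:])"
  define D where "D = (\<Prod>i<n. [:- (z i * z i), 1:])"
  have N: "(\<Prod>i<n. \<Prod>j<n. [:- (z i * z j), 1:]) = S * S * D"
    unfolding S_def D_def by (rule prod_square_symmetric) (simp add: mult.commute)
  have "poly (S * S) (to_ac t) \<in> range to_ac" if t: "poly D (to_ac t) \<noteq> 0" for t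
  proof -
    have "poly D (to_ac t) = (\<Prod>i<n. poly (ac_poly [:t, 0, -1:]) (z i))"
      unfolding D_def by (simp add: poly_prod map_poly_pCons)
    then have D: "poly D (to_ac t) \<in> range to_ac"
      using prod_poly_roots_in_base[OF p] by simp
    \<comment> \<open>As a polynomial in \<open>y\<close> this is the product of the factors
      \<open>t - z j * y\<close>.\<close>
    define q where "q = (\<Sum>k\<le>n. monom (coeff p k * t ^ k) (n - k))"
    have "ac_poly q = (\<Sum>k\<le>n. monom (coeff (ac_poly p) k * to_ac t ^ k) (n - k))"
      unfolding q_def by (rule poly_eqI) (simp add: coeff_map_poly Polynomial.coeff_sum to_ac_sum if_distrib cong: if_cong)
    then have q: "poly (ac_poly q) y = (\<Prod>j<n. to_ac t - z j * y)" for y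
      unfolding prod_homogenize p by (simp add: poly_sum poly_monom)
    have "poly (S * S * D) (to_ac t) = (\<Prod>i<n. poly (ac_poly q) (z i))"
      unfolding q N[symmetric] by (simp add: poly_prod mult.commute)
    then have "poly (S * S * D) (to_ac t) \<in> range to_ac"
      using prod_poly_roots_in_base[OF p] by simp
    moreover have "poly (S * S) (to_ac t) = poly (S * S * D) (to_ac t) / poly D (to_ac t)"
      using t by simp
    ultimately show ?thesis using D by (metis range_to_ac_arith(4))
  qed
  moreover have "infinite {t. poly D (to_ac t) \<noteq> 0}"
  proof
    have "D \<noteq> 0" unfolding D_def by (simp add: prod_zero_iff)
    then have "finite (to_ac -` {x. poly D x = 0} :: 'a set)"
      by (intro finite_vimageI poly_roots_finite inj_to_ac)
    moreover assume "finite {t. poly D (to_ac t) \<noteq> 0}"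
    ultimately have "finite (to_ac -` {x. poly D x = 0} \<union> {t. poly D (to_ac t) \<noteq> 0} :: 'a set)"
      by simp
    moreover have "to_ac -` {x. poly D x = 0} \<union> {t. poly D (to_ac t) \<noteq> 0} = UNIV" by auto
    ultimately show False by (metis infinite_UNIV_char_0)
  qed
  ultimately obtain q where q: "S * S = ac_poly q"
    using poly_in_base_if_values_in_base[of "{t. poly D (to_ac t) \<noteq> 0}" "S * S"] by auto
  have "lead_coeff S = 1" unfolding S_def by (simp add: lead_coeff_prod)
  then show ?thesis using monic_sqrt_in_base q S_def by metis
qed

section \<open>The field obtained by adjoining a square root of -1\<close>

context
  fixes \<iota> :: "'f::real_closed_field alg_closure"
  assumes iota: "\<iota> * \<iota> = -1"
begin

definition gaussian :: "'f alg_closure set" where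
  "gaussian = {to_ac a + \<iota> * to_ac b |a b. True}"

lemma gaussianI: "z = to_ac a + \<iota> * to_ac b \<Longrightarrow> z \<in> gaussian"
  by (auto simp: gaussian_def)

lemma gaussian_to_ac: "to_ac a \<in> gaussian"
  by (rule gaussianI[of _ a 0]) simp

lemma gaussian_add: "x \<in> gaussian \<Longrightarrow> y \<in> gaussian \<Longrightarrow> x + y \<in> gaussian"
  unfolding gaussian_def
  by (clarsimp, rule_tac x = "a + aa" in exI, rule_tac x = "b + ba" in exI) (simp add: algebra_simps)

lemma gaussian_mult:
  assumes "x \<in> gaussian" "y \<in> gaussian" shows "x * y \<in> gaussian"
proof -
  obtain a b c d where xy: "x = to_ac a + \<iota> * to_ac b" "y = to_ac c + \<iota> * to_ac d"
    using assms by (auto simp: gaussian_def)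
  have "x * y = to_ac a * to_ac c + (\<iota> * \<iota>) * to_ac b * to_ac d + \<iota> * (to_ac a * to_ac d + to_ac b * to_ac c)"
    unfolding xy by (simp only: ring_distribs ac_simps)
  then show ?thesis unfolding iota
    by (intro gaussianI[of _ "a * c - b * d" "a * d + b * c"]) simp
qed

lemma gaussian_diff: "x \<in> gaussian \<Longrightarrow> y \<in> gaussian \<Longrightarrow> x - y \<in> gaussian"
  using gaussian_add[of x "to_ac (-1) * y"] gaussian_mult[OF gaussian_to_ac[of "-1"]] by auto

text \<open>The half-angle formulas: with \<open>r\<close> the absolute value of \<open>z\<close>,
  the two parts of the root are square roots of \<open>(r + a) / 2\<close> and
  \<open>(r - a) / 2\<close>. Their relative sign has to be chosen to match
  \<open>b\<close>.\<close>

lemma gaussian_sqrt: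
  assumes "z \<in> gaussian"
  obtains w where "w \<in> gaussian" "w * w = z"
proof -
  obtain a b where z: "z = to_ac a + \<iota> * to_ac b" using assms by (auto simp: gaussian_def)
  obtain r' where "a * a + b * b = r' * r'"
    using nonneg_is_square[of "a * a + b * b"] by auto
  then obtain r where r: "a * a + b * b = r * r" "r \<ge> 0"
    by (metis abs_ge_zero abs_mult_self_eq)
  have "\<bar>a\<bar> * \<bar>a\<bar> \<le> a * a + b * b" by simp
  then have "\<bar>a\<bar> ^ 2 \<le> r ^ 2" unfolding r(1) power2_eq_square .
  then have "\<bar>a\<bar> \<le> r" using r(2) power2_le_imp_le by blast
  then obtain u v where uv: "(r + a) / 2 = u * u" "(r - a) / 2 = v * v"
    using nonneg_is_square[of "(r + a) / 2"] nonneg_is_square[of "(r - a) / 2"] by (auto simp: abs_le_iff)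
  have sq: "u * u - v * v = a" unfolding uv[symmetric] by (simp add: field_simps)
  have "(2 * u * v) * (2 * u * v) = 4 * ((u * u) * (v * v))" by simp
  also have "\<dots> = r * r - a * a" unfolding uv[symmetric] by (simp add: field_simps)
  also have "\<dots> = b * b" by (simp flip: r(1))
  finally have "2 * u * v = b \<or> 2 * u * v = - b" by (simp only: square_eq_iff)
  then obtain v' where v': "2 * u * v' = b" "v' * v' = v * v"
    by (metis minus_mult_minus minus_mult_right minus_minus)
  have "(to_ac u + \<iota> * to_ac v') * (to_ac u + \<iota> * to_ac v') =
      to_ac u * to_ac u + (\<iota> * \<iota>) * (to_ac v' * to_ac v') + \<iota> * (2 * to_ac u * to_ac v')"
    by (simp add: algebra_simps)
  also have "\<dots> = to_ac (u * u - v' * v') + \<iota> * to_ac (2 * u * v')"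
    unfolding iota by simp
  also have "\<dots> = z" unfolding v' sq z ..
  finally show ?thesis using that gaussianI by blast
qed

text \<open>The quadratic formula: the discriminant of the quadratic with roots \<open>x\<close> and
  \<open>y\<close> is the square of \<open>x - y\<close>, and it has a gaussian square root.\<close>

lemma gaussian_if_sum_prod:
  assumes "x + y \<in> gaussian" "x * y \<in> gaussian"
  shows "x \<in> gaussian"
proof -
  have "(x + y) * (x + y) - to_ac 4 * (x * y) \<in> gaussian"
    by (rule gaussian_diff[OF gaussian_mult[OF assms(1) assms(1)] gaussian_mult[OF gaussian_to_ac assms(2)]])
  then obtain w where w: "w \<in> gaussian" "w * w = (x + y) * (x + y) - to_ac 4 * (x * y)"
    using gaussian_sqrt by blast
  then have "w * w = (x - y) * (x - y)" by (simp add: algebra_simps)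
  then have "w = x - y \<or> w = - (x - y)" by (simp only: square_eq_iff)
  then have "x = to_ac (1/2) * (x + y + w) \<or> x = to_ac (1/2) * (x + y - w)"
    by (auto simp: field_simps)
  then show ?thesis
  proof (elim disjE)
    assume "x = to_ac (1/2) * (x + y + w)"
    then show ?thesis
      by (rule ssubst) (rule gaussian_mult[OF gaussian_to_ac gaussian_add[OF assms(1) w(1)]])
  next
    assume "x = to_ac (1/2) * (x + y - w)"
    then show ?thesis
      by (rule ssubst) (rule gaussian_mult[OF gaussian_to_ac gaussian_diff[OF assms(1) w(1)]])
  qed
qed

text \<open>Laplace's argument: if the degree is \<open>2 ^ k * m\<close> with \<open>m\<close> odd and \<open>k > 0\<close>, the polynomial
  whose roots are the products of two (shifted) roots has degree \<open>2 ^ (k - 1) * m'\<close> with \<open>m'\<close> odd.\<close>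

lemma monic_has_gaussian_root_aux:
  fixes p :: "'f poly"
  assumes "lead_coeff p = 1" "degree p = 2 ^ k * m" "odd m"
  shows "\<exists>z\<in>gaussian. poly (ac_poly p) z = 0"
  using assms
proof (induction k arbitrary: p m)
  case 0
  then obtain x where "poly p x = 0"
    using odd_degree_has_root[of "degree p" "coeff p"] by (auto simp: poly_altdef)
  then have "poly (ac_poly p) (to_ac x) = 0" by (simp add: poly_ac_poly)
  then show ?case using gaussian_to_ac by blast
next
  case (Suc k)
  define n where "n = degree p"
  obtain z where z: "ac_poly p = (\<Prod>i<n. [:- z i, 1:])"
    using monic_splits_ac Suc.prems n_def by blast
  have root: "poly (ac_poly p) (z i) = 0" if "i < n" for i
    unfolding z using that by (auto simp: poly_prod)
  \<comment> \<open>The roots are shifted by every natural number \<open>c\<close>; for each shift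
    the induction hypothesis makes the product of some pair of shifted roots gaussian.\<close>
  have "\<exists>i j. i < j \<and> j < n \<and> (z i + of_nat c) * (z j + of_nat c) \<in> gaussian" for c :: nat
  proof -
    let ?z = "\<lambda>i. z i + of_nat c"
    have "ac_poly (p \<circ>\<^sub>p [:- of_nat c, 1:]) = ac_poly p \<circ>\<^sub>p [:- of_nat c, 1:]"
      by (induction p) (simp_all add: pcompose_pCons ac_poly_add ac_poly_diff map_poly_smult map_poly_pCons)
    also have "\<dots> = (\<Prod>i<n. [:- ?z i, 1:])"
      unfolding z by (simp add: pcompose_prod pcompose_pCons)
    finally have "ac_poly (p \<circ>\<^sub>p [:- of_nat c, 1:]) = (\<Prod>i<n. [:- ?z i, 1:])" .
    from pair_products_in_base[OF this]
    obtain s where s: "ac_poly s = (\<Prod>j<n. \<Prod>i<j. [:- (?z i * ?z j), 1:])" ..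
    have "degree (\<Prod>i<j. [:- (?z i * ?z j), 1:]) = j" for j
      by (subst degree_prod_eq_sum_degree) auto
    moreover have "(\<Prod>i<j. [:- (?z i * ?z j), 1:]) \<noteq> 0" for j
      by (subst prod_zero_iff) auto
    ultimately have "degree s = (\<Sum>j<n. j)"
      unfolding degree_ac_poly[of s, symmetric] s by (subst degree_prod_eq_sum_degree) auto
    also have "\<dots> = n * (n - 1) div 2"
      by (simp add: Sum_Ico_nat lessThan_atLeast0)
    also have "\<dots> = 2 ^ k * (m * (n - 1))" using Suc.prems by (simp add: n_def)
    finally have "degree s = 2 ^ k * (m * (n - 1))" .
    moreover have "odd (m * (n - 1))"
    proof -
      have "even n" "n > 0" using Suc.prems by (auto simp: n_def elim: oddE)
      then show ?thesis using Suc.prems by simp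
    qed
    moreover have "lead_coeff s = 1"
    proof -
      have "to_ac (lead_coeff s) = lead_coeff (ac_poly s)" by (simp add: coeff_map_poly)
      also have "\<dots> = 1" unfolding s by (simp add: lead_coeff_prod)
      finally show ?thesis by (metis to_ac_1 to_ac_eq_iff)
    qed
    ultimately obtain y where y: "y \<in> gaussian" "poly (ac_poly s) y = 0"
      using Suc.IH by blast
    then show ?thesis by (auto simp: s poly_prod)
  qed
  then obtain I J where IJ: "\<And>c. I c < J c" "\<And>c. J c < n"
      "\<And>c. (z (I c) + of_nat c) * (z (J c) + of_nat c) \<in> gaussian" by metis
  have "range (\<lambda>c. (I c, J c)) \<subseteq> {..<n} \<times> {..<n}"
    using IJ by (auto intro: less_trans)
  then have "finite (range (\<lambda>c. (I c, J c)))" by (rule finite_subset) simp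
  then have "\<not> inj (\<lambda>c. (I c, J c))" using finite_imageD infinite_UNIV_nat by blast
  then obtain c d where cd: "c \<noteq> d" "I c = I d" "J c = J d" by (auto simp: inj_def)
  define x y where "x = z (I c)" and "y = z (J c)"
  have xy: "(x + of_nat c) * (y + of_nat c) \<in> gaussian" "(x + of_nat d) * (y + of_nat d) \<in> gaussian"
    using IJ(3)[of c] IJ(3)[of d] cd by (simp_all add: x_def y_def)
  have eq: "(x + of_nat c) * (y + of_nat c) - (x + of_nat d) * (y + of_nat d) =
      to_ac (of_nat c - of_nat d) * (x + y) + to_ac (of_nat c * of_nat c - of_nat d * of_nat d)"
    by (simp add: algebra_simps)
  have "x + y = to_ac (1 / (of_nat c - of_nat d)) * ((x + of_nat c) * (y + of_nat c) - (x + of_nat d) * (y + of_nat d)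
      - to_ac (of_nat c * of_nat c - of_nat d * of_nat d))"
    unfolding eq using cd(1) by simp
  also have "\<dots> \<in> gaussian"
    by (rule gaussian_mult[OF gaussian_to_ac gaussian_diff[OF gaussian_diff[OF xy] gaussian_to_ac]])
  finally have sum: "x + y \<in> gaussian" .
  have "x * y = (x + of_nat c) * (y + of_nat c) - to_ac (of_nat c) * (x + y) - to_ac (of_nat c * of_nat c)"
    by (simp add: algebra_simps)
  also have "\<dots> \<in> gaussian"
    by (rule gaussian_diff[OF gaussian_diff[OF xy(1) gaussian_mult[OF gaussian_to_ac sum]] gaussian_to_ac])
  finally have "x * y \<in> gaussian" .
  with sum have "x \<in> gaussian" by (rule gaussian_if_sum_prod)
  moreover have "poly (ac_poly p) x = 0" using root IJ x_def by (metis less_trans)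
  ultimately show ?case by blast
qed

lemma has_gaussian_root:
  fixes p :: "'f poly"
  assumes "degree p > 0"
  shows "\<exists>z\<in>gaussian. poly (ac_poly p) z = 0"
proof -
  let ?q = "smult (inverse (lead_coeff p)) p"
  have p0: "lead_coeff p \<noteq> 0" using assms by auto
  obtain k m where "degree p = 2 ^ k * m" "odd m"
    by (metis assms multiplicity_decompose'[of "degree p" 2] not_gr_zero not_is_unit_0
      odd_one even_zero dvd_refl)
  then have "\<exists>z\<in>gaussian. poly (ac_poly ?q) z = 0"
    using p0 by (intro monic_has_gaussian_root_aux[of _ k m]) auto
  then show ?thesis using p0 by (auto simp: map_poly_smult)
qed

end

text \<open>Induction on the degree, splitting off a root in the field or a pair of conjugate roots.
  A factor with the same sign at \<open>a\<close> and \<open>b\<close> leaves the sign change to the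
  cofactor. The sign change is expressed by a product, which is compatible with factorization and
  blind to direction.\<close>

theorem rcf_poly_IVT:
  fixes p :: "'f::real_closed_field poly"
  assumes "a < b" "poly p a < 0" "0 < poly p b"
  shows "\<exists>x. a < x \<and> x < b \<and> poly p x = 0"
proof -
  obtain \<iota> :: "'f alg_closure" where "\<iota> ^ 2 = -1" using nth_root_exists[of 2 "-1"] by auto
  then have \<iota>: "\<iota> * \<iota> = -1" by (simp add: power2_eq_square)
  have "\<exists>x. a < x \<and> x < b \<and> poly p x = 0" if "poly p a * poly p b < 0" for p
    using that
  proof (induction "degree p" arbitrary: p rule: less_induct)
    case less
    have "degree p > 0"
      using less.prems by (intro gr0I) (auto elim!: degree_eq_zeroE simp: mult_less_0_iff)
    then obtain u v where uv: "poly (ac_poly p) (to_ac u + \<iota> * to_ac v) = 0"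
      using has_gaussian_root[OF \<iota>] unfolding gaussian_def[OF \<iota>] by blast
    have p0: "p \<noteq> 0" using less.prems by auto
    show ?case
    proof (cases "v = 0")
      case True
      then have "poly p u = 0" using uv by (simp add: poly_ac_poly)
      then obtain q where q: "p = [:- u, 1:] * q" by (metis poly_eq_0_iff_dvd dvdE)
      show ?thesis
      proof (cases "a < u \<and> u < b")
        case True
        then show ?thesis using \<open>poly p u = 0\<close> by blast
      next
        case False
        have "poly p a \<noteq> 0" "poly p b \<noteq> 0" using less.prems by auto
        then have "(a - u) * (b - u) > 0"
          using False assms(1) q by (auto simp: zero_less_mult_iff not_less)
        moreover have "poly p a * poly p b = ((a - u) * (b - u)) * (poly q a * poly q b)"
          unfolding q by (simp add: algebra_simps)
        ultimately have "poly q a * poly q b < 0"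
          using less.prems by (metis neg_if_pos_mult_neg)
        moreover have "degree q < degree p"
          using p0 unfolding q by (subst Polynomial.degree_mult_eq) auto
        ultimately obtain x where "a < x" "x < b" "poly q x = 0" using less.hyps by blast
        then show ?thesis unfolding q by auto
      qed
    next
      case False
      \<comment> \<open>The quadratic whose roots are the given root and its conjugate.\<close>
      define r where "r = [:u * u + v * v, - 2 * u, 1:]"
      have r_pos: "poly r x > 0" for x
      proof -
        have "poly r x = (x - u) * (x - u) + v * v" by (simp add: r_def algebra_simps)
        also have "\<dots> > 0" using False by (subst sum_squares_gt_zero_iff) simp
        finally show ?thesis .
      qed
      have degr: "degree r = 2" by (simp add: r_def)
      have "r \<noteq> 0" using degr by auto
      then have "degree (p mod r) < 2"
        using degree_mod_less'[of r p] degr by (cases "p mod r = 0") auto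
      then obtain c d where cd: "p mod r = [:c, d:]"
        by (intro that[of "coeff (p mod r) 0" "coeff (p mod r) 1"] poly_eqI)
          (auto simp: coeff_pCons split: nat.split intro!: coeff_eq_0)
      have "poly (ac_poly r) (to_ac u + \<iota> * to_ac v) = (\<iota> * \<iota> + 1) * (to_ac v * to_ac v)"
        unfolding r_def by (simp add: map_poly_pCons algebra_simps)
      then have "poly (ac_poly r) (to_ac u + \<iota> * to_ac v) = 0" using \<iota> by simp
      moreover have "ac_poly p = ac_poly (p div r) * ac_poly r + ac_poly (p mod r)"
        by (simp flip: ac_poly_mult ac_poly_add)
      ultimately have "poly (ac_poly [:c, d:]) (to_ac u + \<iota> * to_ac v) = 0" using uv cd by simp
      then have lin: "to_ac (c + u * d) = - \<iota> * to_ac (v * d)"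
        by (simp add: map_poly_pCons algebra_simps eq_neg_iff_add_eq_0)
      \<comment> \<open>Squaring leads to a vanishing sum of two squares in the ordered field, so
        both parts vanish; linear independence of 1 and the imaginary unit need not be known
        beforehand.\<close>
      then have "to_ac (c + u * d) * to_ac (c + u * d) = (\<iota> * \<iota>) * (to_ac (v * d) * to_ac (v * d))"
        by (simp only:) (simp add: algebra_simps)
      then have "to_ac ((c + u * d) * (c + u * d)) = to_ac (- ((v * d) * (v * d)))"
        unfolding \<iota> by (simp only: to_ac_mult to_ac_minus) simp
      then have "(c + u * d) * (c + u * d) + (v * d) * (v * d) = 0"
        unfolding to_ac_eq_iff by simp
      then have "c + u * d = 0 \<and> v * d = 0" by (simp only: sum_squares_eq_zero_iff)
      then have "p mod r = 0" using False cd by auto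
      then obtain q where q: "p = r * q" by auto
      have "poly p a * poly p b = (poly r a * poly r b) * (poly q a * poly q b)"
        unfolding q by (simp add: algebra_simps)
      then have "poly q a * poly q b < 0"
        using less.prems r_pos by (metis neg_if_pos_mult_neg mult_pos_pos)
      moreover have "degree q < degree p"
        using p0 degr unfolding q by (subst Polynomial.degree_mult_eq) auto
      ultimately obtain x where "a < x" "x < b" "poly q x = 0" using less.hyps by blast
      then show ?thesis unfolding q by auto
    qed
  qed
  then show ?thesis using assms by (simp add: mult_neg_pos)
qed

section \<open>Monotonicity of polynomials\<close>

lemma finite_avoid_nhd:
  fixes u :: "'a::linordered_field"
  assumes "finite Z" "u \<notin> Z"
  obtains d where "d > 0" "\<And>z. z \<in> Z \<Longrightarrow> z < u - d \<or> u + d < z"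
proof -
  have "\<exists>d>0. \<forall>z\<in>Z. z < u - d \<or> u + d < z"
    using assms
  proof (induction Z)
    case (insert y Z)
    then obtain d where d: "d > 0" "\<forall>z\<in>Z. z < u - d \<or> u + d < z" by auto
    define e where "e = min d (\<bar>y - u\<bar> / 2)"
    have "e > 0" using insert.prems d by (auto simp: e_def)
    moreover have "y < u - e \<or> u + e < y"
      using insert.prems d(1) by (cases "y < u") (auto simp: e_def min_def field_simps)
    moreover have "\<forall>z\<in>Z. z < u - e \<or> u + e < z" using d by (force simp: e_def min_def)
    ultimately show ?case by blast
  qed (auto intro: exI[of _ 1])
  then show thesis using that by blast
qed

lemma rcf_poly_IVT_value:
  fixes p :: "'f::real_closed_field poly"
  assumes "a < b" "poly p a < c \<and> c < poly p b \<or> poly p b < c \<and> c < poly p a"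
  shows "\<exists>x. a < x \<and> x < b \<and> poly p x = c"
  using assms rcf_poly_IVT[of a b "p - [:c:]"] rcf_poly_IVT[of a b "[:c:] - p"] by auto

lemma poly_sgn_eq_if_no_root:
  fixes p :: "'f::real_closed_field poly"
  assumes "a \<le> b" "\<And>z. a \<le> z \<Longrightarrow> z \<le> b \<Longrightarrow> poly p z \<noteq> 0"
  shows "sgn (poly p a) = sgn (poly p b)"
proof (rule ccontr)
  assume neq: "\<not> ?thesis"
  have "poly p a \<noteq> 0" "poly p b \<noteq> 0" using assms by auto
  then have "a < b" using assms(1) neq by (cases "a = b") auto
  then show False
    using rcf_poly_IVT[of a b p] rcf_poly_IVT[of a b "- p"] neq assms(2) \<open>poly p a \<noteq> 0\<close> \<open>poly p b \<noteq> 0\<close>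
    by (cases "poly p a < 0"; cases "poly p b < 0") (auto simp: sgn_if not_less)
qed

text \<open>Dividing \<open>p - [:poly p u:]\<close> by the factor with root \<open>u\<close> leaves
  a polynomial \<open>q\<close> whose value at \<open>u\<close> is the derivative of
  \<open>p\<close> there. As \<open>q\<close> has finitely many roots, it stays positive near
  \<open>u\<close>.\<close>

lemma poly_local_increase:
  fixes p :: "'f::real_closed_field poly"
  assumes "poly (pderiv p) u > 0"
  obtains d where "d > 0" "\<And>x. u < x \<Longrightarrow> x < u + d \<Longrightarrow> poly p u < poly p x"
    "\<And>x. u - d < x \<Longrightarrow> x < u \<Longrightarrow> poly p x < poly p u"
proof -
  have "poly (p - [:poly p u:]) u = 0" by simp
  then obtain q where q: "p - [:poly p u:] = [:- u, 1:] * q" by (metis poly_eq_0_iff_dvd dvdE)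
  have "pderiv p = pderiv (p - [:poly p u:])" by (simp add: pderiv_diff)
  also have "poly \<dots> u = poly q u" unfolding q pderiv_mult by (simp add: pderiv_pCons)
  finally have qu: "poly q u > 0" using assms by simp
  then have "q \<noteq> 0" by auto
  have "u \<notin> {z. poly q z = 0}" using qu by simp
  from finite_avoid_nhd[OF poly_roots_finite[OF \<open>q \<noteq> 0\<close>] this]
  obtain d where d: "d > 0" "\<And>z. poly q z = 0 \<Longrightarrow> z < u - d \<or> u + d < z"
    unfolding mem_Collect_eq by metis
  have eq: "poly p x = poly p u + (x - u) * poly q x" for x
    using arg_cong[OF q, of "\<lambda>r. poly r x"] by (simp add: algebra_simps)
  have pos: "poly q x > 0" if "u - d < x" "x < u + d" for x
  proof -
    have "sgn (poly q x) = sgn (poly q u)"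
    proof (cases "x \<le> u")
      case True
      then show ?thesis using that d by (intro poly_sgn_eq_if_no_root) force+
    next
      case False
      then show ?thesis using that d by (intro poly_sgn_eq_if_no_root[symmetric]) force+
    qed
    then show ?thesis using qu by (metis sgn_1_pos)
  qed
  show thesis
  proof
    show "d > 0" by (rule d(1))
    show "poly p u < poly p x" if "u < x" "x < u + d" for x
      using pos[of x] that d(1) by (subst eq[of x]) simp
    show "poly p x < poly p u" if "u - d < x" "x < u" for x
      using pos[of x] that d(1) by (subst eq[of x]) (simp add: mult_neg_pos)
  qed
qed

text \<open>A Rolle argument. If \<open>p\<close> did not grow, \<open>q\<close> would have a first
  zero \<open>w\<close> after its zero \<open>u\<close>; it is positive just to the right of
  \<open>u\<close> and negative just to the left of \<open>w\<close>, but has no zero in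
  between.\<close>

lemma poly_increasing_closed:
  fixes p :: "'f::real_closed_field poly"
  assumes "u < v" and pos: "\<And>x. u \<le> x \<Longrightarrow> x \<le> v \<Longrightarrow> poly (pderiv p) x > 0"
  shows "poly p u < poly p v"
proof (rule ccontr)
  assume neg: "\<not> ?thesis"
  define q where "q = p - [:poly p u:]"
  have dq: "pderiv q = pderiv p" by (simp add: q_def pderiv_diff)
  have "q \<noteq> 0" using pos[of u] assms(1) dq by auto
  have qu: "poly q u = 0" and qv: "poly q v \<le> 0" using neg by (auto simp: q_def)
  have "poly (pderiv q) u > 0" using pos[of u] assms(1) dq by auto
  then obtain d where d: "d > 0" "\<And>x. u < x \<Longrightarrow> x < u + d \<Longrightarrow> poly q u < poly q x"
    by (rule poly_local_increase) blast
  define W where "W = {w. u < w \<and> w \<le> v \<and> poly q w = 0}"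
  have "finite W" unfolding W_def using poly_roots_finite[OF \<open>q \<noteq> 0\<close>] by simp
  have "W \<noteq> {}"
  proof (cases "poly q v = 0")
    case True
    then show ?thesis using assms(1) by (auto simp: W_def)
  next
    case False
    define x where "x = min ((u + v) / 2) (u + d / 2)"
    have x: "u < x" "x < v" "x < u + d" using assms(1) d(1) by (auto simp: x_def min_def field_simps)
    then show ?thesis
      using rcf_poly_IVT[of x v "- q"] d(2)[OF x(1,3)] qu qv False unfolding W_def by force
  qed
  define w where "w = Min W"
  have w: "u < w" "w \<le> v" "poly q w = 0"
    using Min_in[OF \<open>finite W\<close> \<open>W \<noteq> {}\<close>] by (auto simp: w_def W_def)
  have no: "poly q x \<noteq> 0" if "u < x" "x < w" for x
    using Min_le[OF \<open>finite W\<close>, of x] that w by (auto simp: w_def W_def)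
  have "poly (pderiv q) w > 0" using pos[of w] w dq by auto
  then obtain e where e: "e > 0" "\<And>x. w - e < x \<Longrightarrow> x < w \<Longrightarrow> poly q x < poly q w"
    by (rule poly_local_increase) blast
  define x where "x = min ((u + w) / 2) (u + d / 2)"
  have x: "u < x" "x < w" "x < u + d" using w(1) d(1) by (auto simp: x_def min_def field_simps)
  define y where "y = max ((x + w) / 2) (w - e / 2)"
  have y: "x < y" "y < w" "w - e < y" using x e(1) by (auto simp: y_def max_def field_simps)
  have "sgn (poly q x) = sgn (poly q y)"
    using x y no by (intro poly_sgn_eq_if_no_root) auto
  moreover have "poly q x > 0" using d(2)[OF x(1,3)] qu by simp
  moreover have "poly q y < 0" using e(2)[OF y(3,2)] w by simp
  ultimately show False by simp
qed

text \<open>The derivative may vanish at the two ends. Inside, growth is strict; an end value on the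
  wrong side would force \<open>p\<close> to take an intermediate value at a point where strict
  growth forbids it.\<close>

lemma poly_increasing:
  fixes p :: "'f::real_closed_field poly"
  assumes ab: "a < b" and pos: "\<And>x. a < x \<Longrightarrow> x < b \<Longrightarrow> poly (pderiv p) x > 0"
  shows "poly p a < poly p b"
proof -
  have mono: "poly p x < poly p y" if "a < x" "x < y" "y < b" for x y
    using that pos by (intro poly_increasing_closed) auto
  have a: "poly p a \<le> poly p x" if ax: "a < x" "x < b" for x
  proof (rule ccontr)
    assume "\<not> ?thesis"
    then have "poly p x < poly p a" by simp
    then have m: "poly p x < (poly p x + poly p a) / 2" "(poly p x + poly p a) / 2 < poly p a"
      by (simp_all add: field_simps)
    then obtain y where "a < y" "y < x" "poly p y = (poly p x + poly p a) / 2"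
      using rcf_poly_IVT_value[of a x p "(poly p x + poly p a) / 2"] ax by blast
    then show False using m mono[of y x] that \<open>poly p x < poly p a\<close> by simp
  qed
  have b: "poly p x \<le> poly p b" if ax: "a < x" "x < b" for x
  proof (rule ccontr)
    assume "\<not> ?thesis"
    then have "poly p b < poly p x" by simp
    then have m: "poly p b < (poly p x + poly p b) / 2" "(poly p x + poly p b) / 2 < poly p x"
      by (simp_all add: field_simps)
    then obtain y where "x < y" "y < b" "poly p y = (poly p x + poly p b) / 2"
      using rcf_poly_IVT_value[of x b p "(poly p x + poly p b) / 2"] ax by blast
    then show False using m mono[of x y] that \<open>poly p b < poly p x\<close> by simp
  qed
  define x y where "x = (2 * a + b) / 3" and "y = (a + 2 * b) / 3"
  have "a < x" "x < y" "y < b" using ab by (auto simp: x_def y_def field_simps)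
  then show ?thesis using mono[of x y] a[of x] b[of y] by simp
qed

lemma poly_inj_if_pderiv_nonzero:
  fixes p :: "'f::real_closed_field poly"
  assumes "a < b" "\<And>x. a \<le> x \<Longrightarrow> x \<le> b \<Longrightarrow> poly (pderiv p) x \<noteq> 0"
  shows "poly p a \<noteq> poly p b"
proof (cases "poly (pderiv p) a > 0")
  case True
  have "poly (pderiv p) x > 0" if "a \<le> x" "x \<le> b" for x
    using poly_sgn_eq_if_no_root[of a x "pderiv p"] assms that True
    by (metis order_trans sgn_greater)
  then show ?thesis using poly_increasing[of a b p] assms by simp
next
  case False
  then have "poly (pderiv p) a < 0" using assms by force
  have "poly (pderiv p) x < 0" if "a \<le> x" "x \<le> b" for x
    using poly_sgn_eq_if_no_root[of a x "pderiv p"] assms that \<open>poly (pderiv p) a < 0\<close>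
    by (metis order_trans sgn_less)
  then show ?thesis using poly_increasing[of a b "- p"] assms by (simp add: pderiv_minus)
qed

lemma poly_unbounded:
  fixes p :: "'a::linordered_field poly"
  assumes "degree p > 0"
  obtains N where "\<And>x. N \<le> \<bar>x\<bar> \<Longrightarrow> B \<le> \<bar>poly p x\<bar>"
proof -
  have "\<exists>N. \<forall>x. N \<le> \<bar>x\<bar> \<longrightarrow> B \<le> \<bar>poly p x\<bar>"
    using assms
  proof (induction p arbitrary: B)
    case (pCons a p)
    obtain c N where c: "c > 0" "\<And>x. N \<le> \<bar>x\<bar> \<Longrightarrow> c \<le> \<bar>poly p x\<bar>"
    proof (cases "degree p = 0")
      case True
      then obtain b where "p = [:b:]" by (metis degree_eq_zeroE)
      with pCons.prems show thesis using that[of "\<bar>b\<bar>" 0] by (auto split: if_splits)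
    next
      case False
      then show thesis using pCons.IH[of 1] that[of 1] by auto
    qed
    have "B \<le> \<bar>poly (pCons a p) x\<bar>" if x: "max N ((\<bar>a\<bar> + \<bar>B\<bar>) / c) \<le> \<bar>x\<bar>" for x
    proof -
      have "\<bar>a\<bar> + \<bar>B\<bar> \<le> \<bar>x\<bar> * c" using x c(1) by (simp add: field_simps)
      also have "\<dots> \<le> \<bar>x\<bar> * \<bar>poly p x\<bar>" using c(2)[of x] x by (intro mult_left_mono) auto
      also have "\<dots> = \<bar>x * poly p x\<bar>" by (simp add: abs_mult)
      finally show ?thesis by simp
    qed
    then show ?case by blast
  qed simp
  then show thesis using that by blast
qed

lemma order_automorphism_move:
  fixes a b c c' :: "'f::linordered_field"
  assumes "a < c" "c < b" "a < c'" "c' < b"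
  obtains m where "strict_mono m" "surj m" "m c = c'" "\<And>x. x \<le> a \<or> b \<le> x \<Longrightarrow> m x = x"
proof -
  define s t where "s = (c' - a) / (c - a)" and "t = (b - c') / (b - c)"
  have s: "s > 0" "s * (c - a) = c' - a" and t: "t > 0" "t * (b - c) = b - c'"
    using assms by (simp_all add: s_def t_def)
  define m where "m = (\<lambda>x. if x \<le> a \<or> b \<le> x then x
    else if x \<le> c then a + s * (x - a) else b - t * (b - x))"
  have l: "m x = a + s * (x - a)" "a < m x" "m x \<le> c'" if "a < x" "x \<le> c" for x
  proof -
    show m: "m x = a + s * (x - a)" using that assms by (auto simp: m_def)
    have "0 < s * (x - a)" "s * (x - a) \<le> s * (c - a)"
      using that s(1) by (auto intro: mult_left_mono)
    then show "a < m x" "m x \<le> c'" unfolding m s(2) by linarith+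
  qed
  have r: "m x = b - t * (b - x)" "m x < b" "c' < m x" if "c < x" "x < b" for x
  proof -
    show m: "m x = b - t * (b - x)" using that assms by (auto simp: m_def)
    have "0 < t * (b - x)" "t * (b - x) < t * (b - c)"
      using that t(1) by (auto intro: mult_strict_left_mono)
    then show "m x < b" "c' < m x" unfolding m t(2) by linarith+
  qed
  have o: "m x = x" if "x \<le> a \<or> b \<le> x" for x using that by (auto simp: m_def)
  have "m x < m y" if xy: "x < y" for x y
  proof -
    consider "x \<le> a \<or> b \<le> x" | "a < x" "x \<le> c" | "c < x" "x < b" by linarith
    then show ?thesis
    proof cases
      case 1
      then have "m x = x" by (rule o)
      consider "y \<le> a \<or> b \<le> y" | "x \<le> a" "a < y" "y \<le> c" | "x \<le> a" "c < y" "y < b"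
        using 1 xy by linarith
      then show ?thesis
        using \<open>m x = x\<close> o[of y] l(2)[of y] r(3)[of y] that assms by cases auto
    next
      case 2
      note x = l[OF 2]
      consider "b \<le> y" | "c < y" "y < b" | "a < y" "y \<le> c" using 2 xy by linarith
      then show ?thesis
      proof cases
        case 3
        then show ?thesis using x(1) l(1)[OF 3] that s(1) by simp
      qed (use x(3) o[of y] r(3)[of y] assms in auto)
    next
      case 3
      note x = r[OF 3]
      consider "b \<le> y" | "c < y" "y < b" using 3 xy by linarith
      then show ?thesis
      proof cases
        case 2
        then show ?thesis using x(1) r(1)[OF 2] that t(1) by simp
      qed (use x(2) o[of y] in auto)
    qed
  qed
  then have "strict_mono m" by (simp add: strict_mono_def)
  moreover have "\<exists>x. m x = y" for y
  proof -
    consider "y \<le> a \<or> b \<le> y" | "a < y" "y \<le> c'" | "c' < y" "y < b" by linarith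
    then show ?thesis
    proof cases
      case 2
      have "(y - a) / s \<le> c - a" using 2 s by (simp add: pos_divide_le_eq mult.commute)
      moreover have "(y - a) / s > 0" using 2 s(1) by simp
      ultimately have "m (a + (y - a) / s) = y" using l(1)[of "a + (y - a) / s"] s(1) by simp
      then show ?thesis by blast
    next
      case 3
      have "(b - y) / t < b - c" using 3 t by (simp add: pos_divide_less_eq mult.commute)
      moreover have "(b - y) / t > 0" using 3 t(1) by simp
      ultimately have "m (b - (b - y) / t) = y" using r(1)[of "b - (b - y) / t"] t(1) by simp
      then show ?thesis by blast
    qed (use o in blast)
  qed
  moreover have "m c = c'" using l(1)[of c] s(2) assms by simp
  ultimately show thesis using that[of m] o by (metis surjI surj_def)
qed

section \<open>Transfer of signs along order automorphisms\<close>

text \<open>Between \<open>x\<close> and the nearest point of \<open>Z\<close> on its left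
  \<open>f\<close> is increasing, so it has a zero there or is still nonnegative at that point;
  without such a point \<open>f\<close> is unbounded to the left and must have a zero. Positivity at
  \<open>x\<close> is thus certified by a zero or by a sign on \<open>Z\<close>, and both can be
  transported.\<close>

lemma poly_left_of_positive:
  fixes f :: "'f::real_closed_field poly"
  assumes Z: "finite Z" and df: "pderiv f \<noteq> 0" "\<And>z. poly (pderiv f) z = 0 \<Longrightarrow> z \<in> Z"
    and x: "x \<notin> Z" "poly (pderiv f) x > 0" "poly f x > 0"
  shows "(\<exists>r<x. poly f r = 0 \<and> (\<forall>z\<in>Z. z < r \<or> x < z)) \<or>
    (\<exists>u\<in>Z. u < x \<and> 0 \<le> poly f u \<and> (\<forall>z\<in>Z. z \<le> u \<or> x < z))"
proof -
  have pos: "poly (pderiv f) y > 0" if "y \<le> x" "\<And>z. z \<in> Z \<Longrightarrow> z < y \<or> x < z" for y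
  proof -
    have "sgn (poly (pderiv f) y) = sgn (poly (pderiv f) x)"
      using that df(2) by (intro poly_sgn_eq_if_no_root) (assumption | metis not_less)+
    then show ?thesis using x(2) by (metis sgn_greater)
  qed
  show ?thesis
  proof (cases "\<exists>z\<in>Z. z < x")
    case False
    then have Zx: "x < z" if "z \<in> Z" for z using that x(1) by (metis linorder_cases)
    have "degree f > 0" using df(1) by (simp add: pderiv_eq_0_iff)
    then obtain N where N: "\<And>y. N \<le> \<bar>y\<bar> \<Longrightarrow> \<bar>poly f x\<bar> \<le> \<bar>poly f y\<bar>" using poly_unbounded by blast
    define y where "y = - (\<bar>N\<bar> + \<bar>x\<bar> + 1)"
    have y: "y < x" "N \<le> \<bar>y\<bar>" by (auto simp: y_def)
    have "poly f y < poly f x"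
      using y pos Zx by (intro poly_increasing) auto
    moreover have "\<bar>poly f x\<bar> \<le> \<bar>poly f y\<bar>" using N y(2) by blast
    ultimately have "poly f y < 0" using x(3) by linarith
    then obtain r where "y < r" "r < x" "poly f r = 0"
      using rcf_poly_IVT[of y x f] y x(3) by blast
    then show ?thesis using Zx by blast
  next
    case True
    define u where "u = Max {z\<in>Z. z < x}"
    have "u \<in> {z\<in>Z. z < x}" unfolding u_def by (rule Max_in) (use Z True in auto)
    then have u: "u \<in> Z" "u < x" by auto
    have uz: "z \<le> u \<or> x < z" if "z \<in> Z" for z
      using Max_ge[of "{z\<in>Z. z < x}" z] Z that x(1) by (cases "z < x") (auto simp: u_def)
    show ?thesis
    proof (cases "0 \<le> poly f u")
      case True
      then show ?thesis using u uz by blast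
    next
      case False
      then obtain r where "u < r" "r < x" "poly f r = 0"
        using rcf_poly_IVT[of u x f] u x(3) by auto
      then show ?thesis using uz by (meson le_less_trans)
    qed
  qed
qed

lemma poly_right_of_negative:
  fixes f :: "'f::real_closed_field poly"
  assumes Z: "finite Z" and df: "pderiv f \<noteq> 0" "\<And>z. poly (pderiv f) z = 0 \<Longrightarrow> z \<in> Z"
    and x: "x \<notin> Z" "poly (pderiv f) x > 0" "poly f x < 0"
  shows "(\<exists>r>x. poly f r = 0 \<and> (\<forall>z\<in>Z. z < x \<or> r < z)) \<or>
    (\<exists>u\<in>Z. x < u \<and> poly f u \<le> 0 \<and> (\<forall>z\<in>Z. z < x \<or> u \<le> z))"
proof -
  \<comment> \<open>Point reflection exchanges left with right and positive with negative, while the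
    sign of the derivative is kept.\<close>
  let ?g = "- (f \<circ>\<^sub>p [:0, -1:])"
  have g: "poly ?g y = - poly f (- y)" "poly (pderiv ?g) y = poly (pderiv f) (- y)" for y
    by (simp_all add: poly_pcompose pderiv_minus pderiv_pcompose pderiv_pCons)
  have "(\<exists>r. r < - x \<and> poly ?g r = 0 \<and> (\<forall>z\<in>uminus ` Z. z < r \<or> - x < z)) \<or>
    (\<exists>u\<in>uminus ` Z. u < - x \<and> 0 \<le> poly ?g u \<and> (\<forall>z\<in>uminus ` Z. z \<le> u \<or> - x < z))"
  proof (rule poly_left_of_positive)
    have "poly (pderiv ?g) (- x) \<noteq> 0" using g x by simp
    then show "pderiv ?g \<noteq> 0" by force
    show "z \<in> uminus ` Z" if "poly (pderiv ?g) z = 0" for z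
      using df(2)[of "- z"] that unfolding g by (metis image_eqI minus_minus)
  qed (use Z x g in auto)
  then show ?thesis
  proof (elim disjE exE bexE conjE)
    fix r assume r: "r < - x" "poly ?g r = 0" "\<forall>z\<in>uminus ` Z. z < r \<or> - x < z"
    then have "x < - r \<and> poly f (- r) = 0 \<and> (\<forall>z\<in>Z. z < x \<or> - r < z)"
      unfolding g by force
    then show ?thesis by blast
  next
    fix u assume u: "u \<in> uminus ` Z" "u < - x" "0 \<le> poly ?g u" "\<forall>z\<in>uminus ` Z. z \<le> u \<or> - x < z"
    then have "- u \<in> Z \<and> x < - u \<and> poly f (- u) \<le> 0 \<and> (\<forall>z\<in>Z. z < x \<or> - u \<le> z)"
      unfolding g by force
    then show ?thesis by blast
  qed
qed

text \<open>One step in the construction of a matching: what remains open about \<open>f\<close> and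
  \<open>g\<close> is the position of their roots in the gaps of \<open>Z\<close> and
  \<open>Z'\<close>. In each gap both are monotone, so each has at most one root there.\<close>

locale sign_transfer =
  fixes h :: "'f::real_closed_field \<Rightarrow> 'f" and Z Z' :: "'f set" and f g :: "'f poly"
  assumes mono: "strict_mono h" and surj: "surj h"
    and fin: "finite Z" "finite Z'" and Z_iff: "h z \<in> Z' \<longleftrightarrow> z \<in> Z"
    and df: "pderiv f \<noteq> 0" "poly (pderiv f) z = 0 \<Longrightarrow> z \<in> Z"
    and dg: "pderiv g \<noteq> 0" "poly (pderiv g) z = 0 \<Longrightarrow> z \<in> Z'"
    and sgn_d: "sgn (poly (pderiv g) (h x)) = sgn (poly (pderiv f) x)"
    and sgn_Z: "z \<in> Z \<Longrightarrow> sgn (poly g (h z)) = sgn (poly f z)"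
begin

lemma h_less: "h x < h y \<longleftrightarrow> x < y"
  using mono by (rule strict_mono_less)

lemma uminus_transfer: "sign_transfer h Z Z' (- f) (- g)"
  using sign_transfer_axioms unfolding sign_transfer_def by (simp add: pderiv_minus sgn_minus)

lemma deriv_pos:
  assumes "poly (pderiv f) x > 0" "\<And>z. z \<in> Z \<Longrightarrow> z < min x y \<or> max x y < z"
  shows "poly (pderiv f) y > 0"
proof -
  have "sgn (poly (pderiv f) (min x y)) = sgn (poly (pderiv f) (max x y))"
    using assms df(2) by (intro poly_sgn_eq_if_no_root) (simp, metis not_less)
  then have "sgn (poly (pderiv f) x) = sgn (poly (pderiv f) y)" by (auto simp: min_def max_def split: if_splits)
  then show ?thesis using assms(1) by (metis sgn_greater)
qed

lemma f_g_less:
  assumes "x < y" "\<And>t. x < t \<Longrightarrow> t < y \<Longrightarrow> poly (pderiv f) t > 0"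
  shows "poly f x < poly f y" "poly g (h x) < poly g (h y)"
proof -
  show "poly f x < poly f y" using assms by (intro poly_increasing)
  show "poly g (h x) < poly g (h y)"
  proof (rule poly_increasing)
    show "h x < h y" using assms h_less by blast
    fix s assume s: "h x < s" "s < h y"
    obtain t where t: "s = h t" using surj by (metis surjD)
    then have "sgn (poly (pderiv g) s) = 1" using s assms(2)[of t] by (simp add: sgn_d h_less)
    then show "poly (pderiv g) s > 0" by (simp add: sgn_1_pos)
  qed
qed

lemma less_left:
  assumes "poly (pderiv f) x > 0" "u < x" "\<forall>z\<in>Z. z \<le> u \<or> x < z"
  shows "poly f u < poly f x" "poly g (h u) < poly g (h x)"
proof -
  have "poly (pderiv f) t > 0" if t: "u < t" "t < x" for t
  proof (rule deriv_pos[OF assms(1)])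
    fix z assume "z \<in> Z"
    then show "z < min x t \<or> max x t < z" using assms(3) t by force
  qed
  then show "poly f u < poly f x" "poly g (h u) < poly g (h x)"
    using f_g_less[OF assms(2)] by blast+
qed

lemma less_right:
  assumes "poly (pderiv f) x > 0" "x < u" "\<forall>z\<in>Z. z < x \<or> u \<le> z"
  shows "poly f x < poly f u" "poly g (h x) < poly g (h u)"
proof -
  have "poly (pderiv f) t > 0" if t: "x < t" "t < u" for t
  proof (rule deriv_pos[OF assms(1)])
    fix z assume "z \<in> Z"
    then show "z < min x t \<or> max x t < z" using assms(3) t by force
  qed
  then show "poly f x < poly f u" "poly g (h x) < poly g (h u)"
    using f_g_less[OF assms(2)] by blast+
qed

text \<open>The certificate for the sign of \<open>f\<close> at \<open>x\<close>, a root or a point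
  of \<open>Z\<close>, is moved by \<open>h\<close>; monotonicity of \<open>g\<close> in the
  corresponding gap then gives the sign of \<open>g\<close>.\<close>

lemma pos_transfer:
  assumes x: "x \<notin> Z" "poly (pderiv f) x > 0" and roots: "\<And>r. poly f r = 0 \<Longrightarrow> poly g (h r) = 0"
  shows "0 < poly f x \<Longrightarrow> 0 < poly g (h x)" "poly f x < 0 \<Longrightarrow> poly g (h x) < 0"
proof -
  assume fx: "0 < poly f x"
  from poly_left_of_positive[OF fin(1) df x fx]
  consider r where "r < x" "poly f r = 0" "\<forall>z\<in>Z. z < r \<or> x < z"
    | u where "u \<in> Z" "u < x" "0 \<le> poly f u" "\<forall>z\<in>Z. z \<le> u \<or> x < z" by blast
  then show "0 < poly g (h x)"
  proof cases
    case 1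
    have "poly g (h r) < poly g (h x)" using 1 by (intro less_left(2) x(2)) auto
    then show ?thesis using roots 1 by simp
  next
    case 2
    have "poly g (h u) < poly g (h x)" using 2 by (intro less_left(2) x(2))
    moreover have "0 \<le> poly g (h u)" using sgn_Z[OF 2(1)] 2(3) by (metis sgn_less not_less)
    ultimately show ?thesis by simp
  qed
next
  assume fx: "poly f x < 0"
  from poly_right_of_negative[OF fin(1) df x fx]
  consider r where "x < r" "poly f r = 0" "\<forall>z\<in>Z. z < x \<or> r < z"
    | u where "u \<in> Z" "x < u" "poly f u \<le> 0" "\<forall>z\<in>Z. z < x \<or> u \<le> z" by blast
  then show "poly g (h x) < 0"
  proof cases
    case 1
    have "poly g (h x) < poly g (h r)" using 1 by (intro less_right(2) x(2)) auto
    then show ?thesis using roots 1 by simp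
  next
    case 2
    have "poly g (h x) < poly g (h u)" using 2 by (intro less_right(2) x(2))
    moreover have "poly g (h u) \<le> 0" using sgn_Z[OF 2(1)] 2(3) by (metis sgn_greater not_less)
    ultimately show ?thesis by simp
  qed
qed

text \<open>If \<open>g\<close> does not vanish at \<open>h x\<close>, its sign there has a
  certificate. A point of \<open>Z'\<close> is impossible: it would pull back to a point of
  \<open>Z\<close> at which \<open>f\<close> has the wrong sign, given that \<open>f\<close>
  vanishes at \<open>x\<close>. So the certificate is a root of \<open>g\<close> in the same
  gap.\<close>

lemma g_root_pos:
  assumes "poly f x = 0" "x \<notin> Z" "poly (pderiv f) x > 0"
  shows "\<exists>y. poly g (h y) = 0 \<and> (\<forall>z\<in>Z. z < min x y \<or> max x y < z)"
proof -
  have hx: "h x \<notin> Z'" using assms Z_iff by simp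
  have dgx: "poly (pderiv g) (h x) > 0" using assms sgn_d[of x] by (simp add: sgn_1_pos)
  consider "poly g (h x) = 0" | "poly g (h x) > 0" | "poly g (h x) < 0" by linarith
  then show ?thesis
  proof cases
    case 1
    then show ?thesis using assms(2) by (intro exI[of _ x]) (metis linorder_neqE max.idem min.idem)
  next
    case 2
    from poly_left_of_positive[OF fin(2) dg hx dgx 2]
    consider r where "r < h x" "poly g r = 0" "\<forall>z\<in>Z'. z < r \<or> h x < z"
      | u where "u \<in> Z'" "u < h x" "0 \<le> poly g u" "\<forall>z\<in>Z'. z \<le> u \<or> h x < z" by blast
    then show ?thesis
    proof cases
      case 1
      obtain y where y: "r = h y" using surj by (metis surjD)
      have "y < x" using 1(1) by (simp add: y h_less)
      moreover have "\<forall>z\<in>Z. z < y \<or> x < z" using 1(3) Z_iff h_less y by blast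
      ultimately show ?thesis using 1(2) y by (intro exI[of _ y]) (auto simp: min_def max_def)
    next
      case 2
      obtain v where v: "u = h v" using surj by (metis surjD)
      have "v \<in> Z" "v < x" "\<forall>z\<in>Z. z \<le> v \<or> x < z"
        using 2 Z_iff h_less v by (simp, simp, metis not_less)
      then have "poly f v < poly f x" by (intro less_left(1) assms(3))
      moreover have "0 \<le> poly f v" using sgn_Z[OF \<open>v \<in> Z\<close>] 2(3) v by (metis sgn_less not_less)
      ultimately show ?thesis using assms(1) by simp
    qed
  next
    case 3
    from poly_right_of_negative[OF fin(2) dg hx dgx 3]
    consider r where "h x < r" "poly g r = 0" "\<forall>z\<in>Z'. z < h x \<or> r < z"
      | u where "u \<in> Z'" "h x < u" "poly g u \<le> 0" "\<forall>z\<in>Z'. z < h x \<or> u \<le> z" by blast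
    then show ?thesis
    proof cases
      case 1
      obtain y where y: "r = h y" using surj by (metis surjD)
      have "x < y" using 1(1) by (simp add: y h_less)
      moreover have "\<forall>z\<in>Z. z < x \<or> y < z" using 1(3) Z_iff h_less y by blast
      ultimately show ?thesis using 1(2) y by (intro exI[of _ y]) (auto simp: min_def max_def)
    next
      case 2
      obtain v where v: "u = h v" using surj by (metis surjD)
      have "v \<in> Z" "x < v" "\<forall>z\<in>Z. z < x \<or> v \<le> z"
        using 2 Z_iff h_less v by (simp, simp, metis not_less)
      then have "poly f x < poly f v" by (intro less_right(1) assms(3))
      moreover have "poly f v \<le> 0" using sgn_Z[OF \<open>v \<in> Z\<close>] 2(3) v by (metis sgn_greater not_less)
      ultimately show ?thesis using assms(1) by simp
    qed
  qed
qed

lemma g_root: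
  assumes "poly f x = 0" "x \<notin> Z"
  shows "\<exists>y. poly g (h y) = 0 \<and> (\<forall>z\<in>Z. z < min x y \<or> max x y < z)"
proof (cases "poly (pderiv f) x > 0")
  case True
  then show ?thesis using g_root_pos assms by blast
next
  case False
  then have "poly (pderiv f) x < 0" using assms(2) df(2) by (metis linorder_cases)
  then show ?thesis
    using sign_transfer.g_root_pos[OF uminus_transfer, of x] assms by (simp add: pderiv_minus)
qed

lemma all_signs_transfer:
  assumes roots: "\<And>r. poly f r = 0 \<Longrightarrow> poly g (h r) = 0"
  shows "sgn (poly g (h x)) = sgn (poly f x)"
proof (cases "x \<in> Z \<or> poly f x = 0")
  case True
  then show ?thesis using sgn_Z roots by auto
next
  case False
  then consider "poly (pderiv f) x > 0" | "poly (pderiv f) x < 0"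
    using df(2) by (metis linorder_cases)
  then show ?thesis
  proof cases
    case 1
    then show ?thesis using pos_transfer[of x] False roots
      by (cases "poly f x" "0::'f" rule: linorder_cases) auto
  next
    case 2
    then show ?thesis using sign_transfer.pos_transfer[OF uminus_transfer, of x] False roots
      by (cases "poly f x" "0::'f" rule: linorder_cases) (auto simp: pderiv_minus)
  qed
qed

lemma at_most_one_root:
  assumes "poly f x = 0" "poly f y = 0" "\<And>z. z \<in> Z \<Longrightarrow> z < min x y \<or> max x y < z"
  shows "x = y"
proof (rule ccontr)
  assume "x \<noteq> y"
  then have "min x y < max x y" by (auto simp: min_def max_def)
  moreover have "poly (pderiv f) t \<noteq> 0" if "min x y \<le> t" "t \<le> max x y" for t
    using assms(3)[of t] df(2)[of t] that by fastforce
  ultimately have "poly f (min x y) \<noteq> poly f (max x y)" by (rule poly_inj_if_pderiv_nonzero)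
  then show False using assms by (auto simp: min_def max_def split: if_splits)
qed

end

section \<open>Order automorphisms that match the signs of pairs of polynomials\<close>

definition matches :: "('f::linordered_field \<Rightarrow> 'f) \<Rightarrow> ('f poly \<times> 'f poly) set \<Rightarrow> bool" where
  "matches h S \<longleftrightarrow> strict_mono h \<and> surj h \<and> (\<forall>(p, q)\<in>S. \<forall>x. sgn (poly q (h x)) = sgn (poly p x))"

lemma matchesI:
  "strict_mono h \<Longrightarrow> surj h \<Longrightarrow> (\<And>p q x. (p, q) \<in> S \<Longrightarrow> sgn (poly q (h x)) = sgn (poly p x)) \<Longrightarrow> matches h S"
  by (auto simp: matches_def)

lemma matchesD: "matches h S \<Longrightarrow> (p, q) \<in> S \<Longrightarrow> sgn (poly q (h x)) = sgn (poly p x)"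
  by (auto simp: matches_def)

text \<open>The zero polynomial is left out because every point is a root of it, which would make
  the set infinite.\<close>

definition critical :: "'f::linordered_field poly set \<Rightarrow> 'f set" where
  "critical P = {z. \<exists>p\<in>P. p \<noteq> 0 \<and> poly p z = 0}"

lemma finite_critical:
  assumes "finite P"
  shows "finite (critical P)"
proof -
  have "critical P = (\<Union>p\<in>P - {0}. {z. poly p z = 0})" by (auto simp: critical_def)
  then show ?thesis using assms poly_roots_finite by auto
qed

lemma matches_eq_0_iff:
  assumes "matches h S" "(p, q) \<in> S"
  shows "q = 0 \<longleftrightarrow> p = (0::'f::linordered_field poly)"
proof -
  have "(\<forall>x. poly q x = 0) \<longleftrightarrow> (\<forall>x. poly p x = 0)"
    using matchesD[OF assms] assms(1) unfolding matches_def by (metis sgn_0_0 surjD)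
  then show ?thesis by (simp add: poly_all_0_iff_0)
qed

lemma matches_critical_iff:
  fixes h :: "'f::linordered_field \<Rightarrow> 'f"
  assumes "matches h S"
  shows "h z \<in> critical (snd ` S) \<longleftrightarrow> z \<in> critical (fst ` S)"
  unfolding critical_def using matches_eq_0_iff[OF assms] matchesD[OF assms]
  by (auto simp: image_iff Bex_def) (metis sgn_0_0)+

text \<open>The roots of \<open>f\<close> are treated one by one: \<open>h\<close> is composed with
  an automorphism that moves the image of a root of \<open>f\<close> onto the root of
  \<open>g\<close> in the corresponding gap. The number of roots of \<open>f\<close> not yet sent to
  roots of \<open>g\<close> decreases.\<close>

lemma matches_extend:
  fixes f g :: "'f::real_closed_field poly"
  assumes "finite S" "(pderiv f, pderiv g) \<in> S" "pderiv f \<noteq> 0"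
    and "matches h S" "\<And>z. z \<in> critical (fst ` S) \<Longrightarrow> sgn (poly g (h z)) = sgn (poly f z)"
  shows "\<exists>h'. matches h' (insert (f, g) S)"
  using assms(4,5)
proof (induction "card {r. poly f r = 0 \<and> poly g (h r) \<noteq> 0}" arbitrary: h rule: less_induct)
  case less
  let ?Z = "critical (fst ` S)" and ?Z' = "critical (snd ` S)"
  have "pderiv g \<noteq> 0" using matches_eq_0_iff[OF less.prems(1) assms(2)] assms(3) by simp
  interpret sign_transfer h ?Z ?Z' f g
  proof
    show "strict_mono h" "surj h" using less.prems(1) by (auto simp: matches_def)
    show "finite ?Z" "finite ?Z'" using assms(1) by (auto intro: finite_critical)
    show "poly (pderiv f) z = 0 \<Longrightarrow> z \<in> ?Z" for z
      using assms(2,3) unfolding critical_def by force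
    show "poly (pderiv g) z = 0 \<Longrightarrow> z \<in> ?Z'" for z
      using assms(2) \<open>pderiv g \<noteq> 0\<close> unfolding critical_def by force
  qed (use less.prems matches_critical_iff matchesD assms(2,3) \<open>pderiv g \<noteq> 0\<close> in auto)
  have fin_roots: "finite {r. poly f r = 0 \<and> poly g (h r) \<noteq> 0}"
    using poly_roots_finite[of f] assms(3) by (cases "f = 0") auto
  show ?case
  proof (cases "\<exists>r. poly f r = 0 \<and> poly g (h r) \<noteq> 0")
    case False
    then have "matches h (insert (f, g) S)"
      using less.prems(1) all_signs_transfer unfolding matches_def by auto
    then show ?thesis by blast
  next
    case True
    then obtain r where r: "poly f r = 0" "poly g (h r) \<noteq> 0" by blast
    have "r \<notin> ?Z" using r less.prems(2)[of r] by (auto simp: sgn_0_0)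
    then obtain y where y: "poly g (h y) = 0" "\<forall>z\<in>?Z. z < min r y \<or> max r y < z"
      using g_root r(1) by blast
    have "min r y \<le> max r y" by (auto simp: min_def max_def)
    then have "min r y \<notin> ?Z" and "max r y \<notin> ?Z" using y(2) by (metis less_irrefl not_less)+
    from finite_avoid_nhd[OF fin(1) this(1)] finite_avoid_nhd[OF fin(1) this(2)]
    obtain d e where d: "d > 0" "\<And>z. z \<in> ?Z \<Longrightarrow> z < min r y - d \<or> min r y + d < z"
      and e: "e > 0" "\<And>z. z \<in> ?Z \<Longrightarrow> z < max r y - e \<or> max r y + e < z" by metis
    \<comment> \<open>The interval contains \<open>r\<close> and \<open>y\<close> but no critical
      point, so changing \<open>h\<close> inside it disturbs neither the signs of the members of
      \<open>S\<close> nor any other root of \<open>f\<close>.\<close>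
    define a b where "a = min r y - d" and "b = max r y + e"
    have ab: "a < r" "r < b" "a < y" "y < b" using d(1) e(1) by (auto simp: a_def b_def min_def max_def)
    have no_Z: "z \<notin> ?Z" if "a \<le> z" "z \<le> b" for z
      using y(2) d e that unfolding a_def b_def by force
    obtain m where m: "strict_mono m" "surj m" "m (h r) = h y" "\<And>x. x \<le> h a \<or> h b \<le> x \<Longrightarrow> m x = x"
      using order_automorphism_move[of "h a" "h r" "h b" "h y"] ab h_less by blast
    let ?h = "m \<circ> h"
    have outside: "?h x = h x" if "x \<le> a \<or> b \<le> x" for x
      using m(4)[of "h x"] that h_less by (metis comp_apply not_less)
    have inside: "\<exists>x'. ?h x = h x' \<and> a < x' \<and> x' < b" if "a < x" "x < b" for x
    proof -
      have "m (h a) < m (h x)" "m (h x) < m (h b)" using that m(1) h_less by (auto simp: strict_mono_less)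
      then have "h a < ?h x" "?h x < h b" using m(4) by auto
      then show ?thesis using surj h_less by (metis surjD)
    qed
    have "matches ?h S"
    proof (rule matchesI)
      show "strict_mono ?h" using m(1) mono by (simp add: strict_mono_def)
      show "surj ?h" using m(2) surj by (metis comp_surj)
      fix p q x assume pq: "(p, q) \<in> S"
      show "sgn (poly q (?h x)) = sgn (poly p x)"
      proof (cases "x \<le> a \<or> b \<le> x")
        case True
        then show ?thesis using outside matchesD[OF less.prems(1) pq] by simp
      next
        case False
        then obtain x' where x': "?h x = h x'" "a < x'" "x' < b" using inside by (metis not_less)
        have "sgn (poly p x') = sgn (poly p x)"
        proof (cases "p = 0")
          case pn0: False
          have nr: "poly p z \<noteq> 0" if "a < z" "z < b" for z
            using no_Z[of z] that pq pn0 unfolding critical_def by force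
          show ?thesis
            using poly_sgn_eq_if_no_root[of x x' p] poly_sgn_eq_if_no_root[of x' x p] nr x' False
            by (cases "x \<le> x'") (force simp: not_le)+
        qed simp
        then show ?thesis using x' matchesD[OF less.prems(1) pq] by simp
      qed
    qed
    moreover have "sgn (poly g (?h z)) = sgn (poly f z)" if "z \<in> ?Z" for z
      using less.prems(2)[OF that] outside[of z] no_Z[of z] that by (metis not_less order.strict_implies_order)
    moreover have "card {r. poly f r = 0 \<and> poly g (?h r) \<noteq> 0} < card {r. poly f r = 0 \<and> poly g (h r) \<noteq> 0}"
    proof (rule psubset_card_mono[OF fin_roots])
      have "poly g (h s) \<noteq> 0" if s: "poly f s = 0" "poly g (?h s) \<noteq> 0" for s
      proof (cases "s \<le> a \<or> b \<le> s")
        case True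
        then show ?thesis using outside s by simp
      next
        case False
        then have "z < min r s \<or> max r s < z" if "z \<in> ?Z" for z
          using no_Z[of z] ab that by (force simp: min_def max_def)
        then have "r = s" using at_most_one_root r(1) s(1) by blast
        then show ?thesis using r by simp
      qed
      moreover have "poly g (?h r) = 0" using m(3) y(1) by simp
      ultimately show "{r. poly f r = 0 \<and> poly g (?h r) \<noteq> 0} \<subset> {r. poly f r = 0 \<and> poly g (h r) \<noteq> 0}"
        using r by blast
    qed
    ultimately show ?thesis using less.hyps by blast
  qed
qed

text \<open>The automorphism is built in order of increasing degree. When a pair
  \<open>(f, g)\<close> of largest degree is added, the derivatives are already matched, and at a
  root of an earlier \<open>p\<close> the sign of \<open>f\<close> is that of a remainder of smaller
  degree than \<open>p\<close>, hence matched as well.\<close>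

theorem closed_pairs_match:
  fixes S :: "('f::real_closed_field poly \<times> 'f poly) set"
  assumes fin: "finite S"
    and lead: "\<And>p q. (p, q) \<in> S \<Longrightarrow> degree p = degree q"
      "\<And>p q. (p, q) \<in> S \<Longrightarrow> sgn (lead_coeff p) = sgn (lead_coeff q)"
    and der: "\<And>p q. (p, q) \<in> S \<Longrightarrow> degree p > 0 \<Longrightarrow> (pderiv p, pderiv q) \<in> S"
    and rem: "\<And>f g p q. (f, g) \<in> S \<Longrightarrow> (p, q) \<in> S \<Longrightarrow> 0 < degree p \<Longrightarrow>
      degree p \<le> degree f \<Longrightarrow>
      \<exists>r s. (r, s) \<in> S \<and> degree r < degree p \<and>
        (\<forall>z. poly p z = 0 \<longrightarrow> sgn (poly f z) = sgn (poly r z)) \<and>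
        (\<forall>z. poly q z = 0 \<longrightarrow> sgn (poly g z) = sgn (poly s z))"
  shows "\<exists>h. matches h S"
proof -
  \<comment> \<open>The sets \<open>\<Gamma>\<close> are closed under passing to smaller degree;
    removing one element of maximal degree preserves this and keeps the derivatives and remainders
    that the step needs.\<close>
  have "\<exists>h. matches h \<Gamma>" if "\<Gamma> \<subseteq> S"
    and "\<And>x y. x \<in> \<Gamma> \<Longrightarrow> y \<in> S \<Longrightarrow> degree (fst y) < degree (fst x) \<Longrightarrow> y \<in> \<Gamma>" for \<Gamma>
    using that
  proof (induction "card \<Gamma>" arbitrary: \<Gamma>)
    case 0
    then have "\<Gamma> = {}" using fin finite_subset by (metis card_0_eq)
    then have "matches id \<Gamma>" by (simp add: matches_def strict_mono_def)
    then show ?case by blast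
  next
    case (Suc n)
    have "finite \<Gamma>" using Suc.prems(1) fin finite_subset by blast
    moreover have "\<Gamma> \<noteq> {}" using Suc.hyps(2) by auto
    ultimately have "Max ((\<lambda>y. degree (fst y)) ` \<Gamma>) \<in> (\<lambda>y. degree (fst y)) ` \<Gamma>"
      by (intro Max_in) auto
    then obtain x where x: "x \<in> \<Gamma>" "\<And>y. y \<in> \<Gamma> \<Longrightarrow> degree (fst y) \<le> degree (fst x)"
      using Max_ge[of "(\<lambda>y. degree (fst y)) ` \<Gamma>"] \<open>finite \<Gamma>\<close>
      by (smt (verit) finite_imageI image_iff)
    obtain f g where fg: "x = (f, g)" by (cases x)
    let ?\<Delta> = "\<Gamma> - {x}"
    have less: "y \<in> ?\<Delta>" if "y \<in> S" "degree (fst y) < degree f" for y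
      using that Suc.prems(2)[OF x(1), of y] fg by auto
    have "n = card ?\<Delta>" using Suc.hyps(2) x(1) by simp
    moreover have "y \<in> ?\<Delta>" if "z \<in> ?\<Delta>" "y \<in> S" "degree (fst y) < degree (fst z)" for y z
      using that x(2)[of z] less[of y] fg by simp
    ultimately obtain h where h: "matches h ?\<Delta>" using Suc.hyps(1)[of ?\<Delta>] Suc.prems(1) by blast
    have ins: "insert (f, g) ?\<Delta> = \<Gamma>" using x(1) fg by auto
    have fgP: "(f, g) \<in> S" using x(1) fg Suc.prems(1) by auto
    show ?case
    proof (cases "degree f = 0")
      case True
      then obtain c d where "f = [:c:]" "g = [:d:]" using lead(1)[OF fgP] by (metis degree_eq_zeroE)
      then have "sgn (poly g (h y)) = sgn (poly f y)" for y using lead(2)[OF fgP] by simp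
      then have "matches h (insert (f, g) ?\<Delta>)" using h unfolding matches_def by auto
      then show ?thesis unfolding ins by blast
    next
      case False
      have df: "pderiv f \<noteq> 0" using False by (simp add: pderiv_eq_0_iff)
      have "(pderiv f, pderiv g) \<in> ?\<Delta>"
        using False der[OF fgP] by (intro less) (auto simp: degree_pderiv)
      moreover have "sgn (poly g (h z)) = sgn (poly f z)" if z: "z \<in> critical (fst ` ?\<Delta>)" for z
      proof -
        obtain p q where pq: "(p, q) \<in> ?\<Delta>" "p \<noteq> 0" "poly p z = 0"
          using z unfolding critical_def by force
        have "degree p > 0" using pq(2,3) by (intro gr0I) (auto elim!: degree_eq_zeroE)
        moreover have "degree p \<le> degree f" using x(2)[of "(p, q)"] pq(1) fg by simp
        ultimately obtain r s where rs: "(r, s) \<in> S" "degree r < degree p"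
            "\<forall>z. poly p z = 0 \<longrightarrow> sgn (poly f z) = sgn (poly r z)"
            "\<forall>z. poly q z = 0 \<longrightarrow> sgn (poly g z) = sgn (poly s z)"
          using rem[OF fgP, of p q] pq(1) Suc.prems(1) by blast
        have "(r, s) \<in> ?\<Delta>" using rs(1,2) \<open>degree p \<le> degree f\<close> by (intro less) auto
        moreover have "poly q (h z) = 0" using matchesD[OF h pq(1), of z] pq(3) by (simp add: sgn_0_0)
        ultimately show ?thesis using rs(3,4) pq(3) matchesD[OF h, of r s z] by simp
      qed
      ultimately show ?thesis
        using matches_extend[of ?\<Delta> f g h] \<open>finite \<Gamma>\<close> df h ins by simp
    qed
  qed
  from this[of S] show ?thesis by blast
qed

section \<open>Quantifier elimination\<close>

text \<open>The language has no subtraction, so a polynomial with integer coefficients in the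
  variables appears as a difference of two terms.\<close>

definition polyfuns :: "((nat \<Rightarrow> 'f::linordered_field) \<Rightarrow> 'f) set" where
  "polyfuns = {\<lambda>e. term_val s e - term_val t e |s t. True}"

lemma polyfunsI: "(\<And>e. p e = term_val s e - term_val t e) \<Longrightarrow> p \<in> polyfuns"
  unfolding polyfuns_def by blast

lemma polyfunsE:
  assumes "p \<in> polyfuns"
  obtains s t where "\<And>e. p e = term_val s e - term_val t e"
  using assms unfolding polyfuns_def by blast

lemma polyfuns_add: "p \<in> polyfuns \<Longrightarrow> q \<in> polyfuns \<Longrightarrow> (\<lambda>e. p e + q e) \<in> polyfuns"
  by (elim polyfunsE, rule_tac s = "Add s sa" and t = "Add t ta" in polyfunsI) simp

lemma polyfuns_uminus: "p \<in> polyfuns \<Longrightarrow> (\<lambda>e. - p e) \<in> polyfuns"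
  by (elim polyfunsE, rule_tac s = t and t = s in polyfunsI) simp

lemma polyfuns_diff: "p \<in> polyfuns \<Longrightarrow> q \<in> polyfuns \<Longrightarrow> (\<lambda>e. p e - q e) \<in> polyfuns"
  using polyfuns_add[of p "\<lambda>e. - q e"] polyfuns_uminus[of q] by simp

lemma polyfuns_mult:
  assumes "p \<in> polyfuns" "q \<in> polyfuns"
  shows "(\<lambda>e. p e * q e) \<in> polyfuns"
proof -
  obtain s t where st: "\<And>e. p e = term_val s e - term_val t e" using assms(1) by (rule polyfunsE) blast
  obtain u v where uv: "\<And>e. q e = term_val u e - term_val v e" using assms(2) by (rule polyfunsE) blast
  show ?thesis
    by (rule polyfunsI[of _ "Add (Mult s u) (Mult t v)" "Add (Mult s v) (Mult t u)"])
      (simp add: st uv algebra_simps)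
qed

lemma polyfuns_var: "(\<lambda>e. e n) \<in> polyfuns"
  by (rule polyfunsI[of _ "Var n" Zero]) simp

lemma polyfuns_0: "(\<lambda>_. 0) \<in> polyfuns"
  by (rule polyfunsI[of _ Zero Zero]) simp

lemma polyfuns_1: "(\<lambda>_. 1) \<in> polyfuns"
  by (rule polyfunsI[of _ One Zero]) simp

lemma polyfuns_of_nat: "(\<lambda>_. of_nat n) \<in> polyfuns"
  by (induction n) (simp_all add: polyfuns_0 polyfuns_add polyfuns_1)

lemma polyfuns_sum: "(\<And>i. i \<in> I \<Longrightarrow> p i \<in> polyfuns) \<Longrightarrow> (\<lambda>e. \<Sum>i\<in>I. p i e) \<in> polyfuns"
  by (induction I rule: infinite_finite_induct) (simp_all add: polyfuns_0 polyfuns_add)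

text \<open>\<open>N\<close> is a formal degree, independent of the assignment; the coefficient at
  \<open>N\<close> may vanish for some assignments.\<close>

definition poly_family :: "nat \<Rightarrow> ((nat \<Rightarrow> 'f::linordered_field) \<Rightarrow> 'f poly) \<Rightarrow> bool" where
  "poly_family N q \<longleftrightarrow> (\<forall>e. degree (q e) \<le> N) \<and> (\<forall>i. (\<lambda>e. coeff (q e) i) \<in> polyfuns)"

lemma poly_familyD:
  assumes "poly_family N q"
  shows "degree (q e) \<le> N" "(\<lambda>e. coeff (q e) i) \<in> polyfuns"
  using assms by (auto simp: poly_family_def)

text \<open>Meant for assignments at which the formal leading coefficient vanishes: there the
  truncation equals \<open>q\<close> but has a smaller formal degree.\<close>

definition trunc_family :: "nat \<Rightarrow> ('e \<Rightarrow> 'f::linordered_field poly) \<Rightarrow> 'e \<Rightarrow> 'f poly" where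
  "trunc_family n q = (\<lambda>e. q e - monom (coeff (q e) n) n)"

lemma poly_family_trunc:
  assumes "poly_family (Suc N) q"
  shows "poly_family N (trunc_family (Suc N) q)"
  unfolding poly_family_def
proof (intro conjI allI)
  show "degree (trunc_family (Suc N) q e) \<le> N" for e
    using poly_familyD(1)[OF assms, of e]
    by (intro degree_le) (auto simp: trunc_family_def coeff_eq_0 not_less_eq)
  show "(\<lambda>e. coeff (trunc_family (Suc N) q e) i) \<in> polyfuns" for i
    using poly_familyD(2)[OF assms, of i] by (cases "Suc N = i") (auto simp: trunc_family_def polyfuns_0)
qed

lemma poly_family_pderiv:
  assumes "poly_family (Suc N) q"
  shows "poly_family N (\<lambda>e. pderiv (q e))"
  unfolding poly_family_def
proof (intro conjI allI)
  show "degree (pderiv (q e)) \<le> N" for e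
    using poly_familyD(1)[OF assms, of e] by (simp add: degree_pderiv)
  show "(\<lambda>e. coeff (pderiv (q e)) i) \<in> polyfuns" for i
    unfolding coeff_pderiv by (intro polyfuns_mult polyfuns_of_nat poly_familyD(2)[OF assms])
qed

text \<open>Nothing is required where the formal leading coefficient of \<open>g\<close> vanishes,
  because a truncation of \<open>g\<close> takes over there.\<close>

definition sign_remainder where
  "sign_remainder M f g r \<longleftrightarrow> (\<forall>e z. coeff (g e) (Suc M) \<noteq> 0 \<longrightarrow> poly (g e) z = 0 \<longrightarrow>
     sgn (poly (f e) z) = sgn (poly (r e) (z :: 'f::linordered_field)))"

text \<open>Pseudo-division, with even powers of the leading coefficient so that signs are kept.\<close>

lemma sign_remainder_exists:
  fixes f g :: "(nat \<Rightarrow> 'f::linordered_field) \<Rightarrow> 'f poly"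
  assumes "poly_family N f" "poly_family (Suc M) g"
  shows "\<exists>r. poly_family M r \<and> sign_remainder M f g r"
  using assms(1)
proof (induction N arbitrary: f)
  case 0
  then have "poly_family M f" by (auto simp: poly_family_def)
  then show ?case by (auto simp: sign_remainder_def)
next
  case (Suc N)
  show ?case
  proof (cases "Suc N \<le> M")
    case True
    then have "poly_family M f" using Suc.prems unfolding poly_family_def by (meson order_trans)
    then show ?thesis by (auto simp: sign_remainder_def)
  next
    case False
    define b c where "b = (\<lambda>e. coeff (g e) (Suc M))" and "c = (\<lambda>e. coeff (f e) (Suc N))"
    \<comment> \<open>The two terms of the difference have the same coefficient at
      \<open>Suc N\<close>, so the formal degree drops; at a zero of \<open>g\<close> the value of
      \<open>f\<close> is only multiplied by the square of \<open>b\<close>.\<close>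
    define f' where "f' = (\<lambda>e. smult (b e * b e) (f e) -
      smult (b e * c e) (monom 1 (N - M) * g e))"
    have bc: "b \<in> polyfuns" "c \<in> polyfuns"
      unfolding b_def c_def using poly_familyD(2) assms(2) Suc.prems by blast+
    have coeff: "coeff (f' e) i = b e * b e * coeff (f e) i -
        b e * c e * (if N - M \<le> i then coeff (g e) (i - (N - M)) else 0)" for e i
      unfolding f'_def by (simp add: coeff_monom_mult)
    have "poly_family N f'"
      unfolding poly_family_def
    proof (intro conjI allI)
      fix e
      show "degree (f' e) \<le> N"
      proof (rule degree_le, intro allI impI)
        fix i assume "N < i"
        show "coeff (f' e) i = 0"
        proof (cases "i = Suc N")
          case True
          then have "i - (N - M) = Suc M" using False by simp
          then show ?thesis unfolding coeff using True by (simp add: b_def c_def)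
        next
          case 2: False
          then have "Suc N < i" "Suc M < i - (N - M)" using \<open>N < i\<close> False by auto
          then show ?thesis unfolding coeff
            using poly_familyD(1)[OF Suc.prems, of e] poly_familyD(1)[OF assms(2), of e]
            by (simp add: coeff_eq_0)
        qed
      qed
    next
      fix i
      show "(\<lambda>e. coeff (f' e) i) \<in> polyfuns"
        unfolding coeff
        by (cases "N - M \<le> i") (auto intro!: polyfuns_diff polyfuns_mult bc polyfuns_0
            poly_familyD(2)[OF Suc.prems] poly_familyD(2)[OF assms(2)])
    qed
    then obtain r where r: "poly_family M r" "sign_remainder M f' g r" using Suc.IH by blast
    have "sgn (poly (f e) z) = sgn (poly (f' e) z)"
      if "coeff (g e) (Suc M) \<noteq> 0" "poly (g e) z = 0" for e z
    proof -
      have "b e * b e > 0" using that(1) unfolding b_def by (auto simp: zero_less_mult_iff neq_iff)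
      moreover have "poly (f' e) z = (b e * b e) * poly (f e) z" using that(2) by (simp add: f'_def)
      then have "sgn (poly (f' e) z) = sgn (b e * b e) * sgn (poly (f e) z)" by (simp only: sgn_mult)
      ultimately show ?thesis by (metis sgn_pos mult_1_left)
    qed
    then have "sign_remainder M f g r" using r(2) unfolding sign_remainder_def by metis
    then show ?thesis using r(1) by blast
  qed
qed

definition closed_above where
  "closed_above k F \<longleftrightarrow>
     (\<forall>N q. k \<le> N \<longrightarrow> (Suc N, q) \<in> F \<longrightarrow> (N, trunc_family (Suc N) q) \<in> F \<and> (N, \<lambda>e. pderiv (q e)) \<in> F) \<and>
     (\<forall>N M f g. k \<le> M \<longrightarrow> M < N \<longrightarrow> (N, f) \<in> F \<longrightarrow> (Suc M, g) \<in> F \<longrightarrow>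
       (\<exists>r. (M, r) \<in> F \<and> sign_remainder M f g r))"

text \<open>Downward induction on \<open>k\<close>: the members added for level \<open>k\<close> all
  have formal degree \<open>k\<close>, so they create no further obligation whose result has degree
  at least \<open>k\<close>. Above the largest formal degree there is nothing to close.\<close>

lemma closed_above_exists:
  fixes S :: "(nat \<times> ((nat \<Rightarrow> 'f::linordered_field) \<Rightarrow> 'f poly)) set"
  assumes "finite S" "\<And>N q. (N, q) \<in> S \<Longrightarrow> poly_family N q"
  shows "\<exists>F. finite F \<and> S \<subseteq> F \<and> (\<forall>N q. (N, q) \<in> F \<longrightarrow> poly_family N q) \<and> closed_above k F"
proof -
  obtain K where K: "\<And>N q. (N, q) \<in> S \<Longrightarrow> N \<le> K"
    using finite_nat_set_iff_bounded_le[of "fst ` S"] assms(1) by force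
  have "closed_above (max k K) S" using K unfolding closed_above_def by fastforce
  then have base: "\<exists>F. finite F \<and> S \<subseteq> F \<and> (\<forall>N q. (N, q) \<in> F \<longrightarrow> poly_family N q) \<and> closed_above (max k K) F"
    using assms by blast
  have step: "\<exists>F. finite F \<and> S \<subseteq> F \<and> (\<forall>N q. (N, q) \<in> F \<longrightarrow> poly_family N q) \<and> closed_above k F"
    if ex: "\<exists>F. finite F \<and> S \<subseteq> F \<and> (\<forall>N q. (N, q) \<in> F \<longrightarrow> poly_family N q) \<and> closed_above (Suc k) F" for k
  proof -
    obtain F where F: "finite F" "S \<subseteq> F" "\<And>N q. (N, q) \<in> F \<Longrightarrow> poly_family N q"
      "closed_above (Suc k) F" using ex by blast
    obtain R where R: "\<And>N f g. (N, f) \<in> F \<Longrightarrow> (Suc k, g) \<in> F \<Longrightarrow>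
        poly_family k (R f g) \<and> sign_remainder k f g (R f g)"
      using sign_remainder_exists F(3) by metis
    define A where "A = {g. (Suc k, g) \<in> F}"
    define F' where "F' = F \<union> Pair k ` (trunc_family (Suc k) ` A \<union> (\<lambda>q e. pderiv (q e)) ` A \<union>
      (\<lambda>(f, g). R f g) ` (snd ` F \<times> A))"
    have "A \<subseteq> snd ` F" unfolding A_def by force
    then have "finite F'" unfolding F'_def using F(1) finite_subset by fastforce
    moreover have "S \<subseteq> F'" using F(2) by (auto simp: F'_def)
    moreover have "poly_family N q" if "(N, q) \<in> F'" for N q
      using that F(3) R poly_family_trunc poly_family_pderiv unfolding F'_def A_def by fastforce
    moreover have "closed_above k F'"
    proof -
      have old: "(N, q) \<in> F" if "(N, q) \<in> F'" "k < N" for N q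
        using that unfolding F'_def by auto
      have unary: "(N, trunc_family (Suc N) q) \<in> F' \<and> (N, \<lambda>e. pderiv (q e)) \<in> F'"
        if "k \<le> N" "(Suc N, q) \<in> F'" for N q
      proof (cases "N = k")
        case True
        then have "q \<in> A" using old that unfolding A_def by simp
        then show ?thesis using True unfolding F'_def by blast
      next
        case False
        then show ?thesis using F(4) old[of "Suc N" q] that unfolding closed_above_def F'_def by simp
      qed
      have binary: "\<exists>r. (M, r) \<in> F' \<and> sign_remainder M f g r"
        if "k \<le> M" "M < N" "(N, f) \<in> F'" "(Suc M, g) \<in> F'" for N M f g
      proof -
        have fg: "(N, f) \<in> F" "(Suc M, g) \<in> F" using old that by auto
        show ?thesis
        proof (cases "M = k")
          case True
          then have "(f, g) \<in> snd ` F \<times> A" using fg unfolding A_def by force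
          then have "(k, R f g) \<in> F'" unfolding F'_def by blast
          then show ?thesis using R fg True by blast
        next
          case False
          then show ?thesis using F(4) fg that unfolding closed_above_def F'_def
            by (metis UnI1 Suc_leI le_neq_implies_less)
        qed
      qed
      show ?thesis unfolding closed_above_def using unary binary by blast
    qed
    ultimately show ?thesis by blast
  qed
  show ?thesis by (rule inc_induct[where j = "max k K"]) (use base step in auto)
qed

definition same_signs where
  "same_signs G e e' \<longleftrightarrow> (\<forall>g\<in>G. sgn (g e) = sgn (g e' :: 'f::linordered_field))"

text \<open>\<open>G\<close> collects all coefficients, up to the formal degree, of a finite closed
  system. If their signs agree at \<open>e\<close> and \<open>e'\<close>, the same coefficients
  vanish, hence the true degrees agree and the closure conditions of
  \<open>closed_pairs_match\<close> hold.\<close>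

theorem families_match:
  fixes S :: "(nat \<times> ((nat \<Rightarrow> 'f::real_closed_field) \<Rightarrow> 'f poly)) set"
  assumes "finite S" "\<And>N q. (N, q) \<in> S \<Longrightarrow> poly_family N q"
  shows "\<exists>G\<subseteq>polyfuns. finite G \<and> (\<forall>e e'. same_signs G e e' \<longrightarrow>
    (\<exists>h. matches h ((\<lambda>(N, q). (q e, q e')) ` S)))"
proof -
  obtain F where F: "finite F" "S \<subseteq> F" "\<And>N q. (N, q) \<in> F \<Longrightarrow> poly_family N q" "closed_above 0 F"
    using closed_above_exists[OF assms, of 0] by blast
  define G where "G = (\<Union>(N, q)\<in>F. (\<lambda>i e. coeff (q e) i) ` {..N})"
  have "G \<subseteq> polyfuns" unfolding G_def by (auto intro!: poly_familyD(2)[OF F(3)])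
  moreover have "finite G" unfolding G_def using F(1) by auto
  moreover have "\<exists>h. matches h ((\<lambda>(N, q). (q e, q e')) ` S)" if same: "same_signs G e e'" for e e'
  proof -
    have sgn_coeff: "sgn (coeff (q e) i) = sgn (coeff (q e') i)" if "(N, q) \<in> F" "i \<le> N" for N q i
      using same that unfolding same_signs_def G_def by fastforce
    \<comment> \<open>Only members whose formal degree is the true one are kept. The others are not
      lost: at \<open>e\<close> and \<open>e'\<close> they coincide with an iterated truncation that
      is kept.\<close>
    define T where "T = {(q e, q e') |N q. (N, q) \<in> F \<and> (N = 0 \<or> coeff (q e) N \<noteq> 0)}"
    have TI: "(q e, q e') \<in> T" if "(N, q) \<in> F" for N q
      using that
    proof (induction N arbitrary: q)
      case 0
      then show ?case unfolding T_def by blast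
    next
      case (Suc N)
      show ?case
      proof (cases "coeff (q e) (Suc N) = 0")
        case True
        then have "coeff (q e') (Suc N) = 0"
          using sgn_coeff[OF Suc.prems, of "Suc N"] by (simp add: sgn_0_0)
        moreover have "(N, trunc_family (Suc N) q) \<in> F"
          using F(4) Suc.prems unfolding closed_above_def by blast
        ultimately show ?thesis using Suc.IH[of "trunc_family (Suc N) q"] True
          by (simp add: trunc_family_def)
      next
        case False
        then show ?thesis using Suc.prems unfolding T_def by blast
      qed
    qed
    have TE: "\<exists>N q. p = q e \<and> p' = q e' \<and> (N, q) \<in> F \<and> degree p = N \<and> degree p' = N \<and>
        (N = 0 \<or> coeff p N \<noteq> 0 \<and> coeff p' N \<noteq> 0)" if pp': "(p, p') \<in> T" for p p'
    proof -
      obtain N q where q: "p = q e" "p' = q e'" "(N, q) \<in> F" "N = 0 \<or> coeff p N \<noteq> 0"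
        using pp' unfolding T_def by blast
      then have nz: "N = 0 \<or> coeff p N \<noteq> 0 \<and> coeff p' N \<noteq> 0"
        using sgn_coeff[OF q(3), of N] by (auto simp: sgn_0_0)
      moreover have "degree p \<le> N" "degree p' \<le> N"
        using poly_familyD(1)[OF F(3)[OF q(3)]] q by auto
      ultimately have "degree p = N" "degree p' = N"
        by (auto intro: antisym le_degree)
      with nz q show ?thesis by blast
    qed
    have "\<exists>h. matches h T"
    proof (rule closed_pairs_match)
      have "T \<subseteq> (\<lambda>(N, q). (q e, q e')) ` F" unfolding T_def by force
      then show "finite T" using F(1) finite_subset by blast
    next
      fix p q assume pq: "(p, q) \<in> T"
      then show "degree p = degree q" using TE by metis
      show "sgn (lead_coeff p) = sgn (lead_coeff q)" using TE[OF pq] sgn_coeff by (metis order_refl)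
      assume "degree p > 0"
      then obtain N f where "p = f e" "q = f e'" "(Suc N, f) \<in> F"
        using TE[OF pq] by (metis gr0_conv_Suc)
      moreover from this have "(N, \<lambda>e. pderiv (f e)) \<in> F" using F(4) unfolding closed_above_def by blast
      ultimately show "(pderiv p, pderiv q) \<in> T" using TI[of N "\<lambda>e. pderiv (f e)"] by simp
    next
      fix f g p q assume fg: "(f, g) \<in> T" and pq: "(p, q) \<in> T"
        and deg: "0 < degree p" "degree p \<le> degree f"
      obtain N f' where f': "f = f' e" "g = f' e'" "(N, f') \<in> F" "degree f = N"
        using TE[OF fg] by blast
      obtain M p' where p': "p = p' e" "q = p' e'" "(Suc M, p') \<in> F" "degree p = Suc M"
          "coeff p (Suc M) \<noteq> 0" "coeff q (Suc M) \<noteq> 0"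
        using TE[OF pq] deg(1) by (metis gr0_conv_Suc less_irrefl)
      have "M < N" using deg(2) f' p' by simp
      then obtain r where r: "(M, r) \<in> F" "sign_remainder M f' p' r"
        using F(4) f'(3) p'(3) unfolding closed_above_def by blast
      have "degree (r e) < degree p"
        using poly_familyD(1)[OF F(3)[OF r(1)], of e] p'(4) by simp
      then show "\<exists>r s. (r, s) \<in> T \<and> degree r < degree p \<and>
        (\<forall>z. poly p z = 0 \<longrightarrow> sgn (poly f z) = sgn (poly r z)) \<and>
        (\<forall>z. poly q z = 0 \<longrightarrow> sgn (poly g z) = sgn (poly s z))"
        using TI[OF r(1)] r(2) p' f' unfolding sign_remainder_def by blast
    qed
    moreover have "(\<lambda>(N, q). (q e, q e')) ` S \<subseteq> T" using TI F(2) by auto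
    ultimately show ?thesis unfolding matches_def by (meson subsetD)
  qed
  ultimately show ?thesis by blast
qed

lemma term_val_family:
  "\<exists>N q. poly_family N q \<and> (\<forall>e x. term_val t (e(n := x)) = poly (q e) (x::'f::linordered_field))"
proof (induction t)
  case (Var m)
  show ?case
  proof (cases "m = n")
    case True
    have "poly_family 1 (\<lambda>_. [:0, 1::'f:])"
      unfolding poly_family_def coeff_pCons
      by (auto simp: polyfuns_0 polyfuns_1 split: nat.split)
    then show ?thesis using True by (intro exI[of _ 1] exI[of _ "\<lambda>_. [:0, 1:]"]) simp
  next
    case False
    have "poly_family 0 (\<lambda>e. [:e m::'f:])"
      unfolding poly_family_def
    proof (intro conjI allI)
      show "(\<lambda>e. coeff [:e m::'f:] i) \<in> polyfuns" for i
        by (cases i) (simp_all add: polyfuns_0 polyfuns_var)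
    qed simp
    then show ?thesis using False by (intro exI[of _ 0] exI[of _ "\<lambda>e. [:e m:]"]) simp
  qed
next
  case Zero
  have "poly_family 0 (\<lambda>_. 0)" by (auto simp: poly_family_def polyfuns_0)
  then show ?case by (intro exI[of _ 0] exI[of _ "\<lambda>_. 0"]) simp
next
  case One
  have "poly_family 0 (\<lambda>_. 1)"
    by (auto simp: poly_family_def polyfuns_0 polyfuns_1)
  then show ?case by (intro exI[of _ 0] exI[of _ "\<lambda>_. 1"]) simp
next
  case (Add s t)
  then obtain N q M r where *: "poly_family N q" "\<forall>e x. term_val s (e(n := x)) = poly (q e) (x::'f)"
    "poly_family M r" "\<forall>e x. term_val t (e(n := x)) = poly (r e) (x::'f)" by blast
  have "poly_family (max N M) (\<lambda>e. q e + r e)"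
    using *(1,3) unfolding poly_family_def by (auto intro!: polyfuns_add degree_add_le intro: le_max_iff_disj[THEN iffD2])
  moreover have "term_val (Add s t) (e(n := x)) = poly (q e + r e) x" for e x
    by (simp only: term_val.simps poly_add *(2,4)[rule_format])
  ultimately show ?case by blast
next
  case (Mult s t)
  then obtain N q M r where *: "poly_family N q" "\<forall>e x. term_val s (e(n := x)) = poly (q e) (x::'f)"
    "poly_family M r" "\<forall>e x. term_val t (e(n := x)) = poly (r e) (x::'f)" by blast
  have "degree (q e * r e) \<le> N + M" for e
    using degree_mult_le[of "q e" "r e"] poly_familyD(1)[OF *(1), of e] poly_familyD(1)[OF *(3), of e] by linarith
  then have "poly_family (N + M) (\<lambda>e. q e * r e)"
    unfolding poly_family_def coeff_mult
    by (auto intro!: polyfuns_sum polyfuns_mult poly_familyD(2)[OF *(1)] poly_familyD(2)[OF *(3)])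
  moreover have "term_val (Mult s t) (e(n := x)) = poly (q e * r e) x" for e x
    by (simp only: term_val.simps poly_mult *(2,4)[rule_format])
  ultimately show ?case by blast
qed

lemma polyfun_family:
  assumes "p \<in> polyfuns"
  shows "\<exists>N q. poly_family N q \<and> (\<forall>e x. p (e(n := x)) = poly (q e) (x::'f::linordered_field))"
proof -
  obtain s t where st: "\<And>e. p e = term_val s e - term_val t e" using assms by (rule polyfunsE) blast
  obtain N q where q: "poly_family N q" "\<forall>e x. term_val s (e(n := x)) = poly (q e) (x::'f)"
    using term_val_family by blast
  obtain M r where r: "poly_family M r" "\<forall>e x. term_val t (e(n := x)) = poly (r e) (x::'f)"
    using term_val_family by blast
  have "poly_family (max N M) (\<lambda>e. q e - r e)"
    using q(1) r(1) unfolding poly_family_def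
    by (auto intro!: polyfuns_diff degree_diff_le intro: le_max_iff_disj[THEN iffD2])
  moreover have "p (e(n := x)) = poly (q e - r e) x" for e x
    by (simp only: st poly_diff q(2)[rule_format] r(2)[rule_format])
  ultimately show ?thesis by blast
qed

section \<open>Truth values of formulas and o-minimality\<close>

definition sign_determined :: "((nat \<Rightarrow> 'f::linordered_field) \<Rightarrow> bool) \<Rightarrow> bool" where
  "sign_determined B \<longleftrightarrow> (\<exists>G\<subseteq>polyfuns. finite G \<and> (\<forall>e e'. same_signs G e e' \<longrightarrow> B e = B e'))"

text \<open>Witnesses \<open>x\<close> for \<open>e\<close> and \<open>h x\<close> for
  \<open>e'\<close> correspond under the matching, and as \<open>h\<close> is onto no witness for
  \<open>e'\<close> is missed.\<close>

lemma sign_determined_Ex: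
  fixes B :: "(nat \<Rightarrow> 'f::real_closed_field) \<Rightarrow> bool"
  assumes "sign_determined B"
  shows "sign_determined (\<lambda>e. \<exists>x. B (e(n := x)))"
proof -
  obtain G where G: "G \<subseteq> polyfuns" "finite G" "\<And>e e'. same_signs G e e' \<Longrightarrow> B e = B e'"
    using assms unfolding sign_determined_def by blast
  have "\<exists>N q. poly_family N q \<and> (\<forall>e x. g (e(n := x)) = poly (q e) x)" if "g \<in> G" for g
    using polyfun_family G(1) that by blast
  then obtain N q where Nq: "\<And>g. g \<in> G \<Longrightarrow> poly_family (N g) (q g)"
      "\<And>g e x. g \<in> G \<Longrightarrow> g (e(n := x)) = poly (q g e) x"
    by metis
  obtain H where H: "H \<subseteq> polyfuns" "finite H" "\<And>e e'. same_signs H e e' \<Longrightarrow>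
      \<exists>h. matches h ((\<lambda>(N, q). (q e, q e')) ` (\<lambda>g. (N g, q g)) ` G)"
    using families_match[of "(\<lambda>g. (N g, q g)) ` G"] G(2) Nq(1) by force
  have "(\<exists>x. B (e(n := x))) = (\<exists>x. B (e'(n := x)))" if same: "same_signs H e e'" for e e'
  proof -
    obtain h where h: "matches h ((\<lambda>(N, q). (q e, q e')) ` (\<lambda>g. (N g, q g)) ` G)"
      using H(3) same by blast
    have "sgn (poly (q g e') (h x)) = sgn (poly (q g e) x)" if "g \<in> G" for g x
      using that by (intro matchesD[OF h]) force
    then have "same_signs G (e(n := x)) (e'(n := h x))" for x
      unfolding same_signs_def by (simp add: Nq(2))
    then have eq: "B (e(n := x)) = B (e'(n := h x))" for x using G(3) by blast
    have "surj h" using h by (simp add: matches_def)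
    then show ?thesis using eq by (metis surjD)
  qed
  then show ?thesis using H(1,2) unfolding sign_determined_def by blast
qed

theorem sign_determined_sat: "sign_determined (sat \<phi> :: (nat \<Rightarrow> 'f::real_closed_field) \<Rightarrow> bool)"
proof (induction \<phi>)
  case (Equal s t)
  have "sat (Equal s t) e = sat (Equal s t) e'"
    if "same_signs {\<lambda>e. term_val s e - term_val t e} e e'" for e e' :: "nat \<Rightarrow> 'f"
  proof -
    have "sgn (term_val s e - term_val t e) = sgn (term_val s e' - term_val t e')"
      using that by (simp add: same_signs_def)
    then show ?thesis by (auto simp: sgn_if split: if_splits)
  qed
  then show ?case unfolding sign_determined_def
    by (intro exI[of _ "{\<lambda>e. term_val s e - term_val t e}"]) (auto intro: polyfunsI)
next
  case (Less s t)
  have "sat (Less s t) e = sat (Less s t) e'"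
    if "same_signs {\<lambda>e. term_val s e - term_val t e} e e'" for e e' :: "nat \<Rightarrow> 'f"
  proof -
    have "sgn (term_val s e - term_val t e) = sgn (term_val s e' - term_val t e')"
      using that by (simp add: same_signs_def)
    then show ?thesis by (auto simp: sgn_if split: if_splits)
  qed
  then show ?case unfolding sign_determined_def
    by (intro exI[of _ "{\<lambda>e. term_val s e - term_val t e}"]) (auto intro: polyfunsI)
next
  case (Neg \<phi>)
  then show ?case unfolding sign_determined_def by simp
next
  case (Conj \<phi> \<psi>)
  then obtain G H where G: "G \<subseteq> polyfuns" "finite G" "\<And>e e'. same_signs G e e' \<Longrightarrow> sat \<phi> e = sat \<phi> (e' :: nat \<Rightarrow> 'f)"
    and H: "H \<subseteq> polyfuns" "finite H" "\<And>e e'. same_signs H e e' \<Longrightarrow> sat \<psi> e = sat \<psi> (e' :: nat \<Rightarrow> 'f)"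
    unfolding sign_determined_def by blast
  have "sat (Conj \<phi> \<psi>) e = sat (Conj \<phi> \<psi>) e'" if "same_signs (G \<union> H) e e'" for e e' :: "nat \<Rightarrow> 'f"
    using that G(3)[of e e'] H(3)[of e e'] by (simp add: same_signs_def)
  then show ?case unfolding sign_determined_def
    using G H by (intro exI[of _ "G \<union> H"]) auto
next
  case (Exists n \<phi>)
  then show ?case using sign_determined_Ex by simp
qed

text \<open>This is o-minimality: with the other variables fixed, the truth value can change only at
  roots of finitely many nonzero polynomials in the variable \<open>n\<close>.\<close>

theorem sat_constant_off_finite:
  fixes e :: "nat \<Rightarrow> 'f::real_closed_field"
  shows "\<exists>Z. finite Z \<and> (\<forall>u v. u \<le> v \<longrightarrow> (\<forall>z\<in>Z. z < u \<or> v < z) \<longrightarrow> sat \<phi> (e(n := u)) = sat \<phi> (e(n := v)))"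
proof -
  obtain G where G: "G \<subseteq> polyfuns" "finite G" "\<And>e e'. same_signs G e e' \<Longrightarrow> sat \<phi> e = sat \<phi> (e' :: nat \<Rightarrow> 'f)"
    using sign_determined_sat unfolding sign_determined_def by blast
  have "\<exists>p. \<forall>x. g (e(n := x)) = poly p x" if "g \<in> G" for g
    using polyfun_family[of g n] G(1) that by blast
  then obtain p where p: "\<And>g x. g \<in> G \<Longrightarrow> g (e(n := x)) = poly (p g) x" by metis
  have "sat \<phi> (e(n := u)) = sat \<phi> (e(n := v))"
    if uv: "u \<le> v" "\<forall>z\<in>critical (p ` G). z < u \<or> v < z" for u v
  proof (rule G(3))
    have "sgn (poly (p g) u) = sgn (poly (p g) v)" if "g \<in> G" for g
    proof (cases "p g = 0")
      case False
      have "poly (p g) z \<noteq> 0" if "u \<le> z" "z \<le> v" for z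
        using uv(2) that False \<open>g \<in> G\<close> unfolding critical_def by fastforce
      then show ?thesis using uv(1) by (intro poly_sgn_eq_if_no_root) auto
    qed simp
    then show "same_signs G (e(n := u)) (e(n := v))" unfolding same_signs_def by (simp add: p)
  qed
  moreover have "finite (critical (p ` G))" using G(2) by (intro finite_critical) simp
  ultimately show ?thesis by (intro exI[of _ "critical (p ` G)"]) simp
qed

section \<open>Dedekind cuts and increasing branches\<close>

lemma dedekind_cutD:
  assumes "dedekind_cut C"
  shows dedekind_lower_down: "x \<in> fst C \<Longrightarrow> y \<le> x \<Longrightarrow> y \<in> fst C"
    and dedekind_upper_iff: "x \<in> snd C \<longleftrightarrow> x \<notin> fst C"
    and dedekind_lower_ne: "fst C \<noteq> {}" and dedekind_upper_ne: "snd C \<noteq> {}"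
    and dedekind_lower_greater: "x \<in> fst C \<Longrightarrow> \<exists>y\<in>fst C. x < y"
    and dedekind_upper_less: "x \<in> snd C \<Longrightarrow> \<exists>y\<in>snd C. y < x"
  using assms unfolding dedekind_cut_def is_cut_def by (auto simp: not_le)

lemma dedekind_less:
  assumes "dedekind_cut C" "x \<in> fst C" "y \<in> snd C"
  shows "x < y"
  using dedekind_lower_down[OF assms(1,2), of y] dedekind_upper_iff[OF assms(1)] assms(3) by force

text \<open>Each point lies on one side of the cut, and that side contains elements still closer to
  the cut, so the interval can be shrunk past the point.\<close>

lemma dedekind_avoid_finite:
  fixes C :: "'f::linordered_field cut"
  assumes C: "dedekind_cut C" and "finite Z"
  shows "\<exists>d\<in>fst C. \<exists>e\<in>snd C. \<forall>z\<in>Z. z < d \<or> e < z"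
  using assms(2)
proof (induction Z)
  case empty
  then show ?case using dedekind_lower_ne[OF C] dedekind_upper_ne[OF C] by blast
next
  case (insert z Z)
  then obtain d e where de: "d \<in> fst C" "e \<in> snd C" "\<forall>z\<in>Z. z < d \<or> e < z" by blast
  show ?case
  proof (cases "z \<in> fst C")
    case True
    then obtain y where y: "y \<in> fst C" "z < y" using dedekind_lower_greater[OF C] by blast
    have "max d y \<in> fst C" using de(1) y(1) by (simp add: max_def)
    moreover have "\<forall>z\<in>insert z Z. z < max d y \<or> e < z" using de(3) y(2) by (auto simp: less_max_iff_disj)
    ultimately show ?thesis using de(2) by blast
  next
    case False
    then obtain y where y: "y \<in> snd C" "y < z"
      using dedekind_upper_less[OF C] dedekind_upper_iff[OF C] by blast
    have "min e y \<in> snd C" using de(2) y(1) by (simp add: min_def)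
    moreover have "\<forall>z\<in>insert z Z. z < d \<or> min e y < z" using de(3) y(2) by (auto simp: min_less_iff_disj)
    ultimately show ?thesis using de(1) by blast
  qed
qed

lemma poly_sgn_left_of_cut:
  fixes p :: "'f::real_closed_field poly"
  assumes C: "dedekind_cut C"
  shows "\<exists>d\<in>fst C. \<exists>\<sigma>. \<forall>x\<in>fst C. d < x \<longrightarrow> sgn (poly p x) = \<sigma>"
proof (cases "p = 0")
  case True
  then show ?thesis using dedekind_lower_ne[OF C] by auto
next
  case False
  obtain d e where de: "d \<in> fst C" "e \<in> snd C" "\<forall>z\<in>{z. poly p z = 0}. z < d \<or> e < z"
    using dedekind_avoid_finite[OF C poly_roots_finite[OF False]] by blast
  have "sgn (poly p x) = sgn (poly p d)" if "x \<in> fst C" "d < x" for x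
    using de that dedekind_less[OF C that(1) de(2)] by (intro poly_sgn_eq_if_no_root[symmetric]) force+
  then show ?thesis using de(1) by blast
qed

text \<open>The finitely many points where the truth value can change leave some interval around the
  cut free, and on it the value below the cut persists above.\<close>

lemma sat_extends_past_cut:
  fixes e :: "nat \<Rightarrow> 'f::real_closed_field"
  assumes C: "dedekind_cut C" and u0: "u0 \<in> fst C"
    and sat: "\<And>u. u \<in> fst C \<Longrightarrow> u0 < u \<Longrightarrow> sat \<phi> (e(n := u))"
  shows "\<exists>w\<in>snd C. sat \<phi> (e(n := w))"
proof -
  obtain Z where Z: "finite Z" "\<And>u v. u \<le> v \<Longrightarrow> \<forall>z\<in>Z. z < u \<or> v < z \<Longrightarrow> sat \<phi> (e(n := u)) = sat \<phi> (e(n := v))"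
    using sat_constant_off_finite[of \<phi> e n] by blast
  obtain d w where dw: "d \<in> fst C" "w \<in> snd C" "\<forall>z\<in>Z. z < d \<or> w < z"
    using dedekind_avoid_finite[OF C Z(1)] by blast
  obtain u where u: "u \<in> fst C" "u0 < u" using dedekind_lower_greater[OF C u0] by blast
  have m: "max d u \<in> fst C" using u(1) dw(1) by (simp add: max_def)
  then have "sat \<phi> (e(n := max d u))" using sat u(2) by (simp add: less_max_iff_disj)
  moreover have "\<forall>z\<in>Z. z < max d u \<or> w < z" using dw(3) by (auto simp: less_max_iff_disj)
  ultimately have "sat \<phi> (e(n := w))"
    using Z(2)[of "max d u" w] dedekind_less[OF C m dw(2)] by simp
  then show ?thesis using dw(2) by blast
qed

text \<open>The interval \<open>(u, v)\<close> extends beyond \<open>lo\<close> and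
  \<open>hi\<close> so that \<open>f lo\<close> and \<open>f hi\<close> can serve as endpoints of
  the image. Cofinality below the cut and monotonicity together send points above \<open>C\<close>
  to points above \<open>D\<close>.\<close>

lemma positively_equivalentI:
  fixes C D :: "'f::linordered_field cut"
  assumes C: "dedekind_cut C" and D: "dedekind_cut D" and lohi: "lo \<in> fst C" "hi \<in> snd C" "u < lo" "hi < v"
    and def: "definable_on {lo<..<hi} f"
    and mono: "\<And>y y'. u < y \<Longrightarrow> y < y' \<Longrightarrow> y' < v \<Longrightarrow> f y < f y'"
    and onto: "\<And>y y' x. u < y \<Longrightarrow> y < y' \<Longrightarrow> y' < v \<Longrightarrow> f y < x \<Longrightarrow> x < f y' \<Longrightarrow> \<exists>z>y. z < y' \<and> f z = x"
    and lower: "\<And>y. y \<in> fst C \<Longrightarrow> u < y \<Longrightarrow> f y \<in> fst D"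
    and cofinal: "\<And>x. x \<in> fst D \<Longrightarrow> \<exists>y\<in>fst C. u < y \<and> x < f y"
  shows "positively_equivalent C D"
proof -
  have lh: "lo < hi" using dedekind_less[OF C] lohi by blast
  have upper: "f y \<in> snd D" if "y \<in> snd C" "y < v" for y
  proof -
    have "f y \<notin> fst D"
    proof
      assume "f y \<in> fst D"
      then obtain z where "z \<in> fst C" "u < z" "f y < f z" using cofinal by blast
      then show False using mono[of z y] dedekind_less[OF C, of z y] that by simp
    qed
    then show ?thesis using dedekind_upper_iff[OF D] by blast
  qed
  have img: "f ` {lo<..<hi} = {f lo<..<f hi}"
  proof
    show "f ` {lo<..<hi} \<subseteq> {f lo<..<f hi}" using mono lohi lh by auto
    show "{f lo<..<f hi} \<subseteq> f ` {lo<..<hi}"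
    proof
      fix x assume "x \<in> {f lo<..<f hi}"
      then obtain z where "lo < z" "z < hi" "f z = x" using onto[of lo hi x] lohi lh by auto
      then show "x \<in> f ` {lo<..<hi}" by auto
    qed
  qed
  have part: "f y \<in> fst D \<longleftrightarrow> y \<in> fst C" if "y \<in> {lo<..<hi}" for y
    using lower[of y] upper[of y] dedekind_upper_iff[OF C] dedekind_upper_iff[OF D] that lohi by force
  have "f ` ({lo<..<hi} \<inter> fst C) = {f lo<..<f hi} \<inter> fst D"
    unfolding img[symmetric] using part by blast
  moreover have "interval_around C {lo<..<hi}" using lohi by (auto simp: interval_around_def)
  moreover have "interval_around D {f lo<..<f hi}"
    using lower[of lo] upper[of hi] lohi unfolding interval_around_def by blast
  moreover have "strict_mono_on {lo<..<hi} f"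
    using mono lohi by (intro strict_mono_onI) auto
  ultimately show ?thesis unfolding positively_equivalent_def using def img by blast
qed

section \<open>Formulas about polynomials in two variables\<close>

primrec tsum :: "(nat \<Rightarrow> rcf_term) \<Rightarrow> nat \<Rightarrow> rcf_term" where
  "tsum f 0 = Zero"
| "tsum f (Suc n) = Add (tsum f n) (f n)"

primrec tpow :: "rcf_term \<Rightarrow> nat \<Rightarrow> rcf_term" where
  "tpow t 0 = One"
| "tpow t (Suc n) = Mult t (tpow t n)"

lemma term_val_tsum: "term_val (tsum f n) e = (\<Sum>i<n. term_val (f i) e)"
  by (induction n) simp_all

lemma term_val_tpow: "term_val (tpow t n) e = term_val t e ^ n"
  by (induction n) simp_all

lemma term_vars_tsum: "term_vars (tsum f n) = (\<Union>i<n. term_vars (f i))"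
  by (induction n) (auto simp: less_Suc_eq)

lemma term_vars_tpow: "term_vars (tpow t n) \<subseteq> term_vars t"
  by (induction n) auto

text \<open>The outer variable is \<open>x\<close>, the coefficients are polynomials in
  \<open>y\<close>. Hence \<open>pderiv P\<close> is the derivative by \<open>x\<close> and
  \<open>map_poly pderiv P\<close> the one by \<open>y\<close>.\<close>

abbreviation poly2 :: "'a::comm_semiring_0 poly poly \<Rightarrow> 'a \<Rightarrow> 'a \<Rightarrow> 'a" where
  "poly2 P x y \<equiv> poly (poly P [:x:]) y"

definition bidegree_less :: "nat \<Rightarrow> nat \<Rightarrow> 'a::zero poly poly \<Rightarrow> bool" where
  "bidegree_less m n P \<longleftrightarrow> (\<forall>i j. m \<le> i \<or> n \<le> j \<longrightarrow> coeff (coeff P i) j = 0)"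

lemma poly_eq_sum_if:
  fixes p :: "'a::comm_ring_1 poly"
  assumes "\<And>i. m \<le> i \<Longrightarrow> coeff p i = 0"
  shows "poly p x = (\<Sum>i<m. coeff p i * x ^ i)"
proof -
  have "(\<Sum>i<m. coeff p i * x ^ i) = (\<Sum>i\<in>{..<m} \<inter> {..degree p}. coeff p i * x ^ i)"
    by (rule sum.mono_neutral_right) (auto simp: coeff_eq_0 not_le)
  also have "\<dots> = (\<Sum>i\<le>degree p. coeff p i * x ^ i)"
    by (rule sum.mono_neutral_left) (auto, metis assms mult_zero_left not_less)
  finally show ?thesis by (simp add: poly_altdef)
qed

lemma poly2_eq_sum:
  fixes P :: "'a::comm_ring_1 poly poly"
  assumes "bidegree_less m n P"
  shows "poly2 P x y = (\<Sum>i<m. \<Sum>j<n. coeff (coeff P i) j * x ^ i * y ^ j)"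
proof -
  have "coeff P i = 0" if "m \<le> i" for i
    using assms that by (intro poly_eqI) (simp add: bidegree_less_def)
  then have "poly2 P x y = (\<Sum>i<m. poly (coeff P i) y * x ^ i)"
    by (subst poly_eq_sum_if[of m]) (simp_all add: poly_sum)
  also have "\<dots> = (\<Sum>i<m. \<Sum>j<n. coeff (coeff P i) j * x ^ i * y ^ j)"
  proof (rule sum.cong)
    fix i
    have "poly (coeff P i) y = (\<Sum>j<n. coeff (coeff P i) j * y ^ j)"
      using assms by (intro poly_eq_sum_if) (simp add: bidegree_less_def)
    then show "poly (coeff P i) y * x ^ i = (\<Sum>j<n. coeff (coeff P i) j * x ^ i * y ^ j)"
      by (simp add: sum_distrib_left mult_ac)
  qed simp
  finally show ?thesis .
qed

text \<open>The general polynomial of bidegree less than \<open>(m, n)\<close>: its coefficients are the variables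
  with index at least \<open>12\<close>, the smaller indices being left to the arguments and to quantifiers.\<close>

definition generic_poly2 :: "nat \<Rightarrow> nat \<Rightarrow> nat \<Rightarrow> nat \<Rightarrow> rcf_term" where
  "generic_poly2 m n vx vy = tsum (\<lambda>i. tsum (\<lambda>j.
     Mult (Mult (Var (12 + (i * n + j))) (tpow (Var vx) i)) (tpow (Var vy) j)) n) m"

definition holds_coeffs :: "nat \<Rightarrow> nat \<Rightarrow> 'f::linordered_field poly poly \<Rightarrow> (nat \<Rightarrow> 'f) \<Rightarrow> bool" where
  "holds_coeffs m n P e \<longleftrightarrow> bidegree_less m n P \<and>
     (\<forall>i<m. \<forall>j<n. e (12 + (i * n + j)) = coeff (coeff P i) j)"

lemma holds_coeffs_upd [simp]: "k < 12 \<Longrightarrow> holds_coeffs m n P (e(k := x)) = holds_coeffs m n P e"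
  by (simp add: holds_coeffs_def)

lemma term_val_generic_poly2:
  "holds_coeffs m n P e \<Longrightarrow> term_val (generic_poly2 m n vx vy) e = poly2 P (e vx) (e vy)"
  unfolding generic_poly2_def
  by (simp add: holds_coeffs_def poly2_eq_sum[of m n] term_val_tsum term_val_tpow)

lemma index_less: "i < m \<Longrightarrow> j < n \<Longrightarrow> i * n + j < m * (n::nat)"
  by (metis add_less_cancel_left less_le_trans mult_Suc mult_le_mono1 add.commute Suc_leI)

lemma term_vars_generic_poly2: "term_vars (generic_poly2 m n vx vy) \<subseteq> {vx, vy} \<union> {12..<12 + m * n}"
  unfolding generic_poly2_def
  using term_vars_tpow[of "Var vx"] term_vars_tpow[of "Var vy"] index_less
  by (fastforce simp: term_vars_tsum)

definition coeff_env :: "nat \<Rightarrow> nat \<Rightarrow> 'f::linordered_field poly poly \<Rightarrow> 'f list" where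
  "coeff_env m n P = map (\<lambda>k. coeff (coeff P (k div n)) (k mod n)) [0..<m * n]"

lemma holds_coeffs_env:
  assumes "bidegree_less m n P" "length xs = 12"
  shows "holds_coeffs m n P (\<lambda>i. if i < length (xs @ coeff_env m n P) then (xs @ coeff_env m n P) ! i else 0)"
  using assms index_less unfolding holds_coeffs_def coeff_env_def by (auto simp: nth_append)

text \<open>Past the cuts \<open>P\<close> need not be monotone in \<open>x\<close> and may have
  several zeros. The first one to the right of \<open>p\<close>, reached through negative values, is
  unique and is described without mentioning a cut.\<close>

definition first_zero :: "'f::linordered_field poly poly \<Rightarrow> 'f \<Rightarrow> 'f \<Rightarrow> 'f \<Rightarrow> bool" where
  "first_zero P p y x \<longleftrightarrow> p < x \<and> poly2 P x y = 0 \<and> (\<forall>x'. p < x' \<and> x' < x \<longrightarrow> poly2 P x' y < 0)"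

text \<open>Layout of the variables: 2 holds \<open>p\<close> and 11 is bound here; in
  \<open>branch_ok_fm\<close> 3 holds \<open>u\<close>, 0 the right end \<open>v\<close>, and 4 to 9
  are bound.\<close>

definition first_zero_fm :: "nat \<Rightarrow> nat \<Rightarrow> nat \<Rightarrow> nat \<Rightarrow> rcf_formula" where
  "first_zero_fm m n vy vx = Conj (Less (Var 2) (Var vx)) (Conj (Equal (generic_poly2 m n vx vy) Zero)
     (Neg (Exists 11 (Conj (Less (Var 2) (Var 11)) (Conj (Less (Var 11) (Var vx))
       (Neg (Less (generic_poly2 m n 11 vy) Zero)))))))"

lemma sat_first_zero_fm:
  assumes "holds_coeffs m n P e" "vx < 11" "vy < 11"
  shows "sat (first_zero_fm m n vy vx) e \<longleftrightarrow> first_zero P (e 2) (e vy) (e vx)"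
  using assms by (auto simp: first_zero_fm_def first_zero_def term_val_generic_poly2)

lemma first_zero_unique: "first_zero P p y x \<Longrightarrow> first_zero P p y x' \<Longrightarrow> x = x'"
  unfolding first_zero_def by (metis less_irrefl linorder_neqE)

text \<open>Totality, strict growth and absence of gaps, phrased through the graph of the branch so
  that they become a first-order formula in the right end \<open>v\<close>.\<close>

definition branch_ok :: "'f::linordered_field poly poly \<Rightarrow> 'f \<Rightarrow> 'f \<Rightarrow> 'f \<Rightarrow> bool" where
  "branch_ok P p u v \<longleftrightarrow>
    (\<forall>y. u < y \<and> y < v \<longrightarrow> (\<exists>x. first_zero P p y x)) \<and>
    (\<forall>y y' x x'. u < y \<and> y < y' \<and> y' < v \<and> first_zero P p y x \<and> first_zero P p y' x' \<longrightarrow> x < x') \<and>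
    (\<forall>y y' x x' x''. u < y \<and> y < y' \<and> y' < v \<and> first_zero P p y x \<and> first_zero P p y' x' \<and> x < x'' \<and> x'' < x'
      \<longrightarrow> (\<exists>y''. y < y'' \<and> y'' < y' \<and> first_zero P p y'' x''))"

definition all_fm :: "nat \<Rightarrow> rcf_formula \<Rightarrow> rcf_formula" where
  "all_fm n \<phi> = Neg (Exists n (Neg \<phi>))"

definition imp_fm :: "rcf_formula \<Rightarrow> rcf_formula \<Rightarrow> rcf_formula" where
  "imp_fm \<phi> \<psi> = Neg (Conj \<phi> (Neg \<psi>))"

definition branch_ok_fm :: "nat \<Rightarrow> nat \<Rightarrow> rcf_formula" where
  "branch_ok_fm m n =
    Conj (all_fm 4 (imp_fm (Conj (Less (Var 3) (Var 4)) (Less (Var 4) (Var 0))) (Exists 5 (first_zero_fm m n 4 5))))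
   (Conj (all_fm 4 (all_fm 5 (all_fm 6 (all_fm 7 (imp_fm (Conj (Less (Var 3) (Var 4)) (Conj (Less (Var 4) (Var 5)) (Conj (Less (Var 5) (Var 0))
        (Conj (first_zero_fm m n 4 6) (first_zero_fm m n 5 7))))) (Less (Var 6) (Var 7)))))))
    (all_fm 4 (all_fm 5 (all_fm 6 (all_fm 7 (all_fm 8 (imp_fm (Conj (Less (Var 3) (Var 4)) (Conj (Less (Var 4) (Var 5)) (Conj (Less (Var 5) (Var 0))
        (Conj (first_zero_fm m n 4 6) (Conj (first_zero_fm m n 5 7) (Conj (Less (Var 6) (Var 8)) (Less (Var 8) (Var 7))))))))
        (Exists 9 (Conj (Less (Var 4) (Var 9)) (Conj (Less (Var 9) (Var 5)) (first_zero_fm m n 9 8)))))))))))"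

lemma sat_branch_ok_fm:
  assumes "holds_coeffs m n P e"
  shows "sat (branch_ok_fm m n) e \<longleftrightarrow> branch_ok P (e 2) (e 3) (e 0)"
  using assms unfolding branch_ok_fm_def branch_ok_def
  by (simp add: all_fm_def imp_fm_def sat_first_zero_fm) blast

definition at_y :: "'a::comm_ring_1 poly poly \<Rightarrow> 'a \<Rightarrow> 'a poly" where
  "at_y P y = map_poly (\<lambda>q. poly q y) P"

lemma poly_at_y: "poly (at_y P y) x = poly2 P x y"
  unfolding at_y_def by (induction P) (simp_all add: map_poly_pCons)

lemma pderiv_at_y: "pderiv (at_y P y) = at_y (pderiv P) y"
  for P :: "'a::idom poly poly"
  by (rule poly_eqI) (simp add: at_y_def coeff_pderiv coeff_map_poly)

lemma pderiv_at_x: "pderiv (poly P [:x:]) = poly (map_poly pderiv P) [:x:]"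
  for P :: "'a::idom poly poly"
  by (induction P) (simp_all add: map_poly_pCons pderiv_add pderiv_mult pderiv_smult)

lemma definable_first_zero:
  fixes P :: "'f::linordered_field poly poly"
  assumes bd: "bidegree_less m n P"
    and f: "\<And>y. lo < y \<Longrightarrow> y < hi \<Longrightarrow> first_zero P p y (f y)"
  shows "definable_on {lo<..<hi} f"
proof -
  \<comment> \<open>The ten entries before the coefficients, together with the two arguments, fill
    the indices below 12; the zeros are padding.\<close>
  define ds where "ds = [p, lo, hi, 0, 0, 0, 0, 0, 0, 0] @ coeff_env m n P"
  define \<psi> where "\<psi> = Conj (Less (Var 3) (Var 0)) (Conj (Less (Var 0) (Var 4)) (first_zero_fm m n 0 1))"
  have len: "length ds = 10 + m * n" by (simp add: ds_def coeff_env_def)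
  have "term_vars (generic_poly2 m n 1 0) \<subseteq> {..<12 + m * n}" "term_vars (generic_poly2 m n 11 0) \<subseteq> {..<12 + m * n}"
    using term_vars_generic_poly2[of m n 1 0] term_vars_generic_poly2[of m n 11 0] by fastforce+
  then have "free_vars \<psi> \<subseteq> {..<2 + length ds}"
    unfolding \<psi>_def first_zero_fm_def len by (auto simp: subset_iff)
  moreover have "models \<psi> (y # x # ds) \<longleftrightarrow> y \<in> {lo<..<hi} \<and> x = f y" for x y
  proof -
    let ?xs = "[y, x, p, lo, hi, 0, 0, 0, 0, 0, 0, 0]"
    let ?e = "\<lambda>i. if i < length (?xs @ coeff_env m n P) then (?xs @ coeff_env m n P) ! i else 0"
    have "holds_coeffs m n P ?e" using bd by (intro holds_coeffs_env) simp_all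
    moreover have e: "?e 0 = y" "?e 1 = x" "?e 2 = p" "?e 3 = lo" "?e 4 = hi" by simp_all
    ultimately have "sat (first_zero_fm m n 0 1) ?e \<longleftrightarrow> first_zero P p y x"
      by (simp only: sat_first_zero_fm)
    then have "sat \<psi> ?e \<longleftrightarrow> lo < y \<and> y < hi \<and> first_zero P p y x"
      unfolding \<psi>_def by (simp only: sat.simps term_val.simps e)
    moreover have list: "y # x # ds = ?xs @ coeff_env m n P" by (simp add: ds_def)
    ultimately have "models \<psi> (y # x # ds) \<longleftrightarrow> lo < y \<and> y < hi \<and> first_zero P p y x"
      by (simp only: models_def list)
    then show ?thesis using f[of y] first_zero_unique[of P p y x "f y"] by auto
  qed
  ultimately show ?thesis unfolding definable_on_def by blast
qed

text \<open>By \<open>incr\<close> and \<open>decr\<close> the zero set near the corner is the graph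
  of an increasing function of \<open>y\<close>. By \<open>right\<close> no row is entirely
  negative, which makes the function total; by \<open>up\<close> every column becomes negative for
  large \<open>y\<close>, which makes it cofinal in the lower part of \<open>D\<close>.\<close>

lemma positively_equivalent_if_increasing_branch:
  fixes C D :: "'f::real_closed_field cut" and P :: "'f poly poly"
  assumes C: "dedekind_cut C" and D: "dedekind_cut D"
    and x0: "x0 \<in> fst D" and y0: "y0 \<in> fst C"
    and incr: "\<And>x x' y. x0 < x \<Longrightarrow> x < x' \<Longrightarrow> x' \<in> fst D \<Longrightarrow> y0 < y \<Longrightarrow> y \<in> fst C \<Longrightarrow> poly2 P x y < poly2 P x' y"
    and decr: "\<And>x y y'. x0 < x \<Longrightarrow> x \<in> fst D \<Longrightarrow> y0 < y \<Longrightarrow> y < y' \<Longrightarrow> y' \<in> fst C \<Longrightarrow> poly2 P x y' < poly2 P x y"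
    and right: "\<And>y. y0 < y \<Longrightarrow> y \<in> fst C \<Longrightarrow> \<exists>x\<in>fst D. x0 < x \<and> 0 \<le> poly2 P x y"
    and up: "\<And>x. x0 < x \<Longrightarrow> x \<in> fst D \<Longrightarrow> \<exists>y\<in>fst C. y0 < y \<and> poly2 P x y \<le> 0"
    and bd: "bidegree_less m n P"
  shows "positively_equivalent C D"
proof -
  have up': "\<exists>y1\<in>fst C. y0 < y1 \<and> (\<forall>y\<in>fst C. y1 < y \<longrightarrow> poly2 P x y < 0)" if x: "x0 < x" "x \<in> fst D" for x
  proof -
    obtain y1 where y1: "y1 \<in> fst C" "y0 < y1" "poly2 P x y1 \<le> 0" using up x by blast
    then have "poly2 P x y < 0" if "y \<in> fst C" "y1 < y" for y
      using decr[OF x y1(2) that(2,1)] by simp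
    then show ?thesis using y1 by blast
  qed
  \<comment> \<open>Zeros are sought to the right of \<open>p\<close>; for \<open>y\<close> beyond
    \<open>u\<close> the value at \<open>p\<close> is negative, so the first zero is reached from
    negative values.\<close>
  obtain p where p: "p \<in> fst D" "x0 < p" using dedekind_lower_greater[OF D x0] by blast
  obtain u where u: "u \<in> fst C" "y0 < u" "\<And>y. y \<in> fst C \<Longrightarrow> u < y \<Longrightarrow> poly2 P p y < 0"
    using up'[OF p(2,1)] by blast
  let ?Z = "first_zero P p"
  have zero_iff: "?Z y x \<longleftrightarrow> p < x \<and> poly2 P x y = 0" if y: "y \<in> fst C" "u < y" and x: "x \<in> fst D" for x y
  proof -
    have "poly2 P x' y < 0" if "p < x'" "x' < x" "poly2 P x y = 0" for x'
      using incr[of x' x y] that x y p(2) u(2) by simp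
    then show ?thesis unfolding first_zero_def by blast
  qed
  have ex_lower: "\<exists>x\<in>fst D. ?Z y x" if y: "y \<in> fst C" "u < y" for y
  proof -
    obtain x where x: "x \<in> fst D" "x0 < x" "0 \<le> poly2 P x y"
      using right[of y] y u(2) by auto
    have "p < x"
    proof (rule ccontr)
      assume "\<not> p < x"
      then have "poly2 P x y \<le> poly2 P p y"
        using incr[of x p y] x p y u(2) by (cases "x = p") auto
      then show False using u(3)[OF y] x(3) by simp
    qed
    obtain z where z: "p < z" "z \<le> x" "poly2 P z y = 0"
    proof (cases "poly2 P x y = 0")
      case True
      then show thesis using that \<open>p < x\<close> by blast
    next
      case False
      then show thesis
        using rcf_poly_IVT[of p x "at_y P y"] that x(3) u(3)[OF y] \<open>p < x\<close> by (auto simp: poly_at_y)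
    qed
    have "z \<in> fst D" using dedekind_lower_down[OF D x(1) z(2)] .
    then show ?thesis using zero_iff[OF y] z by blast
  qed
  have lower: "x \<in> fst D" if "y \<in> fst C" "u < y" "?Z y x" for x y
    using ex_lower[OF that(1,2)] first_zero_unique[OF that(3)] by blast
  have increasing: "x < x'" if "y \<in> fst C" "y' \<in> fst C" "u < y" "y < y'" "?Z y x" "?Z y' x'" for x x' y y'
  proof (rule ccontr)
    assume neg: "\<not> x < x'"
    have x: "x \<in> fst D" "x' \<in> fst D" using lower that by auto
    have xp: "p < x" "p < x'" "poly2 P x y = 0" "poly2 P x' y' = 0"
      using that(5,6) by (auto simp: first_zero_def)
    have "poly2 P x y' < 0" using decr[of x y y'] x xp that p(2) u(2) by simp
    moreover have "poly2 P x' y' \<le> poly2 P x y'"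
      using incr[of x' x y'] neg x xp that p(2) u(2) by (cases "x = x'") auto
    ultimately show False using xp by simp
  qed
  have between: "\<exists>y''. y < y'' \<and> y'' < y' \<and> ?Z y'' x''"
    if "y \<in> fst C" "y' \<in> fst C" "u < y" "y < y'" "?Z y x" "?Z y' x'" "x < x''" "x'' < x'" for x x' x'' y y'
  proof -
    have x: "x \<in> fst D" "x' \<in> fst D" using lower that by auto
    then have x'': "x'' \<in> fst D" using dedekind_lower_down[OF D, of x' x''] that(8) by simp
    have xp: "p < x" "p < x'" "poly2 P x y = 0" "poly2 P x' y' = 0"
      using that(5,6) by (auto simp: first_zero_def)
    have "0 < poly2 P x'' y" using incr[of x x'' y] xp that p(2) u(2) x'' by simp
    moreover have "poly2 P x'' y' < 0" using incr[of x'' x' y'] xp that p(2) u(2) x by simp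
    ultimately obtain y'' where y'': "y < y''" "y'' < y'" "poly2 P x'' y'' = 0"
      using rcf_poly_IVT_value[of y y' "poly P [:x'':]" 0] \<open>y < y'\<close> by blast
    have "y'' \<in> fst C" using dedekind_lower_down[OF C that(2)] y''(2) by simp
    then show ?thesis using zero_iff[of y'' x''] x'' y'' xp that(3,7) by auto
  qed
  have ok: "branch_ok P p u w" if w: "w \<in> fst C" for w
  proof -
    have "y \<in> fst C" if "y < w" for y using dedekind_lower_down[OF C w] that by simp
    then show ?thesis
      unfolding branch_ok_def using ex_lower increasing between by (meson less_trans)
  qed
  define e where "e = (\<lambda>i. if i < length ([0, 0, p, u, 0, 0, 0, 0, 0, 0, 0, 0] @ coeff_env m n P)
    then ([0, 0, p, u, 0, 0, 0, 0, 0, 0, 0, 0] @ coeff_env m n P) ! i else 0)"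
  have hc: "holds_coeffs m n P e" unfolding e_def using bd by (intro holds_coeffs_env) simp_all
  have ee: "e 2 = p" "e 3 = u" by (simp_all add: e_def)
  have sat_ok: "sat (branch_ok_fm m n) (e(0 := w)) \<longleftrightarrow> branch_ok P p u w" for w
    using sat_branch_ok_fm[of m n P "e(0 := w)"] hc ee by simp
  \<comment> \<open>Here the cut is crossed: the formula, with \<open>p\<close>, \<open>u\<close>
    and the coefficients as parameters, holds at every right end in the lower part, hence at some
    \<open>v\<close> in the upper part.\<close>
  obtain v where v: "v \<in> snd C" "branch_ok P p u v"
    using sat_extends_past_cut[OF C u(1), of "branch_ok_fm m n" e 0] sat_ok ok by auto
  obtain hi where hi: "hi \<in> snd C" "hi < v" using dedekind_upper_less[OF C v(1)] by blast
  obtain lo where lo: "lo \<in> fst C" "u < lo" using dedekind_lower_greater[OF C u(1)] by blast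
  define f where "f = (\<lambda>y. THE x. ?Z y x)"
  have fZ: "?Z y (f y)" if "u < y" "y < v" for y
  proof -
    obtain x where "?Z y x" using v(2) \<open>u < y\<close> \<open>y < v\<close> unfolding branch_ok_def by blast
    then show ?thesis unfolding f_def using first_zero_unique by (metis theI)
  qed
  have fI: "f y = x" if "?Z y x" for x y
    unfolding f_def using that first_zero_unique by blast
  show ?thesis
  proof (rule positively_equivalentI[OF C D lo(1) hi(1) lo(2) hi(2)])
    show "definable_on {lo<..<hi} f"
      using lo(2) hi(2) by (intro definable_first_zero[OF bd, of _ _ p]) (simp add: fZ)
    show "f y < f y'" if "u < y" "y < y'" "y' < v" for y y'
      using v(2) fZ[of y] fZ[of y'] that unfolding branch_ok_def by (meson less_trans)
    show "\<exists>z>y. z < y' \<and> f z = x" if yy': "u < y" "y < y'" "y' < v" "f y < x" "x < f y'" for y y' x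
    proof -
      have "?Z y (f y)" "?Z y' (f y')" using yy' by (auto intro: fZ)
      then obtain z where "y < z" "z < y'" "?Z z x" using v(2) yy' unfolding branch_ok_def by blast
      then show ?thesis using fI by blast
    qed
    have below: "y < v" if "y \<in> fst C" for y using dedekind_less[OF C that v(1)] .
    show "f y \<in> fst D" if "y \<in> fst C" "u < y" for y
      using lower[OF that fZ] below that by blast
    show "\<exists>y\<in>fst C. u < y \<and> x < f y" if x: "x \<in> fst D" for x
    proof -
      \<comment> \<open>In column \<open>x'\<close> the values are negative for all large
        \<open>y\<close> of the lower part, so by growth in \<open>x\<close> the zero in such a row
        lies beyond \<open>x'\<close>.\<close>
      define x' where "x' = max x p"
      have x': "x' \<in> fst D" "x0 < x'" using x p by (auto simp: x'_def max_def)
      then obtain y1 where y1: "y1 \<in> fst C" "\<And>y. y \<in> fst C \<Longrightarrow> y1 < y \<Longrightarrow> poly2 P x' y < 0"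
        using up' by blast
      have "max y1 u \<in> fst C" using y1(1) u(1) by (simp add: max_def)
      then obtain y where y: "y \<in> fst C" "max y1 u < y" using dedekind_lower_greater[OF C] by blast
      have neg: "poly2 P x' y < 0" using y1(2) y by simp
      have Z: "?Z y (f y)" using fZ below y by simp
      have "x' < f y"
      proof (rule ccontr)
        assume "\<not> x' < f y"
        moreover have "x0 < f y" "poly2 P (f y) y = 0" using Z p(2) by (auto simp: first_zero_def)
        ultimately have "0 \<le> poly2 P x' y"
          using incr[of "f y" x' y] x' y u(2) by (cases "f y = x'") auto
        then show False using neg by simp
      qed
      then show ?thesis using y by (auto simp: x'_def)
    qed
  qed
qed

section \<open>Constant signs near a pair of cuts\<close>

text \<open>\<open>C\<close> is the cut for \<open>y\<close> and \<open>D\<close> the one for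
  \<open>x\<close>: a branch takes \<open>y\<close> to \<open>x\<close>, so it leads from
  \<open>C\<close> to \<open>D\<close>.\<close>

definition constant_sign_left :: "'f::linordered_field cut \<Rightarrow> 'f cut \<Rightarrow> 'f poly poly \<Rightarrow> bool" where
  "constant_sign_left C D P \<longleftrightarrow> (\<exists>x0\<in>fst D. \<exists>y0\<in>fst C. \<exists>\<sigma>. \<forall>x\<in>fst D. \<forall>y\<in>fst C.
     x0 < x \<longrightarrow> y0 < y \<longrightarrow> sgn (poly2 P x y) = \<sigma>)"

lemma constant_sign_leftI:
  assumes "x0 \<in> fst D" "y0 \<in> fst C"
    "\<And>x y. x \<in> fst D \<Longrightarrow> y \<in> fst C \<Longrightarrow> x0 < x \<Longrightarrow> y0 < y \<Longrightarrow> sgn (poly2 P x y) = \<sigma>"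
  shows "constant_sign_left C D P"
  using assms unfolding constant_sign_left_def by blast

lemma constant_sign_left_uminus:
  assumes "constant_sign_left C D (- P)"
  shows "constant_sign_left C D P"
proof -
  obtain x0 y0 \<sigma> where *: "x0 \<in> fst D" "y0 \<in> fst C"
    "\<forall>x\<in>fst D. \<forall>y\<in>fst C. x0 < x \<longrightarrow> y0 < y \<longrightarrow> sgn (poly2 (- P) x y) = \<sigma>"
    using assms unfolding constant_sign_left_def by blast
  have "sgn (poly2 P x y) = - \<sigma>" if "x \<in> fst D" "y \<in> fst C" "x0 < x" "y0 < y" for x y
  proof -
    have "- sgn (poly2 P x y) = \<sigma>" using * that by (simp add: sgn_minus)
    then show ?thesis by simp
  qed
  with *(1,2) show ?thesis by (rule constant_sign_leftI)
qed

lemma constant_sign_left_if_increasing: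
  fixes C D :: "'f::real_closed_field cut" and P :: "'f poly poly"
  assumes C: "dedekind_cut C" and D: "dedekind_cut D" and neq: "\<not> positively_equivalent C D"
    and bd: "bidegree_less m n P" and x0: "x0 \<in> fst D" and y0: "y0 \<in> fst C"
    and dx: "\<And>x y. x \<in> fst D \<Longrightarrow> y \<in> fst C \<Longrightarrow> x0 < x \<Longrightarrow> y0 < y \<Longrightarrow> 0 < poly2 (pderiv P) x y"
    and dy: "\<And>x y. x \<in> fst D \<Longrightarrow> y \<in> fst C \<Longrightarrow> x0 < x \<Longrightarrow> y0 < y \<Longrightarrow>
      sgn (poly2 (map_poly pderiv P) x y) = \<tau>" and \<tau>: "\<tau> \<noteq> 0"
  shows "constant_sign_left C D P"
proof -
  have incr: "poly2 P x y < poly2 P x' y" if "x0 < x" "x < x'" "x' \<in> fst D" "y0 < y" "y \<in> fst C" for x x' y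
  proof -
    have "poly (at_y P y) x < poly (at_y P y) x'"
    proof (rule poly_increasing[OF that(2)])
      fix t assume "x < t" "t < x'"
      then show "0 < poly (pderiv (at_y P y)) t"
        using dx[of t y] that dedekind_lower_down[OF D that(3), of t] by (simp add: pderiv_at_y poly_at_y)
    qed
    then show ?thesis by (simp add: poly_at_y)
  qed
  obtain x1 y1 where x1: "x1 \<in> fst D" "x0 < x1" and y1: "y1 \<in> fst C" "y0 < y1"
    using dedekind_lower_greater[OF C y0] dedekind_lower_greater[OF D x0] by blast
  have tau: "\<tau> = 1 \<or> \<tau> = -1" using dy[OF x1(1) y1(1) x1(2) y1(2)] \<tau> by (auto simp: sgn_if split: if_splits)
  then show ?thesis
  proof
    assume \<tau>1: "\<tau> = 1"
    have incry: "poly2 P x y < poly2 P x y'" if "x0 < x" "x \<in> fst D" "y0 < y" "y < y'" "y' \<in> fst C" for x y y'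
    proof (rule poly_increasing[OF that(4)])
      fix t assume "y < t" "t < y'"
      then show "0 < poly (pderiv (poly P [:x:])) t"
        using dy[of x t] that dedekind_lower_down[OF C that(5), of t] \<tau>1 by (simp add: pderiv_at_x sgn_1_pos)
    qed
    show ?thesis
    \<comment> \<open>Since \<open>P\<close> grows in both variables, one nonnegative value forces
      positive values on the smaller box that starts there.\<close>
    proof (cases "\<exists>x y. x \<in> fst D \<and> y \<in> fst C \<and> x0 < x \<and> y0 < y \<and> 0 \<le> poly2 P x y")
      case True
      then obtain x y where xy: "x \<in> fst D" "y \<in> fst C" "x0 < x" "y0 < y" "0 \<le> poly2 P x y" by blast
      have "sgn (poly2 P x' y') = 1" if "x' \<in> fst D" "y' \<in> fst C" "x < x'" "y < y'" for x' y'
        using incr[of x x' y] incry[of x' y y'] xy that by (simp add: sgn_1_pos)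
      then show ?thesis using xy(1,2) by (intro constant_sign_leftI)
    next
      case False
      then have "sgn (poly2 P x y) = -1" if "x \<in> fst D" "y \<in> fst C" "x0 < x" "y0 < y" for x y
        using that by (metis not_less sgn_1_neg)
      then show ?thesis using x0 y0 by (intro constant_sign_leftI)
    qed
  next
    assume \<tau>1: "\<tau> = -1"
    have decr: "poly2 P x y' < poly2 P x y" if "x0 < x" "x \<in> fst D" "y0 < y" "y < y'" "y' \<in> fst C" for x y y'
    proof -
      have "poly (- poly P [:x:]) y < poly (- poly P [:x:]) y'"
      proof (rule poly_increasing[OF that(4)])
        fix t assume "y < t" "t < y'"
        then show "0 < poly (pderiv (- poly P [:x:])) t"
          using dy[of x t] that dedekind_lower_down[OF C that(5), of t] \<tau>1
          by (simp add: pderiv_minus pderiv_at_x sgn_1_neg)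
      qed
      then show ?thesis by simp
    qed
    show ?thesis
    proof (rule ccontr)
      assume neg: "\<not> constant_sign_left C D P"
      have "positively_equivalent C D"
      proof (rule positively_equivalent_if_increasing_branch[OF C D x0 y0 incr decr _ _ bd])
        \<comment> \<open>A row with only negative values would make all rows beyond it negative,
          hence the sign constant on a box.\<close>
        fix y assume y: "y0 < y" "y \<in> fst C"
        show "\<exists>x\<in>fst D. x0 < x \<and> 0 \<le> poly2 P x y"
        proof (rule ccontr)
          assume no: "\<not> ?thesis"
          have "sgn (poly2 P x y') = -1" if "x \<in> fst D" "y' \<in> fst C" "x0 < x" "y < y'" for x y'
            using decr[of x y y'] no y that by (force simp: sgn_1_neg)
          then show False using neg x0 y(2) constant_sign_leftI by blast
        qed
      next
        \<comment> \<open>A column with only positive values would make all columns beyond it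
          positive.\<close>
        fix x assume x: "x0 < x" "x \<in> fst D"
        show "\<exists>y\<in>fst C. y0 < y \<and> poly2 P x y \<le> 0"
        proof (rule ccontr)
          assume no: "\<not> ?thesis"
          have "sgn (poly2 P x' y) = 1" if "x' \<in> fst D" "y \<in> fst C" "x < x'" "y0 < y" for x' y
            using incr[of x x' y] no x that by (force simp: sgn_1_pos)
          then show False using neg y0 x(2) constant_sign_leftI by blast
        qed
      qed
      then show False using neq by blast
    qed
  qed
qed

text \<open>The zeros would come arbitrarily close to the cut from below, while a nonzero polynomial
  has none in some interval around it. It serves for derivatives of sign 0.\<close>

lemma pderiv_eq_0_if_zero_left_of_cut:
  fixes p :: "'f::linordered_field poly"
  assumes C: "dedekind_cut C" and d: "d \<in> fst C" and zero: "\<And>x. x \<in> fst C \<Longrightarrow> d < x \<Longrightarrow> poly p x = 0"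
  shows "p = 0"
proof (rule ccontr)
  assume "p \<noteq> 0"
  then have "finite {x. poly p x = 0}" by (rule poly_roots_finite)
  from dedekind_avoid_finite[OF C this]
  obtain l where l: "l \<in> fst C" "\<And>z. z \<in> fst C \<Longrightarrow> poly p z = 0 \<Longrightarrow> z < l"
    using dedekind_less[OF C] by force
  have "max d l \<in> fst C" using d l(1) by (simp add: max_def)
  then obtain x where "x \<in> fst C" "max d l < x" using dedekind_lower_greater[OF C] by blast
  then show False using zero[of x] l(2)[of x] by simp
qed

lemma bidegree_less_derivs:
  fixes P :: "'a::idom poly poly"
  assumes "bidegree_less m n P"
  shows "bidegree_less (m - 1) n (pderiv P)" "bidegree_less m (n - 1) (map_poly pderiv P)"
proof -
  have "coeff (coeff (pderiv P) i) j = of_nat (Suc i) * coeff (coeff P (Suc i)) j" for i j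
    unfolding coeff_pderiv of_nat_poly by simp
  then show "bidegree_less (m - 1) n (pderiv P)"
    using assms by (auto simp: bidegree_less_def simp del: of_nat_Suc)
  have "coeff (coeff (map_poly pderiv P) i) j = of_nat (Suc j) * coeff (coeff P i) (Suc j)" for i j
    by (simp add: coeff_map_poly coeff_pderiv)
  then show "bidegree_less m (n - 1) (map_poly pderiv P)"
    using assms by (auto simp: bidegree_less_def simp del: of_nat_Suc)
qed

text \<open>Each partial derivative lowers one of the two degree bounds. If a derivative vanishes on
  a box, \<open>P\<close> depends there on one variable only and has finitely many sign changes;
  otherwise, up to replacing \<open>P\<close> by \<open>- P\<close>, it increases in
  \<open>x\<close>.\<close>

lemma constant_sign_left_if_not_equivalent:
  fixes C D :: "'f::real_closed_field cut"
  assumes C: "dedekind_cut C" and D: "dedekind_cut D" and neq: "\<not> positively_equivalent C D"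
    and "bidegree_less m n P"
  shows "constant_sign_left C D P"
  using assms(4)
proof (induction "m + n" arbitrary: m n P rule: less_induct)
  case less
  obtain xx yy where xxyy: "xx \<in> fst D" "yy \<in> fst C"
    using dedekind_lower_ne[OF C] dedekind_lower_ne[OF D] by blast
  show ?case
  proof (cases "m = 0 \<or> n = 0")
    case True
    then have "P = 0" using less.prems by (intro poly_eqI) (auto simp: bidegree_less_def)
    then show ?thesis using xxyy by (intro constant_sign_leftI[where \<sigma> = 0]) auto
  next
    case False
    have Dx: "constant_sign_left C D (pderiv P)" and Dy: "constant_sign_left C D (map_poly pderiv P)"
      using False bidegree_less_derivs[OF less.prems] less.hyps[of "m - 1" n] less.hyps[of m "n - 1"] by auto
    obtain xa ya \<sigma> where a: "xa \<in> fst D" "ya \<in> fst C"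
        "\<And>x y. x \<in> fst D \<Longrightarrow> y \<in> fst C \<Longrightarrow> xa < x \<Longrightarrow> ya < y \<Longrightarrow> sgn (poly2 (pderiv P) x y) = \<sigma>"
      using Dx unfolding constant_sign_left_def by blast
    obtain xb yb \<tau> where b: "xb \<in> fst D" "yb \<in> fst C"
        "\<And>x y. x \<in> fst D \<Longrightarrow> y \<in> fst C \<Longrightarrow> xb < x \<Longrightarrow> yb < y \<Longrightarrow> sgn (poly2 (map_poly pderiv P) x y) = \<tau>"
      using Dy unfolding constant_sign_left_def by blast
    define x0 y0 where "x0 = max xa xb" and "y0 = max ya yb"
    have x0: "x0 \<in> fst D" and y0: "y0 \<in> fst C" using a b by (auto simp: x0_def y0_def max_def)
    have dx: "sgn (poly2 (pderiv P) x y) = \<sigma>" and dy: "sgn (poly2 (map_poly pderiv P) x y) = \<tau>"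
      if "x \<in> fst D" "y \<in> fst C" "x0 < x" "y0 < y" for x y
      using a(3)[of x y] b(3)[of x y] that by (auto simp: x0_def y0_def)
    obtain x1 y1 where x1: "x1 \<in> fst D" "x0 < x1" and y1: "y1 \<in> fst C" "y0 < y1"
      using dedekind_lower_greater[OF C y0] dedekind_lower_greater[OF D x0] by blast
    consider "\<sigma> = 0" | "\<tau> = 0" | "\<sigma> = 1" "\<tau> \<noteq> 0" | "\<sigma> = -1" "\<tau> \<noteq> 0"
      using dx[OF x1(1) y1(1) x1(2) y1(2)] by (auto simp: sgn_if split: if_splits)
    then show ?thesis
    proof cases
      case 1
      have eq: "poly2 P x y = poly2 P x1 y" if "y \<in> fst C" "y0 < y" for x y
      proof -
        have "pderiv (at_y P y) = 0"
          using x0 dx that 1 unfolding pderiv_at_y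
          by (intro pderiv_eq_0_if_zero_left_of_cut[OF D x0]) (simp add: poly_at_y sgn_0_0)
        then obtain h where "at_y P y = [:h:]" using pderiv_iszero by blast
        then show ?thesis using poly_at_y[of P y x] poly_at_y[of P y x1] by simp
      qed
      obtain d \<rho> where d: "d \<in> fst C" "\<forall>y\<in>fst C. d < y \<longrightarrow> sgn (poly2 P x1 y) = \<rho>"
        using poly_sgn_left_of_cut[OF C] by blast
      have "max d y0 \<in> fst C" using d(1) y0 by (simp add: max_def)
      have sgn: "sgn (poly2 P x y) = \<rho>" if "y \<in> fst C" "y0 < y" "d < y" for x y
        using d(2) eq[OF that(1,2), of x] that by simp
      show ?thesis
        by (rule constant_sign_leftI[OF x0 \<open>max d y0 \<in> fst C\<close>, of P \<rho>]) (simp add: sgn)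
    next
      case 2
      have eq: "poly2 P x y = poly2 P x y1" if "x \<in> fst D" "x0 < x" for x y
      proof -
        have "pderiv (poly P [:x:]) = 0"
          using dy that 2 unfolding pderiv_at_x
          by (intro pderiv_eq_0_if_zero_left_of_cut[OF C y0]) (simp add: sgn_0_0)
        then obtain h where "poly P [:x:] = [:h:]" using pderiv_iszero by blast
        then show ?thesis by simp
      qed
      obtain d \<rho> where d: "d \<in> fst D" "\<forall>x\<in>fst D. d < x \<longrightarrow> sgn (poly (at_y P y1) x) = \<rho>"
        using poly_sgn_left_of_cut[OF D] by blast
      have sgn: "sgn (poly2 P x y) = \<rho>" if "x \<in> fst D" "x0 < x" "d < x" for x y
        using d(2) eq[OF that(1,2), of y] that unfolding poly_at_y by simp
      have "max d x0 \<in> fst D" using d(1) x0 by (simp add: max_def)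
      then show ?thesis
        by (rule constant_sign_leftI[OF _ y0, of _ _ P \<rho>]) (simp add: sgn)
    next
      case 3
      show ?thesis
        using constant_sign_left_if_increasing[OF C D neq less.prems x0 y0 _ dy 3(2)] dx 3(1)
        by (simp add: sgn_1_pos)
    next
      case 4
      have m: "map_poly pderiv (- P) = - map_poly pderiv P"
        by (rule poly_eqI) (simp add: coeff_map_poly pderiv_minus)
      have "constant_sign_left C D (- P)"
      proof (rule constant_sign_left_if_increasing[OF C D neq _ x0 y0])
        show "bidegree_less m n (- P)" using less.prems by (simp add: bidegree_less_def)
        show "- \<tau> \<noteq> 0" using 4 by simp
        fix x y assume xy: "x \<in> fst D" "y \<in> fst C" "x0 < x" "y0 < y"
        show "0 < poly2 (pderiv (- P)) x y" using dx[OF xy] 4 by (simp add: pderiv_minus sgn_1_neg)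
        show "sgn (poly2 (map_poly pderiv (- P)) x y) = - \<tau>"
          using dy[OF xy] unfolding m by (simp add: sgn_minus)
      qed
      then show ?thesis by (rule constant_sign_left_uminus)
    qed
  qed
qed

lemma bidegree_less_exists: "\<exists>m n. bidegree_less m n P"
proof (intro exI)
  let ?n = "Suc (Max ((\<lambda>i. degree (coeff P i)) ` {..degree P}))"
  have "coeff (coeff P i) j = 0" if "?n \<le> j" for i j
  proof (cases "i \<le> degree P")
    case True
    then have "degree (coeff P i) \<le> Max ((\<lambda>i. degree (coeff P i)) ` {..degree P})"
      by (intro Max_ge) auto
    then have "degree (coeff P i) < j" using that by linarith
    then show ?thesis by (rule coeff_eq_0)
  qed (simp add: coeff_eq_0)
  then show "bidegree_less (Suc (degree P)) ?n P"
    unfolding bidegree_less_def by (auto simp: coeff_eq_0)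
qed

section \<open>From signs of polynomials to truth values near the corner\<close>

lemma term_val_poly2: "\<exists>P. \<forall>x y. term_val t (e(0 := x, 1 := y)) = poly2 P (x::'f::linordered_field) y"
proof (induction t)
  case (Var n)
  consider "n = 0" | "n = 1" | "n > 1" by linarith
  then show ?case
  proof cases
    case 1
    then show ?thesis by (intro exI[of _ "[:0, 1:]"]) simp
  next
    case 2
    then show ?thesis by (intro exI[of _ "[:[:0, 1:]:]"]) simp
  next
    case 3
    then show ?thesis by (intro exI[of _ "[:[:e n:]:]"]) simp
  qed
next
  case Zero
  show ?case by (intro exI[of _ 0]) simp
next
  case One
  show ?case by (intro exI[of _ 1]) simp
next
  case (Add s t)
  then obtain P Q where PQ: "\<forall>x y. term_val s (e(0 := x, 1 := y)) = poly2 P x y"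
    "\<forall>x y. term_val t (e(0 := x, 1 := y)) = poly2 Q x y" by blast
  have "term_val (Add s t) (e(0 := x, 1 := y)) = poly2 (P + Q) x y" for x y
    by (simp only: term_val.simps PQ[rule_format] poly_add)
  then show ?case by blast
next
  case (Mult s t)
  then obtain P Q where PQ: "\<forall>x y. term_val s (e(0 := x, 1 := y)) = poly2 P x y"
    "\<forall>x y. term_val t (e(0 := x, 1 := y)) = poly2 Q x y" by blast
  have "term_val (Mult s t) (e(0 := x, 1 := y)) = poly2 (P * Q) x y" for x y
    by (simp only: term_val.simps PQ[rule_format] poly_mult)
  then show ?case by blast
qed

lemma polyfuns_poly2:
  assumes "g \<in> polyfuns"
  shows "\<exists>P. \<forall>x y. g (e(0 := x, 1 := y)) = poly2 P (x::'f::linordered_field) y"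
proof -
  obtain s t where st: "\<And>e. g e = term_val s e - term_val t e" using assms by (rule polyfunsE) blast
  obtain P where P: "\<forall>x y. term_val s (e(0 := x, 1 := y)) = poly2 P x y" using term_val_poly2 by blast
  obtain Q where Q: "\<forall>x y. term_val t (e(0 := x, 1 := y)) = poly2 Q x y" using term_val_poly2 by blast
  have "g (e(0 := x, 1 := y)) = poly2 (P - Q) x y" for x y
    by (simp only: st P[rule_format] Q[rule_format] poly_diff)
  then show ?thesis by blast
qed

text \<open>Finitely many polynomials decide the truth value, and finitely many boxes at the corner
  have a box in common.\<close>

lemma sat_constant_left:
  fixes C D :: "'f::real_closed_field cut"
  assumes C: "dedekind_cut C" and D: "dedekind_cut D" and neq: "\<not> positively_equivalent C D"
  shows "\<exists>x0\<in>fst D. \<exists>y0\<in>fst C. \<exists>tv. \<forall>x\<in>fst D. \<forall>y\<in>fst C. x0 < x \<longrightarrow> y0 < y \<longrightarrow>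
    sat \<phi> (e(0 := x, 1 := y)) = tv"
proof -
  have "sign_determined (sat \<phi> :: (nat \<Rightarrow> 'f) \<Rightarrow> bool)" by (rule sign_determined_sat)
  then obtain G where G: "finite G" "G \<subseteq> polyfuns" "\<And>e e'. same_signs G e e' \<Longrightarrow> sat \<phi> e = sat \<phi> (e' :: nat \<Rightarrow> 'f)"
    unfolding sign_determined_def by blast
  have "\<exists>x0\<in>fst D. \<exists>y0\<in>fst C. \<exists>\<sigma>. \<forall>x\<in>fst D. \<forall>y\<in>fst C. x0 < x \<longrightarrow> y0 < y \<longrightarrow>
      (\<forall>g\<in>G. sgn (g (e(0 := x, 1 := y))) = \<sigma> g)"
    using G(1,2)
  proof (induction G)
    case empty
    then show ?case using dedekind_lower_ne[OF C] dedekind_lower_ne[OF D] by auto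
  next
    case (insert g G)
    then obtain xa ya \<sigma> where a: "xa \<in> fst D" "ya \<in> fst C"
      "\<forall>x\<in>fst D. \<forall>y\<in>fst C. xa < x \<longrightarrow> ya < y \<longrightarrow> (\<forall>g\<in>G. sgn (g (e(0 := x, 1 := y))) = \<sigma> g)" by blast
    obtain P where P: "\<forall>x y. g (e(0 := x, 1 := y)) = poly2 P x y"
      using polyfuns_poly2[of g e] insert.prems by blast
    obtain m n where "bidegree_less m n P" using bidegree_less_exists by blast
    then have "constant_sign_left C D P"
      by (rule constant_sign_left_if_not_equivalent[OF C D neq])
    then obtain xb yb \<tau> where b: "xb \<in> fst D" "yb \<in> fst C"
      "\<forall>x\<in>fst D. \<forall>y\<in>fst C. xb < x \<longrightarrow> yb < y \<longrightarrow> sgn (poly2 P x y) = \<tau>"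
      unfolding constant_sign_left_def by blast
    have max: "max xa xb \<in> fst D" "max ya yb \<in> fst C" using a(1,2) b(1,2) by (simp_all add: max_def)
    have "sgn (g' (e(0 := x, 1 := y))) = (\<sigma>(g := \<tau>)) g'"
      if "x \<in> fst D" "y \<in> fst C" "max xa xb < x" "max ya yb < y" "g' \<in> insert g G" for x y g'
    proof (cases "g' = g")
      case True
      then show ?thesis using b(3) that(1-4) by (simp only: fun_upd_same P max_less_iff_conj)
    next
      case False
      then show ?thesis using a(3) that by simp
    qed
    then show ?case using max by blast
  qed
  then obtain x0 y0 \<sigma> where xy: "x0 \<in> fst D" "y0 \<in> fst C"
    "\<forall>x\<in>fst D. \<forall>y\<in>fst C. x0 < x \<longrightarrow> y0 < y \<longrightarrow> (\<forall>g\<in>G. sgn (g (e(0 := x, 1 := y))) = \<sigma> g)" by blast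
  obtain x1 y1 where 1: "x1 \<in> fst D" "x0 < x1" "y1 \<in> fst C" "y0 < y1"
    using dedekind_lower_greater[OF C xy(2)] dedekind_lower_greater[OF D xy(1)] by blast
  have "sat \<phi> (e(0 := x, 1 := y)) = sat \<phi> (e(0 := x1, 1 := y1))"
    if "x \<in> fst D" "y \<in> fst C" "x0 < x" "y0 < y" for x y
  proof (rule G(3))
    show "same_signs G (e(0 := x, 1 := y)) (e(0 := x1, 1 := y1))"
      unfolding same_signs_def using xy(3) that 1 by metis
  qed
  then show ?thesis using xy(1,2) by blast
qed

lemma term_val_cong: "(\<And>n. n \<in> term_vars t \<Longrightarrow> e n = e' n) \<Longrightarrow> term_val t e = term_val t e'"
  by (induction t) simp_all

lemma sat_cong: "(\<And>n. n \<in> free_vars \<phi> \<Longrightarrow> e n = e' n) \<Longrightarrow> sat \<phi> e = sat \<phi> e'"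
proof (induction \<phi> arbitrary: e e')
  case (Equal s t)
  then show ?case using term_val_cong[of s e e'] term_val_cong[of t e e'] by simp
next
  case (Less s t)
  then show ?case using term_val_cong[of s e e'] term_val_cong[of t e e'] by simp
next
  case (Exists n \<phi>)
  have "sat \<phi> (e(n := x)) = sat \<phi> (e'(n := x))" for x
    by (rule Exists.IH) (use Exists.prems in simp)
  then show ?case by simp
next
  case (Neg \<phi>)
  have "sat \<phi> e = sat \<phi> e'" by (rule Neg.IH) (use Neg.prems in simp)
  then show ?case by simp
next
  case (Conj \<phi> \<psi>)
  have "sat \<phi> e = sat \<phi> e'" "sat \<psi> e = sat \<psi> e'"
    by (rule Conj.IH; use Conj.prems in simp)+
  then show ?case by simp
qed

section \<open>Perpendicularity of sequences and equivalence of their cuts\<close>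

lemma eventually_above_lower:
  assumes "strict_mono a" "dedekind_cut (induced_cut a)" "x \<in> fst (induced_cut a)"
  shows "\<forall>\<^sub>F t in at_top. x < a t"
proof -
  obtain y where "y \<in> fst (induced_cut a)" "x < y" using dedekind_lower_greater[OF assms(2,3)] by blast
  then obtain t0 where "y \<le> a t0" by (auto simp: induced_cut_def)
  with \<open>x < y\<close> have "x < a t0" by simp
  then show ?thesis
    unfolding eventually_at_top_linorder using assms(1) by (metis less_le_trans strict_mono_less_eq)
qed

lemma range_in_lower: "a t \<in> fst (induced_cut a)"
  by (auto simp: induced_cut_def)

text \<open>Both iterated limits eventually stay inside one box on which the truth value is
  constant.\<close>

lemma perpendicular_if_not_equivalent:
  fixes a :: "'i::linorder \<Rightarrow> 'f::real_closed_field" and b :: "'j::linorder \<Rightarrow> 'f"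
  assumes a: "strict_mono a" "dedekind_cut (induced_cut a)"
    and b: "strict_mono b" "dedekind_cut (induced_cut b)"
    and neq: "\<not> positively_equivalent (induced_cut b) (induced_cut a)"
  shows "perpendicular a b"
  unfolding perpendicular_def
proof (intro allI impI)
  fix \<phi> :: rcf_formula and ds :: "'f list"
  define e where "e = (\<lambda>i. if i < length (0 # 0 # ds) then (0 # 0 # ds) ! i else 0)"
  have env: "models \<phi> (x # y # ds) = sat \<phi> (e(0 := x, 1 := y))" for x y
    unfolding models_def e_def by (rule sat_cong) (auto simp: nth_Cons' )
  obtain x0 y0 tv where *: "x0 \<in> fst (induced_cut a)" "y0 \<in> fst (induced_cut b)"
    "\<And>x y. x \<in> fst (induced_cut a) \<Longrightarrow> y \<in> fst (induced_cut b) \<Longrightarrow> x0 < x \<Longrightarrow> y0 < y \<Longrightarrow>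
      models \<phi> (x # y # ds) = tv"
    using sat_constant_left[OF b(2) a(2) neq, of \<phi> e] unfolding env by metis
  have ev: "\<forall>\<^sub>F t in at_top. x0 < a t" "\<forall>\<^sub>F s in at_top. y0 < b s"
    using eventually_above_lower[OF a *(1)] eventually_above_lower[OF b *(2)] by auto
  have "\<forall>\<^sub>F t in at_top. \<forall>\<^sub>F s in at_top. models \<phi> (a t # b s # ds) = tv"
    using ev(1)
  proof eventually_elim
    case (elim t)
    show ?case using ev(2) by eventually_elim (use elim in \<open>simp add: *(3)[OF range_in_lower range_in_lower]\<close>)
  qed
  moreover have "\<forall>\<^sub>F s in at_top. \<forall>\<^sub>F t in at_top. models \<phi> (a t # b s # ds) = tv"
    using ev(2)
  proof eventually_elim
    case (elim s)
    show ?case using ev(1) by eventually_elim (use elim in \<open>simp add: *(3)[OF range_in_lower range_in_lower]\<close>)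
  qed
  ultimately show "\<exists>tv. (\<forall>\<^sub>F t in at_top. \<forall>\<^sub>F s in at_top. models \<phi> (a t # b s # ds) = tv) \<and>
      (\<forall>\<^sub>F s in at_top. \<forall>\<^sub>F t in at_top. models \<phi> (a t # b s # ds) = tv)" by blast
qed

text \<open>The formula \<open>x < f y\<close>; the fresh variable \<open>k\<close> keeps \<open>x\<close> while \<open>y\<close> and the value of \<open>f\<close>
  are moved to the places \<open>0\<close> and \<open>1\<close> where the formula for the graph of \<open>f\<close> expects them.\<close>

lemma below_image_definable:
  fixes f :: "'f::linordered_field \<Rightarrow> 'f"
  assumes "definable_on S f"
  shows "\<exists>\<phi> ds. free_vars \<phi> \<subseteq> {..<2 + length ds} \<and>
    (\<forall>x y. models \<phi> (x # y # ds) \<longleftrightarrow> y \<in> S \<and> x < f y)"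
proof -
  obtain \<psi> ds where \<psi>: "free_vars \<psi> \<subseteq> {..<2 + length ds}"
      "\<And>x y. models \<psi> (x # y # ds) \<longleftrightarrow> x \<in> S \<and> y = f x"
    using assms unfolding definable_on_def by blast
  define k where "k = 2 + length ds"
  define \<phi> where "\<phi> = Exists k (Conj (Equal (Var k) (Var 0)) (Exists 0 (Conj (Equal (Var 0) (Var 1))
    (Exists 1 (Conj \<psi> (Less (Var k) (Var 1)))))))"
  have "free_vars \<phi> \<subseteq> {..<2 + length ds}" using \<psi>(1) unfolding \<phi>_def k_def by auto
  moreover have "models \<phi> (x # y # ds) \<longleftrightarrow> y \<in> S \<and> x < f y" for x y
  proof -
    let ?e = "\<lambda>i. if i < length (x # y # ds) then (x # y # ds) ! i else 0"
    have k: "k \<noteq> 0" "k \<noteq> 1" by (simp_all add: k_def)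
    have "sat \<psi> (?e(k := x, 0 := y, 1 := z)) = models \<psi> (y # z # ds)" for z
      unfolding models_def
      by (rule sat_cong) (use \<psi>(1) in \<open>auto simp: k_def nth_Cons'\<close>)
    then have "models \<phi> (x # y # ds) \<longleftrightarrow> (\<exists>z. models \<psi> (y # z # ds) \<and> x < z)"
      unfolding models_def[of \<phi>] unfolding \<phi>_def using k k[symmetric] by (simp del: fun_upd_apply add: fun_upd_same fun_upd_other)
    then show ?thesis using \<psi>(2) by auto
  qed
  ultimately show ?thesis by blast
qed

text \<open>The formula \<open>x < f y\<close> separates the limits: for fixed large
  \<open>t\<close> it holds at large \<open>s\<close>, since \<open>f (b s)\<close> passes
  \<open>a t\<close>; for fixed large \<open>s\<close> it fails at large \<open>t\<close>, since
  \<open>a t\<close> passes \<open>f (b s)\<close>.\<close>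

lemma not_perpendicular_if_equivalent:
  fixes a :: "'i::linorder \<Rightarrow> 'f::linordered_field" and b :: "'j::linorder \<Rightarrow> 'f"
  assumes a: "strict_mono a" "dedekind_cut (induced_cut a)"
    and b: "strict_mono b" "dedekind_cut (induced_cut b)"
    and eq: "positively_equivalent (induced_cut b) (induced_cut a)"
  shows "\<not> perpendicular a b"
proof
  assume perp: "perpendicular a b"
  let ?A = "fst (induced_cut a)" and ?B = "fst (induced_cut b)"
  obtain f S T where f: "interval_around (induced_cut b) S" "interval_around (induced_cut a) T"
      "definable_on S f" "strict_mono_on S f" "f ` (S \<inter> ?B) = T \<inter> ?A"
    using eq unfolding positively_equivalent_def by blast
  obtain \<phi> ds where \<phi>: "free_vars \<phi> \<subseteq> {..<2 + length ds}"
      "\<And>x y. models \<phi> (x # y # ds) \<longleftrightarrow> y \<in> S \<and> x < f y"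
    using below_image_definable[OF f(3)] by blast
  obtain tv where tv: "\<forall>\<^sub>F t in at_top. \<forall>\<^sub>F s in at_top. models \<phi> (a t # b s # ds) = tv"
      "\<forall>\<^sub>F s in at_top. \<forall>\<^sub>F t in at_top. models \<phi> (a t # b s # ds) = tv"
    using perp \<phi>(1) unfolding perpendicular_def by blast
  have evT: "\<forall>\<^sub>F t in at_top. a t \<in> T"
  proof -
    obtain d e where de: "d \<in> ?A" "e \<in> snd (induced_cut a)" "T = {d<..<e}"
      using f(2) unfolding interval_around_def by blast
    show ?thesis using eventually_above_lower[OF a de(1)]
      by eventually_elim (use de dedekind_less[OF a(2) range_in_lower] in auto)
  qed
  have evS: "\<forall>\<^sub>F s in at_top. b s \<in> S"
  proof -
    obtain d e where de: "d \<in> ?B" "e \<in> snd (induced_cut b)" "S = {d<..<e}"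
      using f(1) unfolding interval_around_def by blast
    show ?thesis using eventually_above_lower[OF b de(1)]
      by eventually_elim (use de dedekind_less[OF b(2) range_in_lower] in auto)
  qed
  obtain t where t: "a t \<in> T" "\<forall>\<^sub>F s in at_top. models \<phi> (a t # b s # ds) = tv"
    using eventually_happens'[OF _ eventually_conj[OF evT tv(1)]] by auto
  \<comment> \<open>As \<open>f\<close> respects the cuts, \<open>a t\<close> is its value at a
    point of the lower part of the other cut, and the sequence \<open>b\<close> eventually exceeds
    that point.\<close>
  have "a t \<in> f ` (S \<inter> ?B)" unfolding f(5) using t(1) range_in_lower by blast
  then obtain y where y: "y \<in> S" "y \<in> ?B" "a t = f y" by blast
  obtain s where s: "b s \<in> S" "y < b s" "models \<phi> (a t # b s # ds) = tv"
    using eventually_happens'[OF _ eventually_conj[OF evS eventually_conj[OF eventually_above_lower[OF b y(2)] t(2)]]]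
    by auto
  have "a t < f (b s)" using y s f(4) by (simp add: strict_mono_on_def)
  then have "tv" using s \<phi>(2) by blast
  obtain s' where s': "b s' \<in> S" "\<forall>\<^sub>F t in at_top. models \<phi> (a t # b s' # ds) = tv"
    using eventually_happens'[OF _ eventually_conj[OF evS tv(2)]] by auto
  have "f (b s') \<in> ?A" using f(5) s'(1) range_in_lower by blast
  then obtain t' where "f (b s') < a t'" "models \<phi> (a t' # b s' # ds) = tv"
    using eventually_happens'[OF _ eventually_conj[OF eventually_above_lower[OF a] s'(2)]] by auto
  then have "\<not> tv" using \<phi>(2) by auto
  with \<open>tv\<close> show False by blast
qed

theorem theorem42:
  fixes a :: "'i::linorder \<Rightarrow> 'f::real_closed_field"
    and b :: "'j::linorder \<Rightarrow> 'f"
    and C\<^sub>1 C\<^sub>2 :: "'f cut"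
  assumes "strict_mono a" and "indiscernible a"
    and "strict_mono b" and "indiscernible b"
    and "dedekind_cut C\<^sub>1" and "C\<^sub>1 = induced_cut a"
    and "dedekind_cut C\<^sub>2" and "C\<^sub>2 = induced_cut b"
  shows "positively_equivalent C\<^sub>2 C\<^sub>1 \<longleftrightarrow> \<not> perpendicular a b"
proof -
  have cuts: "dedekind_cut (induced_cut a)" "dedekind_cut (induced_cut b)" using assms(5-8) by simp_all
  show ?thesis
    using perpendicular_if_not_equivalent[OF assms(1) cuts(1) assms(3) cuts(2)]
      not_perpendicular_if_equivalent[OF assms(1) cuts(1) assms(3) cuts(2)] assms(6,8) by blast
qed

end
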